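(* Let $N\in\mathbb{N}$, let $h=(2m-1)/2$ for some $m\in\mathbb{N}$, and let $k\in\mathbb{N}$ with $k>h-\frac12$. Then $$\tilde F_N(h,k)=\frac{2(-1)^{h+1/2}}{2^{2h}\pi}\,\tilde F_N(0,k)\left\{\sum_{p=1}^{2h}\sum_{\ell=1}^{p}\binom{2h}{p-\ell}\frac{(-1)^\ell}{\ell}(-N)^{2h-p}\,p!\,\mathcal{C}_N(p,k)+\sum_{p=2h+1}^{kN}\frac{(2h)!\,(p-2h-1)!}{N^{p-2h}}\,\mathcal{C}_N(p,k)\right\}.$$
   Context: $\mathbb{N}=\{1,2,3,\dots\}$. $\mathrm{U}(N)$ is the group of $N\times N$ unitary matrices with normalised (probability) Haar measure $\mu^{\rm Haar}$. For $U\in\mathrm{U}(N)$ with eigenvalues $e^{i\theta_1},\dots,e^{i\theta_N}$ ($\theta_n\in[0,2\pi)$) put $Z_U(\theta)=\prod_{n=1}^N(1-e^{i(\theta_n-\theta)})$ and $V_U(\theta)=\exp\left(iN\frac{\theta+\pi}{2}-i\sum_{n=1}^N\frac{\theta_n}{2}\right)Z_U(\theta)$, which is real-valued. For $h>-1/2$ and $k>h-1/2$, $$\tilde F_N(h,k)=\int_{\mathrm{U}(N)}|V_U(0)|^{2k-2h}\,|V_U'(0)|^{2h}\,d\mu^{\rm Haar}.$$ A partition is a finite weakly decreasing sequence $\lambda=(\lambda_1\ge\dots\ge\lambda_j)$ of positive integers; $\ell(\lambda)=j$ is its number of parts and $|\lambda|=\sum_i\lambda_i$; the empty partition is the only partition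 of $0$. $\lambda\vdash_k p$ means $|\lambda|=p$ and $\ell(\lambda)\le k$. For $b\in\mathbb{R}$, $[b]_\lambda=\prod_{i=1}^{\ell(\lambda)}\prod_{j=1}^{\lambda_i}(b+j-i)$. $h_\lambda$ is the product of all hook-lengths of the boxes in the Ferrers diagram of $\lambda$ (the hook-length of a box is the number of boxes strictly to its right, plus the number strictly below it, plus one). Empty products equal $1$. For $k\in\mathbb{N}$ and $p\in\mathbb{N}\cup\{0\}$, $$\mathcal{C}_N(p,k)=(-2)^p\sum_{\lambda\vdash_k p}\frac{[k]_\lambda\,[-N]_\lambda}{[2k]_\lambda\,h_\lambda^2}.$$ A sum whose lower limit exceeds its upper limit is zero. *)

theory Defs
  imports "HOL-Analysis.Analysis" "HOL-Probability.Probability"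
    "HOL-Computational_Algebra.Computational_Algebra"
begin

section \<open>The unitary group and its Haar measure\<close>

text \<open>The matrix size \<open>N\<close> is \<open>CARD('n)\<close>.\<close>

definition conj_transpose :: "complex ^ 'n ^ 'n \<Rightarrow> complex ^ 'n ^ 'n" where
  "conj_transpose U = (\<chi> i j. cnj (U $ j $ i))"

definition unitary_group :: "(complex ^ 'n ^ 'n) set" where
  "unitary_group = {U. U ** conj_transpose U = mat 1 \<and> conj_transpose U ** U = mat 1}"

text \<open>
  Left invariance determines a Borel probability measure on a compact group uniquely
  (and implies right invariance), so this predicate describes exactly one measure,
  the normalised Haar measure.
\<close>

definition is_haar_measure :: "(complex ^ 'n ^ 'n) measure \<Rightarrow> bool" where
  "is_haar_measure M \<longleftrightarrow>
     sets M = sets (restrict_space borel unitary_group) \<and>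
     prob_space M \<and>
     (\<forall>W\<in>unitary_group. distr M M (\<lambda>U. W ** U) = M)"

section \<open>Characteristic polynomials of unitary matrices\<close>

definition char_polynomial :: "complex ^ 'n ^ 'n \<Rightarrow> complex poly" where
  "char_polynomial A = det (\<chi> i j. (if i = j then [:0, 1:] else 0) - [:A $ i $ j:])"

text \<open>The eigenangles \<open>\<theta>\<^sub>1, \<dots>, \<theta>\<^sub>N\<close> in \<open>[0, 2\<pi>)\<close>, with multiplicity.\<close>

definition eigenangles :: "complex ^ 'n ^ 'n \<Rightarrow> real multiset" where
  "eigenangles U = image_mset Arg2pi (proots (char_polynomial U))"

definition Z_poly :: "complex ^ 'n ^ 'n \<Rightarrow> real \<Rightarrow> complex" where
  "Z_poly U \<theta> = (\<Prod>t\<in>#eigenangles U. 1 - exp (\<i> * of_real (t - \<theta>)))"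

definition V_poly :: "complex ^ 'n ^ 'n \<Rightarrow> real \<Rightarrow> complex" where
  "V_poly U \<theta> =
     exp (\<i> * of_nat CARD('n) * of_real ((\<theta> + pi) / 2)
          - \<i> * of_real (\<Sum>t\<in>#eigenangles U. t / 2)) * Z_poly U \<theta>"

text \<open>Real power with the convention \<open>0\<^sup>0 = 1\<close>, whereas \<open>0 powr 0 = 0\<close>.\<close>

definition real_pow :: "real \<Rightarrow> real \<Rightarrow> real" where
  "real_pow x a = (if a = 0 then 1 else x powr a)"

text \<open>
  \<open>V_poly U\<close> takes real values when \<open>U\<close> is unitary; it is typed as a complex-valued
  function of a real variable, so the norm is the absolute value and the vector derivative
  is the ordinary derivative.
\<close>

definition F_moment :: "(complex ^ 'n ^ 'n) measure \<Rightarrow> real \<Rightarrow> real \<Rightarrow> real" where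
  "F_moment M h k =
     (LINT U|M. real_pow (norm (V_poly U 0)) (2 * k - 2 * h) *
                real_pow (norm (vector_derivative (V_poly U) (at 0))) (2 * h))"

section \<open>Partitions\<close>

definition partitions :: "nat \<Rightarrow> nat \<Rightarrow> nat list set" where
  "partitions k p =
     {la. sorted_wrt (\<ge>) la \<and> (\<forall>x\<in>set la. 0 < x) \<and> sum_list la = p \<and> length la \<le> k}"

lemma finite_partitions: "finite (partitions k p)"
proof (rule finite_subset)
  show "partitions k p \<subseteq> {xs. set xs \<subseteq> {..p} \<and> length xs \<le> k}"
    by (auto simp: partitions_def member_le_sum_list)
  show "finite {xs. set xs \<subseteq> {..p} \<and> length xs \<le> k}"
    by (rule finite_lists_length_le) simp
qed

text \<open>Rows and columns of the Ferrers diagram are numbered from 0.\<close>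

definition gen_pochhammer :: "real \<Rightarrow> nat list \<Rightarrow> real" where
  "gen_pochhammer b la = (\<Prod>i<length la. \<Prod>j<la ! i. b + real j - real i)"

definition hook_length :: "nat list \<Rightarrow> nat \<Rightarrow> nat \<Rightarrow> nat" where
  "hook_length la i j =
     card {j'. j < j' \<and> j' < la ! i} + card {i'. i < i' \<and> i' < length la \<and> j < la ! i'} + 1"

definition hook_product :: "nat list \<Rightarrow> nat" where
  "hook_product la = (\<Prod>i<length la. \<Prod>j<la ! i. hook_length la i j)"

definition C_coeff :: "nat \<Rightarrow> nat \<Rightarrow> nat \<Rightarrow> real" where
  "C_coeff N p k =
     (- 2) ^ p * (\<Sum>la\<in>partitions k p.
        gen_pochhammer (real k) la * gen_pochhammer (- real N) la /
        (gen_pochhammer (2 * real k) la * (real (hook_product la))\<^sup>2))"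

end

theory Submission
  imports Defs "HOL-Complex_Analysis.Laurent_Convergence"
begin

text \<open>
  Invariance of Haar measure under infinitesimal left translations shows that a product of
  \<open>N\<close> complete symmetric functions \<open>h\<^bsub>m\<^sub>1\<^esub> \<cdots> h\<^bsub>m\<^sub>N\<^esub>\<close> of the eigenvalues is orthogonal to \<open>det\<^sup>k\<close>
  unless all \<open>m\<^sub>i\<close> equal \<open>k\<close>. Hence the integral of \<open>\<Prod>\<^sub>l G(z\<^sub>l) cnj(det U)\<^sup>k\<close> is, up to a constant
  independent of \<open>G\<close>, a determinant in the Taylor coefficients of \<open>G\<close>; no Weyl integration formula
  is needed. Moreover \<open>\<bar>V'(0)\<bar> = \<bar>V(0)\<bar> \<bar>X\<bar>/2\<close> with \<open>X = \<Sum>\<^sub>l cot(\<theta>\<^sub>l/2)\<close>, and the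
  characteristic function of \<open>X\<close> under the weight \<open>\<bar>V(0)\<bar>\<^bsup>2k\<^esup>\<close> corresponds to
  \<open>G(z) = (1 - z)\<^bsup>2k\<^esup> exp(-2tz/(1 - z))\<close>. The Cauchy--Binet formula expands the determinant over
  partitions, and the hook length formula turns the result into \<open>e\<^bsup>-Nt\<^esup> \<Sum>\<^sub>p C\<^sub>N(p,k) t\<^sup>p\<close>.
  An odd absolute moment is recovered by writing \<open>\<bar>X\<bar>\<^sup>q = sgn(X) X\<^sup>q\<close> and representing the sign by the
  Dirichlet integral, which requires \<open>\<integral> f\<^bsup>(q)\<^esup>(t)/t dt\<close> for the explicit characteristic function \<open>f\<close>.
\<close>

text \<open>Left translations act simply on linear forms in the entries of \<open>U\<close>, but not
  on its eigenvalues. The bridge is the average of (v* U v)^n over unit vectors v, a multiple of the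
  n-th complete symmetric function. Orthogonality is therefore proved for products of bilinear forms
  in free vectors, and Fubini replaces these by random vectors one form at a time. Columns of an
  independent Haar matrix serve as random vectors, so the sphere needs no measure of its own. The
  eigenvalues are labelled by an arbitrary choice, without regularity in \<open>U\<close>;
  measurability is always obtained through symmetric functions. Since exp(-2tz/(1-z)) has an
  essential singularity at z = 1, the determinant formula is proved at radius r < 1, and the factor
  (1-z)^(2k) controls the limit r -> 1. Constants independent of t are not evaluated: at t = 0 the
  characteristic function is F(0,k), which fixes their product. The two sums of the result differ in
  shape because, for q = 2h, the q-th derivative of exp(-Nt) t^p vanishes at t = 0 when p > q but
  not when p <= q; only the whole polynomial makes the integral against 1/t converge at 0.\<close>

no_notation fps_nth (infixl "$" 75)

section \<open>Characteristic polynomials\<close>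

lemma poly_of_int: "poly (of_int c) x = of_int c"
  by (induction c) auto

lemma poly_char_polynomial:
  "poly (char_polynomial A) x = det (\<chi> i j. (if i = j then x else 0) - A $ i $ j)"
  unfolding char_polynomial_def det_def
  by (auto simp: poly_sum poly_prod poly_of_int if_distrib if_distribR intro!: sum.cong prod.cong)

lemma degree_of_int_mult_prod_le:
  assumes "finite S"
  shows "degree (of_int c * (\<Prod>i\<in>S. f i) :: complex poly) \<le> (\<Sum>i\<in>S. degree (f i))"
proof -
  have "degree (of_int c * (\<Prod>i\<in>S. f i)) \<le> degree (of_int c :: complex poly) + degree (\<Prod>i\<in>S. f i)"
    by (rule degree_mult_le)
  also have "\<dots> \<le> (\<Sum>i\<in>S. degree (f i))"
    using degree_prod_sum_le[OF assms, of f] by simp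
  finally show ?thesis .
qed

text \<open>The Leibniz term of a permutation has degree at most the number of its fixed points, so
  the identity alone reaches the top degree.\<close>

lemma char_polynomial_monic:
  fixes A :: "complex ^ 'n ^ 'n"
  shows "degree (char_polynomial A) = CARD('n)" "lead_coeff (char_polynomial A) = 1"
proof -
  define M :: "'n \<Rightarrow> 'n \<Rightarrow> complex poly" where "M i j = (if i = j then [:0, 1:] else 0) - [:A $ i $ j:]" for i j
  have M: "degree (M i j) = (if i = j then 1 else 0)" for i j
    by (auto simp: M_def)
  define T :: "('n \<Rightarrow> 'n) \<Rightarrow> complex poly" where "T p = of_int (sign p) * (\<Prod>i\<in>UNIV. M i (p i))" for p
  have char: "char_polynomial A = (\<Sum>p | p permutes UNIV. T p)"
    by (simp add: char_polynomial_def det_def T_def M_def)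
  have deg: "degree (T p) \<le> card {i. p i = i}" for p
  proof -
    have "degree (T p) \<le> (\<Sum>i\<in>UNIV. degree (M i (p i)))"
      unfolding T_def by (rule degree_of_int_mult_prod_le) simp
    also have "\<dots> = (\<Sum>i\<in>UNIV. if p i = i then 1 else 0)" by (simp add: M eq_commute)
    also have "\<dots> = card {i. p i = i}" by (simp add: sum.If_cases)
    finally show ?thesis .
  qed
  have degn: "degree (T p) < CARD('n)" if "p \<noteq> id" for p
  proof -
    from that obtain i where "p i \<noteq> i" by (auto simp: fun_eq_iff)
    then have "{i. p i = i} \<subset> UNIV" by blast
    then have "card {i. p i = i} < CARD('n)" by (intro psubset_card_mono) auto
    then show ?thesis using deg[of p] by simp
  qed
  have le: "degree (char_polynomial A) \<le> CARD('n)"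
    unfolding char
  proof (rule degree_sum_le)
    fix p show "degree (T p) \<le> CARD('n)"
      using deg[of p] card_mono[of UNIV "{i. p i = i}"] by simp
  qed (simp add: finite_permutations)
  have lid: "coeff (T id) CARD('n) = 1"
  proof -
    have "lead_coeff (\<Prod>i\<in>(UNIV::'n set). M i i) = (\<Prod>i\<in>(UNIV::'n set). lead_coeff (M i i))"
      by (rule lead_coeff_prod)
    also have "\<dots> = 1" by (intro prod.neutral) (auto simp: M_def)
    finally have "lead_coeff (\<Prod>i\<in>(UNIV::'n set). M i i) = 1" .
    moreover have "degree (\<Prod>i\<in>(UNIV::'n set). M i i) = (\<Sum>i\<in>(UNIV::'n set). degree (M i i))"
      by (rule degree_prod_eq_sum_degree) (auto simp: M_def)
    ultimately show ?thesis by (simp add: T_def sign_id M)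
  qed
  have "coeff (char_polynomial A) CARD('n) = (\<Sum>p | p permutes (UNIV::'n set). coeff (T p) CARD('n))"
    by (simp add: char coeff_sum)
  also have "\<dots> = (\<Sum>p | p permutes (UNIV::'n set). if p = id then 1 else 0)"
    using degn lid by (intro sum.cong) (auto simp: coeff_eq_0)
  also have "\<dots> = 1" by (simp add: permutes_id finite_permutations)
  finally have c: "coeff (char_polynomial A) CARD('n) = 1" .
  then show "degree (char_polynomial A) = CARD('n)"
    using le by (metis coeff_eq_0 le_antisym linorder_not_less zero_neq_one)
  with c show "lead_coeff (char_polynomial A) = 1" by simp
qed

text \<open>The determinant is the characteristic polynomial of \<open>-A\<close> at epsilon, a
  nonzero polynomial with finitely many roots. This moves the coefficient vectors of
  \<open>det_power_orthogonal\<close> into general position.\<close>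

lemma eventually_invertible_shift:
  fixes A :: "complex ^ 'n ^ 'n"
  shows "eventually (\<lambda>\<epsilon>. det (\<chi> i j. A $ i $ j + (if i = j then \<epsilon> else 0)) \<noteq> 0) (at (0::complex))"
proof -
  let ?p = "char_polynomial (\<chi> i j. - A $ i $ j)"
  have "?p \<noteq> 0" using char_polynomial_monic(2)[of "\<chi> i j. - A $ i $ j"] by auto
  then have "finite {x. poly ?p x = 0}" by (rule poly_roots_finite)
  then have "open (- ({x. poly ?p x = 0} - {0}))" by (intro open_Compl finite_imp_closed) auto
  then have "eventually (\<lambda>x. x \<in> - ({x. poly ?p x = 0} - {0})) (at 0)"
    by (intro eventually_at_in_open') auto
  then have "eventually (\<lambda>x. poly ?p x \<noteq> 0) (at 0)"
    using eventually_neq_at_within[of 0 0 UNIV] by eventually_elim auto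
  then show ?thesis by (simp add: poly_char_polynomial add.commute)
qed

lemma det_0_imp_kernel:
  fixes A :: "complex ^ 'n ^ 'n"
  assumes "det A = 0" obtains v where "v \<noteq> 0" "A *v v = 0"
  using assms matrix_left_invertible_ker[of A] invertible_det_nz[of A] invertible_left_inverse[of A] by blast

text \<open>An eigenvector \<open>v\<close> for \<open>z\<close> exists, and \<open>U\<close>
  preserves its norm, so comparing the norms of \<open>U v\<close> and \<open>v\<close> gives |z|^2
  = 1.\<close>

lemma unitary_char_polynomial_root:
  fixes U :: "complex ^ 'n ^ 'n"
  assumes U: "U \<in> unitary_group" and z: "poly (char_polynomial U) z = 0"
  shows "norm z = 1"
proof -
  have "det (\<chi> i j. (if i = j then z else 0) - U $ i $ j) = 0" using z by (simp add: poly_char_polynomial)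
  then obtain v where v: "v \<noteq> 0" "(\<chi> i j. (if i = j then z else 0) - U $ i $ j) *v v = 0"
    by (rule det_0_imp_kernel)
  have ev: "(\<Sum>j\<in>UNIV. U $ i $ j * v $ j) = z * v $ i" for i
  proof -
    have "((\<chi> i j. (if i = j then z else 0) - U $ i $ j) *v v) $ i = 0" using v by simp
    then have "(\<Sum>j\<in>UNIV. ((if i = j then z else 0) - U $ i $ j) * v $ j) = 0"
      by (simp add: matrix_vector_mult_def)
    moreover have "(\<Sum>j\<in>UNIV. ((if i = j then z else 0) - U $ i $ j) * v $ j) =
       (\<Sum>j\<in>UNIV. (if i = j then z * v $ j else 0) - U $ i $ j * v $ j)"
      by (intro sum.cong) (auto simp: algebra_simps)
    ultimately show ?thesis by (simp add: sum_subtractf)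
  qed
  have orth: "(\<Sum>i\<in>UNIV. cnj (U $ i $ j) * U $ i $ k) = (if j = k then 1 else 0)" for j k
  proof -
    have "(conj_transpose U ** U) $ j $ k = (if j = k then 1 else 0)"
      using U by (simp add: unitary_group_def mat_def)
    then show ?thesis by (simp add: matrix_matrix_mult_def conj_transpose_def)
  qed
  define S where "S = (\<Sum>i\<in>UNIV. cnj (v $ i) * v $ i)"
  have "cnj z * z * S = (\<Sum>i\<in>UNIV. cnj (z * v $ i) * (z * v $ i))"
    by (simp add: S_def sum_distrib_left mult_ac)
  also have "\<dots> = (\<Sum>i\<in>UNIV. (\<Sum>j\<in>UNIV. cnj (U $ i $ j) * cnj (v $ j)) * (\<Sum>k\<in>UNIV. U $ i $ k * v $ k))"
    by (simp flip: ev)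
  also have "\<dots> = (\<Sum>i\<in>UNIV. \<Sum>j\<in>UNIV. \<Sum>k\<in>UNIV. cnj (U $ i $ j) * cnj (v $ j) * (U $ i $ k * v $ k))"
    by (simp add: sum_product)
  also have "\<dots> = (\<Sum>j\<in>UNIV. \<Sum>i\<in>UNIV. \<Sum>k\<in>UNIV. cnj (U $ i $ j) * cnj (v $ j) * (U $ i $ k * v $ k))"
    by (rule sum.swap)
  also have "\<dots> = (\<Sum>j\<in>UNIV. \<Sum>k\<in>UNIV. \<Sum>i\<in>UNIV. cnj (U $ i $ j) * cnj (v $ j) * (U $ i $ k * v $ k))"
    by (intro sum.cong refl sum.swap)
  also have "\<dots> = (\<Sum>j\<in>UNIV. \<Sum>k\<in>UNIV. cnj (v $ j) * v $ k * (\<Sum>i\<in>UNIV. cnj (U $ i $ j) * U $ i $ k))"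
    by (simp add: sum_distrib_left mult_ac)
  also have "\<dots> = (\<Sum>j\<in>UNIV. \<Sum>k\<in>UNIV. if j = k then cnj (v $ j) * v $ k else 0)"
    unfolding orth by (intro sum.cong) auto
  also have "\<dots> = S" by (simp add: S_def)
  finally have eq: "cnj z * z * S = S" .
  have "S = complex_of_real (\<Sum>i\<in>UNIV. (norm (v $ i))\<^sup>2)"
    by (simp add: S_def complex_norm_square mult.commute del: of_real_power)
  moreover have "(\<Sum>i\<in>UNIV. (norm (v $ i))\<^sup>2) \<noteq> 0"
  proof
    assume "(\<Sum>i\<in>UNIV. (norm (v $ i))\<^sup>2) = 0"
    then have "\<forall>i. v $ i = 0" by (simp add: sum_nonneg_eq_0_iff)
    with v show False by (simp add: vec_eq_iff)
  qed
  ultimately have "S \<noteq> 0" by (simp only: of_real_eq_0_iff not_False_eq_True)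
  with eq have "z * cnj z = 1" by (simp add: mult.commute)
  then have "complex_of_real ((norm z)\<^sup>2) = 1" by (simp only: complex_norm_square)
  then have "(norm z)\<^sup>2 = 1" using of_real_eq_1_iff by blast
  then show ?thesis by (metis abs_norm_cancel power2_eq_1_iff abs_1 abs_neg_one)
qed

text \<open>Eigenvalues are indexed by the matrix index type itself, so that they can be the nodes
  of Vandermonde matrices of the same size.\<close>

lemma multiset_eq_image_UNIV:
  assumes "size M = CARD('n)"
  obtains z :: "'n::finite \<Rightarrow> 'a" where "M = image_mset z (mset_set UNIV)"
proof -
  obtain xs where xs: "mset xs = M" using ex_mset by blast
  obtain e :: "'n \<Rightarrow> nat" where e: "bij_betw e UNIV {0..<CARD('n)}"
    using ex_bij_betw_finite_nat[of "UNIV :: 'n set"] by auto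
  have "length xs = CARD('n)" using xs assms by auto
  then have "M = image_mset (\<lambda>i. xs ! i) (mset_set {0..<CARD('n)})"
    using xs by (metis mset_map mset_upt map_nth)
  also have "mset_set {0..<CARD('n)} = image_mset e (mset_set UNIV)"
    using e by (metis bij_betw_def image_mset_mset_set)
  finally have "M = image_mset (\<lambda>i. xs ! e i) (mset_set UNIV)" by (simp add: multiset.map_comp comp_def)
  then show ?thesis by (rule that)
qed

lemma char_polynomial_factor:
  fixes U :: "complex ^ 'n ^ 'n"
  obtains z :: "'n \<Rightarrow> complex" where "char_polynomial U = (\<Prod>i\<in>UNIV. [:- z i, 1:])"
proof -
  have "size (proots (char_polynomial U)) = CARD('n)"
    by (simp add: size_proots_complex char_polynomial_monic)
  then obtain z :: "'n \<Rightarrow> complex" where z: "proots (char_polynomial U) = image_mset z (mset_set UNIV)"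
    by (rule multiset_eq_image_UNIV)
  have "char_polynomial U = smult (lead_coeff (char_polynomial U)) (\<Prod>x\<in>#proots (char_polynomial U). [:- x, 1:])"
    by (rule complex_poly_decompose_multiset[symmetric])
  also have "\<dots> = (\<Prod>i\<in>UNIV. [:- z i, 1:])"
    unfolding z char_polynomial_monic(2) by (simp add: prod_unfold_prod_mset image_mset.compositionality comp_def)
  finally show ?thesis by (rule that)
qed

text \<open>For nonzero \<open>x\<close> each row of 1/x - U is scaled by \<open>x\<close>. The
  reversed characteristic polynomial is the reciprocal of the generating series of the complete
  symmetric functions.\<close>

lemma det_one_minus_eq_prod:
  fixes U :: "complex ^ 'n ^ 'n" and z :: "'n \<Rightarrow> complex"
  assumes "char_polynomial U = (\<Prod>i\<in>UNIV. [:- z i, 1:])"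
  shows "det (\<chi> i j. (if i = j then 1 else 0) - x * U $ i $ j) = (\<Prod>i\<in>UNIV. 1 - x * z i)"
proof (cases "x = 0")
  case True
  have "(\<chi> i j. if i = j then 1 else 0) = (mat 1 :: complex ^ 'n ^ 'n)" by (simp add: mat_def)
  then show ?thesis using True by simp
next
  case False
  have "det (\<chi> i. x *s (\<chi> j. (if i = j then 1 / x else 0) - U $ i $ j)) =
     (\<Prod>i\<in>(UNIV::'n set). x) * det (\<chi> i. (\<chi> j. (if i = j then 1 / x else 0) - U $ i $ j))"
    by (rule det_rows_mul)
  also have "(\<chi> i. x *s (\<chi> j. (if i = j then 1 / x else 0) - U $ i $ j)) =
     (\<chi> i j. (if i = j then 1 else 0) - x * U $ i $ j)"
    using False by (auto simp: vec_eq_iff algebra_simps)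
  also have "det (\<chi> i. (\<chi> j. (if i = j then 1 / x else 0) - U $ i $ j)) = (\<Prod>i\<in>UNIV. 1 / x - z i)"
    unfolding poly_char_polynomial[symmetric] assms by (simp add: poly_prod)
  also have "(\<Prod>i\<in>(UNIV::'n set). x) * (\<Prod>i\<in>UNIV. 1 / x - z i) = (\<Prod>i\<in>UNIV. x * (1 / x - z i))"
    by (rule prod.distrib[symmetric])
  also have "\<dots> = (\<Prod>i\<in>UNIV. 1 - x * z i)" using False by (simp add: right_diff_distrib)
  finally show ?thesis .
qed

section \<open>Polynomial functions on the unitary group and Haar measure\<close>

definition conj_entries :: "complex ^ 'n ^ 'm \<Rightarrow> complex ^ 'n ^ 'm" where
  "conj_entries U = (\<chi> i j. cnj (U $ i $ j))"

lemma conj_entries_nth [simp]: "conj_entries U $ i $ j = cnj (U $ i $ j)"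
  by (simp add: conj_entries_def)

lemma unitary_entry_sum:
  assumes "U \<in> unitary_group" shows "(\<Sum>j\<in>UNIV. (norm (U $ i $ j))\<^sup>2) = 1"
proof -
  have "(U ** conj_transpose U) $ i $ i = 1" using assms by (simp add: unitary_group_def mat_def)
  then have "(\<Sum>j\<in>UNIV. U $ i $ j * cnj (U $ i $ j)) = 1"
    by (simp add: matrix_matrix_mult_def conj_transpose_def)
  then have "complex_of_real (\<Sum>j\<in>UNIV. (norm (U $ i $ j))\<^sup>2) = 1"
    by (simp only: of_real_sum complex_norm_square)
  then show ?thesis using of_real_eq_1_iff by blast
qed

lemma unitary_entry_le_1:
  assumes "U \<in> unitary_group" shows "norm (U $ i $ j) \<le> 1"
proof -
  have "(norm (U $ i $ j))\<^sup>2 \<le> (\<Sum>j\<in>UNIV. (norm (U $ i $ j))\<^sup>2)"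
    by (rule member_le_sum) auto
  then have "(norm (U $ i $ j))\<^sup>2 \<le> 1" using unitary_entry_sum[OF assms] by simp
  then show ?thesis by (simp add: abs_square_le_1)
qed

lemma conj_transpose_mult: "conj_transpose (A ** B) = conj_transpose B ** conj_transpose A"
  by (simp add: vec_eq_iff matrix_matrix_mult_def conj_transpose_def mult.commute)

lemma unitary_mult:
  assumes "U \<in> unitary_group" "W \<in> unitary_group" shows "W ** U \<in> unitary_group"
proof -
  have "W ** U ** (conj_transpose U ** conj_transpose W) = W ** (U ** conj_transpose U) ** conj_transpose W"
    by (simp only: matrix_mul_assoc)
  moreover have "conj_transpose U ** conj_transpose W ** (W ** U) = conj_transpose U ** (conj_transpose W ** W) ** U"
    by (simp only: matrix_mul_assoc)
  ultimately show ?thesis using assms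
    by (simp add: unitary_group_def conj_transpose_mult)
qed

text \<open>On the unitary group the second argument is always the entrywise conjugate of the first.\<close>

inductive matpoly :: "(complex ^ 'n ^ 'n \<Rightarrow> complex ^ 'n ^ 'n \<Rightarrow> complex) \<Rightarrow> bool" where
  matpoly_const: "matpoly (\<lambda>P Q. c)"
| matpoly_fst: "matpoly (\<lambda>P Q. P $ i $ j)"
| matpoly_snd: "matpoly (\<lambda>P Q. Q $ i $ j)"
| matpoly_add: "matpoly F \<Longrightarrow> matpoly G \<Longrightarrow> matpoly (\<lambda>P Q. F P Q + G P Q)"
| matpoly_mult: "matpoly F \<Longrightarrow> matpoly G \<Longrightarrow> matpoly (\<lambda>P Q. F P Q * G P Q)"

lemma matpoly_sum: "(\<And>i. i \<in> A \<Longrightarrow> matpoly (F i)) \<Longrightarrow> matpoly (\<lambda>P Q. \<Sum>i\<in>A. F i P Q)"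
  by (induction A rule: infinite_finite_induct) (auto intro: matpoly.intros)

lemma matpoly_prod: "(\<And>i. i \<in> A \<Longrightarrow> matpoly (F i)) \<Longrightarrow> matpoly (\<lambda>P Q. \<Prod>i\<in>A. F i P Q)"
  by (induction A rule: infinite_finite_induct) (auto intro: matpoly.intros)

lemma matpoly_power: "matpoly F \<Longrightarrow> matpoly (\<lambda>P Q. F P Q ^ n)"
  by (induction n) (auto intro: matpoly.intros)

lemma matpoly_det_snd: "matpoly (\<lambda>P Q. det Q)"
  unfolding det_def by (intro matpoly_sum matpoly_mult matpoly_prod matpoly.intros)

text \<open>For skew-Hermitian \<open>X\<close>, conjugating a path with derivative
  \<open>X ** p 0\<close> gives exactly the rule imposed on \<open>q\<close>; written with the
  transpose, it makes sense for every complex \<open>X\<close>. The coefficients \<open>D\<close>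
  are chosen before \<open>X\<close>, so the derivative is linear in \<open>X\<close>.\<close>

lemma matpoly_derivative:
  fixes F :: "complex ^ 'n ^ 'n \<Rightarrow> complex ^ 'n ^ 'n \<Rightarrow> complex"
  assumes "matpoly F"
  shows "\<exists>D. (\<forall>r s. matpoly (D r s)) \<and> (\<forall>X p q.
    (\<forall>i j. ((\<lambda>\<theta>::real. p \<theta> $ i $ j) has_vector_derivative (X ** p 0) $ i $ j) (at 0)) \<longrightarrow>
    (\<forall>i j. ((\<lambda>\<theta>. q \<theta> $ i $ j) has_vector_derivative - (transpose X ** q 0) $ i $ j) (at 0)) \<longrightarrow>
    ((\<lambda>\<theta>. F (p \<theta>) (q \<theta>)) has_vector_derivative
        (\<Sum>r\<in>UNIV. \<Sum>s\<in>UNIV. X $ r $ s * D r s (p 0) (q 0))) (at 0))"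
  using assms
proof (induction rule: matpoly.induct)
  case (matpoly_const c)
  show ?case by (rule exI[of _ "\<lambda>r s P Q. 0"]) (auto intro: matpoly.intros)
next
  case (matpoly_fst i j)
  show ?case
  proof (rule exI[of _ "\<lambda>r s P Q. if r = i then P $ s $ j else 0"], intro conjI allI impI)
    fix r s show "matpoly (\<lambda>P Q. if r = i then P $ s $ j else (0::complex))"
      by (cases "r = i") (auto intro: matpoly.intros)
  next
    fix X and p q :: "real \<Rightarrow> complex ^ 'n ^ 'n"
    assume p: "\<forall>i j. ((\<lambda>\<theta>::real. p \<theta> $ i $ j) has_vector_derivative (X ** p 0) $ i $ j) (at 0)"
    have "(\<Sum>r\<in>UNIV. \<Sum>s\<in>UNIV. X $ r $ s * (if r = i then p 0 $ s $ j else 0))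
        = (\<Sum>r\<in>UNIV. if r = i then \<Sum>s\<in>UNIV. X $ r $ s * p 0 $ s $ j else 0)"
      by (intro sum.cong) auto
    also have "\<dots> = (X ** p 0) $ i $ j" by (simp add: matrix_matrix_mult_def)
    finally show "((\<lambda>\<theta>. p \<theta> $ i $ j) has_vector_derivative
       (\<Sum>r\<in>UNIV. \<Sum>s\<in>UNIV. X $ r $ s * (if r = i then p 0 $ s $ j else 0))) (at 0)"
      using p by simp
  qed
next
  case (matpoly_snd i j)
  show ?case
  proof (rule exI[of _ "\<lambda>r s P Q. if s = i then - (Q $ r $ j) else 0"], intro conjI allI impI)
    fix r s show "matpoly (\<lambda>P Q. if s = i then - (Q $ r $ j) else (0::complex))"
    proof (cases "s = i")
      case True
      have "matpoly (\<lambda>P Q. (-1) * (Q $ r $ j))" by (intro matpoly.intros)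
      with True show ?thesis by simp
    qed (auto intro: matpoly.intros)
  next
    fix X and p q :: "real \<Rightarrow> complex ^ 'n ^ 'n"
    assume q: "\<forall>i j. ((\<lambda>\<theta>. q \<theta> $ i $ j) has_vector_derivative - (transpose X ** q 0) $ i $ j) (at 0)"
    have "(\<Sum>r\<in>UNIV. \<Sum>s\<in>UNIV. X $ r $ s * (if s = i then - (q 0 $ r $ j) else 0))
        = (\<Sum>r\<in>UNIV. \<Sum>s\<in>UNIV. if s = i then - (X $ r $ s * q 0 $ r $ j) else 0)"
      by (intro sum.cong) auto
    also have "\<dots> = - (transpose X ** q 0) $ i $ j"
      by (simp add: matrix_matrix_mult_def transpose_def sum_negf)
    finally show "((\<lambda>\<theta>. q \<theta> $ i $ j) has_vector_derivative
       (\<Sum>r\<in>UNIV. \<Sum>s\<in>UNIV. X $ r $ s * (if s = i then - (q 0 $ r $ j) else 0))) (at 0)"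
      using q by simp
  qed
next
  case (matpoly_add F G)
  then obtain D E where D: "\<forall>r s. matpoly (D r s)" and E: "\<forall>r s. matpoly (E r s)"
    and d: "\<And>X p q. (\<forall>i j. ((\<lambda>\<theta>::real. p \<theta> $ i $ j) has_vector_derivative (X ** p 0) $ i $ j) (at 0)) \<Longrightarrow>
    (\<forall>i j. ((\<lambda>\<theta>. q \<theta> $ i $ j) has_vector_derivative - (transpose X ** q 0) $ i $ j) (at 0)) \<Longrightarrow>
    ((\<lambda>\<theta>. F (p \<theta>) (q \<theta>)) has_vector_derivative (\<Sum>r\<in>UNIV. \<Sum>s\<in>UNIV. X $ r $ s * D r s (p 0) (q 0))) (at 0)"
    and e: "\<And>X p q. (\<forall>i j. ((\<lambda>\<theta>::real. p \<theta> $ i $ j) has_vector_derivative (X ** p 0) $ i $ j) (at 0)) \<Longrightarrow>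
    (\<forall>i j. ((\<lambda>\<theta>. q \<theta> $ i $ j) has_vector_derivative - (transpose X ** q 0) $ i $ j) (at 0)) \<Longrightarrow>
    ((\<lambda>\<theta>. G (p \<theta>) (q \<theta>)) has_vector_derivative (\<Sum>r\<in>UNIV. \<Sum>s\<in>UNIV. X $ r $ s * E r s (p 0) (q 0))) (at 0)"
    by blast
  show ?case
  proof (rule exI[of _ "\<lambda>r s P Q. D r s P Q + E r s P Q"], intro conjI allI impI, goal_cases)
    case (1 r s) then show ?case using D E by (intro matpoly.intros) auto
  next
    case (2 X p q)
    have "(\<Sum>r\<in>UNIV. \<Sum>s\<in>UNIV. X $ r $ s * (D r s (p 0) (q 0) + E r s (p 0) (q 0))) =
      (\<Sum>r\<in>UNIV. \<Sum>s\<in>UNIV. X $ r $ s * D r s (p 0) (q 0)) + (\<Sum>r\<in>UNIV. \<Sum>s\<in>UNIV. X $ r $ s * E r s (p 0) (q 0))"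
      by (simp add: algebra_simps sum.distrib)
    then show ?case using has_vector_derivative_add[OF d[OF 2] e[OF 2]] by simp
  qed
next
  case (matpoly_mult F G)
  then obtain D E where D: "\<forall>r s. matpoly (D r s)" and E: "\<forall>r s. matpoly (E r s)"
    and d: "\<And>X p q. (\<forall>i j. ((\<lambda>\<theta>::real. p \<theta> $ i $ j) has_vector_derivative (X ** p 0) $ i $ j) (at 0)) \<Longrightarrow>
    (\<forall>i j. ((\<lambda>\<theta>. q \<theta> $ i $ j) has_vector_derivative - (transpose X ** q 0) $ i $ j) (at 0)) \<Longrightarrow>
    ((\<lambda>\<theta>. F (p \<theta>) (q \<theta>)) has_vector_derivative (\<Sum>r\<in>UNIV. \<Sum>s\<in>UNIV. X $ r $ s * D r s (p 0) (q 0))) (at 0)"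
    and e: "\<And>X p q. (\<forall>i j. ((\<lambda>\<theta>::real. p \<theta> $ i $ j) has_vector_derivative (X ** p 0) $ i $ j) (at 0)) \<Longrightarrow>
    (\<forall>i j. ((\<lambda>\<theta>. q \<theta> $ i $ j) has_vector_derivative - (transpose X ** q 0) $ i $ j) (at 0)) \<Longrightarrow>
    ((\<lambda>\<theta>. G (p \<theta>) (q \<theta>)) has_vector_derivative (\<Sum>r\<in>UNIV. \<Sum>s\<in>UNIV. X $ r $ s * E r s (p 0) (q 0))) (at 0)"
    by blast
  show ?case
  proof (rule exI[of _ "\<lambda>r s P Q. F P Q * E r s P Q + D r s P Q * G P Q"], intro conjI allI impI, goal_cases)
    case (1 r s) then show ?case using D E matpoly_mult.hyps by (intro matpoly.intros) auto
  next
    case (2 X p q)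
    have "(\<Sum>r\<in>UNIV. \<Sum>s\<in>UNIV. X $ r $ s * (F (p 0) (q 0) * E r s (p 0) (q 0) + D r s (p 0) (q 0) * G (p 0) (q 0))) =
      F (p 0) (q 0) * (\<Sum>r\<in>UNIV. \<Sum>s\<in>UNIV. X $ r $ s * E r s (p 0) (q 0)) +
      (\<Sum>r\<in>UNIV. \<Sum>s\<in>UNIV. X $ r $ s * D r s (p 0) (q 0)) * G (p 0) (q 0)"
      by (simp add: algebra_simps sum.distrib sum_distrib_left sum_distrib_right)
    then show ?case using has_vector_derivative_mult[OF d[OF 2] e[OF 2]] by simp
  qed
qed

text \<open>The Lipschitz bound dominates difference quotients uniformly over the group; for
  constant paths the statement reduces to boundedness.\<close>

lemma matpoly_lipschitz:
  fixes F :: "complex ^ 'n ^ 'n \<Rightarrow> complex ^ 'n ^ 'n \<Rightarrow> complex"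
  assumes "matpoly F"
    and p: "\<And>u \<theta> i j. u \<in> A \<Longrightarrow> norm (p u \<theta> $ i $ j) \<le> C"
      "\<And>u \<theta> i j. u \<in> A \<Longrightarrow> norm (p u \<theta> $ i $ j - p u 0 $ i $ j) \<le> C * \<bar>\<theta>\<bar>"
    and q: "\<And>u \<theta> i j. u \<in> A \<Longrightarrow> norm (q u \<theta> $ i $ j) \<le> C"
      "\<And>u \<theta> i j. u \<in> A \<Longrightarrow> norm (q u \<theta> $ i $ j - q u 0 $ i $ j) \<le> C * \<bar>\<theta>\<bar>"
  shows "\<exists>L\<ge>0. \<forall>u\<in>A. \<forall>\<theta>::real. norm (F (p u \<theta>) (q u \<theta>)) \<le> L \<and>
           norm (F (p u \<theta>) (q u \<theta>) - F (p u 0) (q u 0)) \<le> L * \<bar>\<theta>\<bar>"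
  using assms(1)
proof (induction rule: matpoly.induct)
  case (matpoly_const c) show ?case by (rule exI[of _ "norm c"]) auto
next
  case (matpoly_fst i j) show ?case using p
    by (intro exI[of _ "\<bar>C\<bar>"] conjI ballI allI)
       (auto intro: order_trans[OF _ abs_ge_self] order_trans[OF _ mult_right_mono[OF abs_ge_self abs_ge_zero]])
next
  case (matpoly_snd i j) show ?case using q
    by (intro exI[of _ "\<bar>C\<bar>"] conjI ballI allI)
       (auto intro: order_trans[OF _ abs_ge_self] order_trans[OF _ mult_right_mono[OF abs_ge_self abs_ge_zero]])
next
  case (matpoly_add F G)
  obtain K where K: "K \<ge> 0" "\<And>u \<theta>. u \<in> A \<Longrightarrow> norm (F (p u \<theta>) (q u \<theta>)) \<le> K"
      "\<And>u \<theta>. u \<in> A \<Longrightarrow> norm (F (p u \<theta>) (q u \<theta>) - F (p u 0) (q u 0)) \<le> K * \<bar>\<theta>\<bar>"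
    using matpoly_add.IH(1) by auto
  obtain L where L: "L \<ge> 0" "\<And>u \<theta>. u \<in> A \<Longrightarrow> norm (G (p u \<theta>) (q u \<theta>)) \<le> L"
      "\<And>u \<theta>. u \<in> A \<Longrightarrow> norm (G (p u \<theta>) (q u \<theta>) - G (p u 0) (q u 0)) \<le> L * \<bar>\<theta>\<bar>"
    using matpoly_add.IH(2) by auto
  show ?case
  proof (intro exI[of _ "K + L"] conjI ballI allI, goal_cases)
    case 1 then show ?case using K L by simp
  next
    case (2 u \<theta>) then show ?case using K(2)[of u \<theta>] L(2)[of u \<theta>] by (meson add_mono norm_triangle_le)
  next
    case (3 u \<theta>)
    have "F (p u \<theta>) (q u \<theta>) + G (p u \<theta>) (q u \<theta>) - (F (p u 0) (q u 0) + G (p u 0) (q u 0)) =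
      (F (p u \<theta>) (q u \<theta>) - F (p u 0) (q u 0)) + (G (p u \<theta>) (q u \<theta>) - G (p u 0) (q u 0))" by simp
    also have "norm \<dots> \<le> K * \<bar>\<theta>\<bar> + L * \<bar>\<theta>\<bar>"
      using K(3)[OF 3, of \<theta>] L(3)[OF 3, of \<theta>] by (intro norm_triangle_le add_mono)
    finally show ?case by (simp add: algebra_simps)
  qed
next
  case (matpoly_mult F G)
  obtain K where K: "K \<ge> 0" "\<And>u \<theta>. u \<in> A \<Longrightarrow> norm (F (p u \<theta>) (q u \<theta>)) \<le> K"
      "\<And>u \<theta>. u \<in> A \<Longrightarrow> norm (F (p u \<theta>) (q u \<theta>) - F (p u 0) (q u 0)) \<le> K * \<bar>\<theta>\<bar>"
    using matpoly_mult.IH(1) by auto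
  obtain L where L: "L \<ge> 0" "\<And>u \<theta>. u \<in> A \<Longrightarrow> norm (G (p u \<theta>) (q u \<theta>)) \<le> L"
      "\<And>u \<theta>. u \<in> A \<Longrightarrow> norm (G (p u \<theta>) (q u \<theta>) - G (p u 0) (q u 0)) \<le> L * \<bar>\<theta>\<bar>"
    using matpoly_mult.IH(2) by auto
  show ?case
  proof (intro exI[of _ "2 * (K * L)"] conjI ballI allI, goal_cases)
    case 1 then show ?case using K L by simp
  next
    case (2 u \<theta>)
    have "norm (F (p u \<theta>) (q u \<theta>) * G (p u \<theta>) (q u \<theta>)) \<le> K * L"
      unfolding norm_mult using K L 2 by (intro mult_mono) auto
    moreover have "0 \<le> K * L" using K L by simp
    ultimately show ?case by linarith
  next
    case (3 u \<theta>)
    have "F (p u \<theta>) (q u \<theta>) * G (p u \<theta>) (q u \<theta>) - F (p u 0) (q u 0) * G (p u 0) (q u 0) =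
      F (p u \<theta>) (q u \<theta>) * (G (p u \<theta>) (q u \<theta>) - G (p u 0) (q u 0)) +
      (F (p u \<theta>) (q u \<theta>) - F (p u 0) (q u 0)) * G (p u 0) (q u 0)"
      by (simp add: algebra_simps)
    also have "norm \<dots> \<le> K * (L * \<bar>\<theta>\<bar>) + (K * \<bar>\<theta>\<bar>) * L"
      using K L 3 by (intro norm_triangle_le add_mono) (auto simp: norm_mult intro!: mult_mono)
    finally show ?case by (simp add: algebra_simps)
  qed
qed

lemma matpoly_bounded:
  assumes "matpoly F"
  shows "\<exists>B. \<forall>U\<in>unitary_group. norm (F U (conj_entries U)) \<le> B"
proof -
  have "\<exists>L\<ge>0. \<forall>u\<in>unitary_group. \<forall>\<theta>::real. norm (F ((\<lambda>u \<theta>. u) u \<theta>) ((\<lambda>u \<theta>. conj_entries u) u \<theta>)) \<le> L \<and>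
           norm (F ((\<lambda>u \<theta>. u) u \<theta>) ((\<lambda>u \<theta>. conj_entries u) u \<theta>) - F ((\<lambda>u \<theta>. u) u 0) ((\<lambda>u \<theta>. conj_entries u) u 0)) \<le> L * \<bar>\<theta>\<bar>"
    by (rule matpoly_lipschitz[OF assms, where C = 1]) (auto simp: unitary_entry_le_1)
  then show ?thesis by auto
qed

locale haar =
  fixes \<mu> :: "(complex ^ 'n ^ 'n) measure"
  assumes haar: "is_haar_measure \<mu>"
begin

lemma sets_haar [measurable_cong]: "sets \<mu> = sets (restrict_space borel unitary_group)"
  using haar by (simp add: is_haar_measure_def)

lemma space_haar: "space \<mu> = unitary_group"
  using sets_eq_imp_space_eq[OF sets_haar] by (simp add: space_restrict_space)

sublocale prob_space \<mu> using haar by (simp add: is_haar_measure_def)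

lemma measurable_continuous_haar:
  fixes f :: "complex ^ 'n ^ 'n \<Rightarrow> 'b :: topological_space"
  assumes "continuous_on UNIV f" shows "f \<in> borel_measurable \<mu>"
proof -
  have "f \<in> borel_measurable borel" by (rule borel_measurable_continuous_onI[OF assms])
  then have "f \<in> borel_measurable (restrict_space borel unitary_group)" by (rule measurable_restrict_space1)
  then show ?thesis using measurable_cong_sets[OF sets_haar refl] by blast
qed

lemma measurable_entry [measurable]: "(\<lambda>U. U $ i $ j) \<in> borel_measurable \<mu>"
  by (rule measurable_continuous_haar) (intro continuous_intros)

lemma measurable_matpoly:
  "matpoly F \<Longrightarrow> (\<lambda>U. F U (conj_entries U)) \<in> borel_measurable \<mu>"
  by (induction rule: matpoly.induct) (auto intro!: borel_measurable_add borel_measurable_times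
      measurable_compose[OF measurable_entry borel_measurable_continuous_onI[of cnj]] continuous_intros)

lemma integrable_matpoly:
  assumes "matpoly F" shows "integrable \<mu> (\<lambda>U. F U (conj_entries U))"
proof -
  obtain B where "\<forall>U\<in>unitary_group. norm (F U (conj_entries U)) \<le> B"
    using matpoly_bounded[OF assms] by blast
  then show ?thesis
    by (intro integrable_const_bound[where B = B] measurable_matpoly assms)
       (auto simp: space_haar intro!: AE_I2)
qed

lemma haar_invariant:
  fixes F :: "complex ^ 'n ^ 'n \<Rightarrow> complex"
  assumes "W \<in> unitary_group" "F \<in> borel_measurable \<mu>"
  shows "(\<integral>U. F (W ** U) \<partial>\<mu>) = (\<integral>U. F U \<partial>\<mu>)"
proof -
  have m: "(\<lambda>U. W ** U) \<in> \<mu> \<rightarrow>\<^sub>M \<mu>"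
  proof -
    have "(\<lambda>U. W ** U) \<in> \<mu> \<rightarrow>\<^sub>M restrict_space borel unitary_group"
    proof (rule measurable_restrict_space2)
      show "(\<lambda>U. W ** U) \<in> space \<mu> \<rightarrow> unitary_group"
        using assms unitary_mult by (auto simp: space_haar)
      show "(\<lambda>U. W ** U) \<in> borel_measurable \<mu>"
        unfolding matrix_matrix_mult_def
        by (rule measurable_continuous_haar) (intro continuous_intros)
    qed
    then show ?thesis using measurable_cong_sets[OF refl sets_haar] by blast
  qed
  have "distr \<mu> \<mu> (\<lambda>U. W ** U) = \<mu>" using haar assms by (simp add: is_haar_measure_def)
  then have "(\<integral>U. F U \<partial>\<mu>) = (\<integral>U. F U \<partial>(distr \<mu> \<mu> (\<lambda>U. W ** U)))" by simp
  also have "\<dots> = (\<integral>U. F (W ** U) \<partial>\<mu>)" by (rule integral_distr[OF m assms(2)])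
  finally show ?thesis by simp
qed

end

section \<open>Infinitesimal invariance of Haar measure\<close>

text \<open>Dominated convergence and limits of measurable functions are applied along sequences,
  hence the increments 1/(n+1).\<close>

lemma tendsto_slope_sequence:
  fixes f :: "real \<Rightarrow> complex"
  assumes "(f has_vector_derivative D) (at 0)"
  shows "(\<lambda>n. (f (inverse (real (Suc n))) - f 0) * of_nat (Suc n)) \<longlonglongrightarrow> D"
proof -
  have "((\<lambda>h. norm (f (0 + h) - f 0 - h *\<^sub>R D) / norm h) \<longlongrightarrow> 0) (at 0)"
    using assms unfolding has_vector_derivative_def has_derivative_at by blast
  moreover have "filterlim (\<lambda>n. inverse (real (Suc n))) (at 0) sequentially"
    by (auto simp: filterlim_at intro!: LIMSEQ_inverse_real_of_nat simp del: of_nat_Suc)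
  ultimately have "(\<lambda>n. norm (f (0 + inverse (real (Suc n))) - f 0 - inverse (real (Suc n)) *\<^sub>R D) / norm (inverse (real (Suc n)))) \<longlonglongrightarrow> 0"
    by (rule filterlim_compose)
  moreover have "norm (f (0 + inverse (real (Suc n))) - f 0 - inverse (real (Suc n)) *\<^sub>R D) / norm (inverse (real (Suc n)))
     = norm ((f (inverse (real (Suc n))) - f 0) * of_nat (Suc n) - D)" for n
  proof -
    have "norm ((f (inverse (real (Suc n))) - f 0) * of_nat (Suc n) - D)
      = norm (of_nat (Suc n) * (f (0 + inverse (real (Suc n))) - f 0 - inverse (real (Suc n)) *\<^sub>R D))"
      by (simp add: algebra_simps scaleR_conv_of_real del: of_nat_Suc)
    also have "\<dots> = real (Suc n) * norm (f (0 + inverse (real (Suc n))) - f 0 - inverse (real (Suc n)) *\<^sub>R D)"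
      unfolding norm_mult norm_of_nat ..
    finally show ?thesis by (simp add: divide_inverse del: of_nat_Suc)
  qed
  ultimately have "(\<lambda>n. norm ((f (inverse (real (Suc n))) - f 0) * of_nat (Suc n) - D)) \<longlonglongrightarrow> 0" by simp
  then show ?thesis using LIM_zero_iff tendsto_norm_zero_iff by blast
qed

text \<open>The one-parameter groups \<open>exp (\<i> \<theta> u u\<^sup>*)\<close>; the matrices \<open>u u\<^sup>*\<close> span all complex matrices.\<close>

definition phase_rotation :: "complex ^ 'n \<Rightarrow> real \<Rightarrow> complex ^ 'n ^ 'n" where
  "phase_rotation u \<theta> = (\<chi> i j. (if i = j then 1 else 0) + (cis \<theta> - 1) * (u $ i * cnj (u $ j)))"

lemma phase_rotation_unitary:
  fixes u :: "complex ^ 'n"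
  assumes u: "(\<Sum>i\<in>UNIV. u $ i * cnj (u $ i)) = 1"
  shows "phase_rotation u \<theta> \<in> unitary_group"
proof -
  \<comment> \<open>As \<open>u\<close> is a unit vector, P = u u* is a projection, so (1 + aP)(1 +
    bP) = 1 + (a + b + ab)P.\<close>
  have key: "(\<Sum>k\<in>UNIV. ((if i = k then 1 else 0) + a * (u $ i * cnj (u $ k))) * ((if k = j then 1 else 0) + b * (u $ k * cnj (u $ j))))
     = (if i = j then 1 else 0) + (a + b + a * b) * (u $ i * cnj (u $ j))" for a b and i j :: 'n
  proof -
    have "(\<Sum>k\<in>UNIV. ((if i = k then 1 else 0) + a * (u $ i * cnj (u $ k))) * ((if k = j then 1 else 0) + b * (u $ k * cnj (u $ j))))
      = (\<Sum>k\<in>UNIV. (if i = k then if k = j then 1 else 0 else 0) + (if i = k then b * (u $ k * cnj (u $ j)) else 0)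
         + (if k = j then a * (u $ i * cnj (u $ k)) else 0) + a * b * u $ i * cnj (u $ j) * (u $ k * cnj (u $ k)))"
      by (intro sum.cong) (auto simp: algebra_simps)
    also have "\<dots> = (if i = j then 1 else 0) + b * (u $ i * cnj (u $ j)) + a * (u $ i * cnj (u $ j))
        + a * b * u $ i * cnj (u $ j) * (\<Sum>k\<in>UNIV. u $ k * cnj (u $ k))"
      by (simp add: sum.distrib sum_distrib_left)
    finally show ?thesis using u by (simp add: algebra_simps)
  qed
  have c: "(cis \<theta> - 1) + (cis (-\<theta>) - 1) + (cis \<theta> - 1) * (cis (-\<theta>) - 1) = 0"
    by (simp add: algebra_simps cis_mult)
  have ct: "conj_transpose (phase_rotation u \<theta>) = (\<chi> i j. (if i = j then 1 else 0) + (cis (-\<theta>) - 1) * (u $ i * cnj (u $ j)))"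
    by (auto simp: conj_transpose_def phase_rotation_def vec_eq_iff cis_cnj)
  have c': "(cis (-\<theta>) - 1) + (cis \<theta> - 1) + (cis (-\<theta>) - 1) * (cis \<theta> - 1) = 0"
    using c by (simp only: add.commute mult.commute)
  have "phase_rotation u \<theta> ** conj_transpose (phase_rotation u \<theta>) = mat 1"
    unfolding ct by (simp only: vec_eq_iff matrix_matrix_mult_def phase_rotation_def mat_def vec_lambda_beta key c) simp
  moreover have "conj_transpose (phase_rotation u \<theta>) ** phase_rotation u \<theta> = mat 1"
    unfolding ct by (simp only: vec_eq_iff matrix_matrix_mult_def phase_rotation_def mat_def vec_lambda_beta key c') simp
  ultimately show ?thesis by (simp add: unitary_group_def)
qed

lemma phase_rotation_mult:
  "(phase_rotation u \<theta> ** A) $ i $ j = A $ i $ j + (cis \<theta> - 1) * ((\<chi> i j. u $ i * cnj (u $ j)) ** A) $ i $ j"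
proof -
  have "(phase_rotation u \<theta> ** A) $ i $ j =
    (\<Sum>k\<in>UNIV. (if i = k then A $ k $ j else 0) + (cis \<theta> - 1) * (u $ i * cnj (u $ k) * A $ k $ j))"
    unfolding phase_rotation_def matrix_matrix_mult_def vec_lambda_beta
    by (intro sum.cong) (auto simp: algebra_simps)
  then show ?thesis by (simp add: sum.distrib matrix_matrix_mult_def sum_distrib_left)
qed

context haar begin

text \<open>By invariance the integral of \<open>F\<close> along the one-parameter group is constant
  in the angle, and dominated convergence moves its derivative at 0 inside the integral.\<close>

lemma rank_one_invariance:
  fixes u :: "complex ^ 'n"
  assumes F: "matpoly F" and D: "\<And>r s. matpoly (D r s)"
    and deriv: "\<And>X p q.
    (\<forall>i j. ((\<lambda>\<theta>::real. p \<theta> $ i $ j) has_vector_derivative (X ** p 0) $ i $ j) (at 0)) \<Longrightarrow>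
    (\<forall>i j. ((\<lambda>\<theta>. q \<theta> $ i $ j) has_vector_derivative - (transpose X ** q 0) $ i $ j) (at 0)) \<Longrightarrow>
    ((\<lambda>\<theta>. F (p \<theta>) (q \<theta>)) has_vector_derivative
        (\<Sum>r\<in>UNIV. \<Sum>s\<in>UNIV. X $ r $ s * D r s (p 0) (q 0))) (at 0)"
    and u: "(\<Sum>i\<in>UNIV. u $ i * cnj (u $ i)) = 1"
  shows "(\<Sum>r\<in>UNIV. \<Sum>s\<in>UNIV. u $ r * cnj (u $ s) * (\<integral>U. D r s U (conj_entries U) \<partial>\<mu>)) = 0"
proof -
  define X :: "complex ^ 'n ^ 'n" where "X = (\<chi> i j. u $ i * cnj (u $ j))"
  \<comment> \<open>i u u* is skew-Hermitian, so the conjugate path \<open>q\<close> obeys the rule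
    with the transpose.\<close>
  define Y where "Y = (\<chi> i j. \<i> * X $ i $ j)"
  define p where "p U \<theta> = phase_rotation u \<theta> ** U" for U :: "complex ^ 'n ^ 'n" and \<theta> :: real
  define q where "q U \<theta> = conj_entries (p U \<theta>)" for U :: "complex ^ 'n ^ 'n" and \<theta> :: real
  have p_eq: "p U \<theta> $ i $ j = U $ i $ j + (cis \<theta> - 1) * (X ** U) $ i $ j" for U \<theta> i j
    unfolding p_def X_def by (rule phase_rotation_mult)
  have p0: "p U 0 = U" and q0: "q U 0 = conj_entries U" for U
    by (simp_all add: vec_eq_iff q_def p_eq)
  have pu: "p U \<theta> \<in> unitary_group" if "U \<in> unitary_group" for U \<theta>
    unfolding p_def using phase_rotation_unitary[OF u] that by (intro unitary_mult)
  have dcis: "((\<lambda>\<theta>. cis \<theta>) has_vector_derivative \<i>) (at 0)"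
    unfolding has_vector_derivative_def by (auto intro!: derivative_eq_intros)
  have dp: "((\<lambda>\<theta>. p U \<theta> $ i $ j) has_vector_derivative (Y ** p U 0) $ i $ j) (at 0)" for U i j
  proof -
    have "((\<lambda>\<theta>. U $ i $ j + (cis \<theta> - 1) * (X ** U) $ i $ j) has_vector_derivative 0 + (\<i> - 0) * (X ** U) $ i $ j) (at 0)"
      by (intro has_vector_derivative_add has_vector_derivative_mult_left has_vector_derivative_diff dcis has_vector_derivative_const)
    moreover have "(Y ** p U 0) $ i $ j = \<i> * (X ** U) $ i $ j"
      unfolding p0 by (simp add: Y_def matrix_matrix_mult_def sum_distrib_left mult.assoc)
    ultimately show ?thesis by (simp add: p_eq)
  qed
  have dq: "((\<lambda>\<theta>. q U \<theta> $ i $ j) has_vector_derivative - (transpose Y ** q U 0) $ i $ j) (at 0)" for U i j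
  proof -
    have "((\<lambda>\<theta>. cnj (p U \<theta> $ i $ j)) has_vector_derivative cnj ((Y ** p U 0) $ i $ j)) (at 0)"
      using bounded_linear.has_vector_derivative[OF bounded_linear_cnj dp] .
    moreover have "cnj ((Y ** p U 0) $ i $ j) = - (transpose Y ** q U 0) $ i $ j"
      unfolding p0 q0 by (simp add: Y_def X_def matrix_matrix_mult_def transpose_def sum_negf mult_ac)
    ultimately show ?thesis by (simp add: q_def)
  qed
  \<comment> \<open>One constant for all bounds: 1 bounds the entries of unitary matrices, the sum
    bounds the entries of \<open>X ** U\<close>.\<close>
  define C where "C = 1 + (\<Sum>i\<in>UNIV. \<Sum>j\<in>UNIV. norm (X $ i $ j))"
  have XU: "norm ((X ** U) $ i $ j) \<le> C" if "U \<in> unitary_group" for U i j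
  proof -
    have "norm ((X ** U) $ i $ j) \<le> (\<Sum>k\<in>UNIV. norm (X $ i $ k))"
      unfolding matrix_matrix_mult_def vec_lambda_beta
      by (rule sum_norm_le) (metis unitary_entry_le_1[OF that] norm_mult mult_left_le norm_ge_zero)
    also have "\<dots> \<le> (\<Sum>i\<in>UNIV. \<Sum>k\<in>UNIV. norm (X $ i $ k))"
      using member_le_sum[of i UNIV "\<lambda>i. \<Sum>k\<in>UNIV. norm (X $ i $ k)"] by (simp add: sum_nonneg)
    finally show ?thesis by (simp add: C_def)
  qed
  have C1: "1 \<le> C" by (simp add: C_def sum_nonneg)
  have cis1: "norm (cis \<theta> - 1) \<le> \<bar>\<theta>\<bar>" for \<theta>
    using iexp_approx1[of \<theta> 0] by (simp add: cis_conv_exp)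
  have lip: "norm (p U \<theta> $ i $ j - p U 0 $ i $ j) \<le> C * \<bar>\<theta>\<bar>" if "U \<in> unitary_group" for U \<theta> i j
  proof -
    have "p U \<theta> $ i $ j - p U 0 $ i $ j = (cis \<theta> - 1) * (X ** U) $ i $ j" by (simp add: p_eq)
    moreover have "norm \<dots> \<le> \<bar>\<theta>\<bar> * C"
      unfolding norm_mult by (intro mult_mono cis1 XU that) auto
    ultimately show ?thesis by (simp add: mult.commute)
  qed
  have "\<exists>L\<ge>0. \<forall>U\<in>unitary_group. \<forall>\<theta>::real. norm (F (p U \<theta>) (q U \<theta>)) \<le> L \<and>
           norm (F (p U \<theta>) (q U \<theta>) - F (p U 0) (q U 0)) \<le> L * \<bar>\<theta>\<bar>"
  proof (rule matpoly_lipschitz[OF F, where C = C])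
    fix U :: "complex ^ 'n ^ 'n" and \<theta> i j assume U: "U \<in> unitary_group"
    show "norm (p U \<theta> $ i $ j) \<le> C" using unitary_entry_le_1[OF pu[OF U]] C1 by (meson order_trans)
    then show "norm (q U \<theta> $ i $ j) \<le> C" by (simp add: q_def)
    show "norm (p U \<theta> $ i $ j - p U 0 $ i $ j) \<le> C * \<bar>\<theta>\<bar>" by (rule lip[OF U])
    then show "norm (q U \<theta> $ i $ j - q U 0 $ i $ j) \<le> C * \<bar>\<theta>\<bar>"
      unfolding q_def conj_entries_nth complex_cnj_diff[symmetric] complex_mod_cnj .
  qed
  then obtain L where L: "\<And>U \<theta>. U \<in> unitary_group \<Longrightarrow> norm (F (p U \<theta>) (q U \<theta>) - F (p U 0) (q U 0)) \<le> L * \<bar>\<theta>\<bar>"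
    by blast
  define S where "S n U = (F (p U (inverse (real (Suc n)))) (q U (inverse (real (Suc n)))) - F U (conj_entries U)) * of_nat (Suc n)" for n U
  define G where "G U = (\<Sum>r\<in>UNIV. \<Sum>s\<in>UNIV. Y $ r $ s * D r s U (conj_entries U))" for U
  have Fm: "(\<lambda>U. F U (conj_entries U)) \<in> borel_measurable \<mu>" by (rule measurable_matpoly[OF F])
  have pm: "(\<lambda>U. F (p U \<theta>) (q U \<theta>)) \<in> borel_measurable \<mu>" for \<theta>
  proof -
    have "(\<lambda>U. p U \<theta>) \<in> \<mu> \<rightarrow>\<^sub>M restrict_space borel unitary_group"
    proof (rule measurable_restrict_space2)
      show "(\<lambda>U. p U \<theta>) \<in> space \<mu> \<rightarrow> unitary_group" using pu by (auto simp: space_haar)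
      show "(\<lambda>U. p U \<theta>) \<in> borel_measurable \<mu>"
        unfolding p_def matrix_matrix_mult_def by (rule measurable_continuous_haar) (intro continuous_intros)
    qed
    then have "(\<lambda>U. p U \<theta>) \<in> \<mu> \<rightarrow>\<^sub>M \<mu>" using measurable_cong_sets[OF refl sets_haar] by blast
    from measurable_compose[OF this Fm] show ?thesis by (simp add: q_def)
  qed
  have inv: "(\<integral>U. F (p U \<theta>) (q U \<theta>) \<partial>\<mu>) = (\<integral>U. F U (conj_entries U) \<partial>\<mu>)" for \<theta>
    using haar_invariant[OF phase_rotation_unitary[OF u] Fm] by (simp add: p_def q_def)
  obtain B where B: "\<And>U. U \<in> unitary_group \<Longrightarrow> norm (F U (conj_entries U)) \<le> B"
    using matpoly_bounded[OF F] by blast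
  have ip: "integrable \<mu> (\<lambda>U. F (p U \<theta>) (q U \<theta>))" for \<theta>
  proof (rule integrable_const_bound[where B = B])
    show "AE U in \<mu>. norm (F (p U \<theta>) (q U \<theta>)) \<le> B"
      using B[OF pu] by (intro AE_I2) (simp add: space_haar q_def)
  qed (rule pm)
  have S0: "(\<integral>U. S n U \<partial>\<mu>) = 0" for n
    unfolding S_def using ip integrable_matpoly[OF F] inv by (simp del: of_nat_Suc)
  have "(\<lambda>n. \<integral>U. S n U \<partial>\<mu>) \<longlonglongrightarrow> (\<integral>U. G U \<partial>\<mu>)"
  proof (rule integral_dominated_convergence[where w = "\<lambda>_. L"])
    have "matpoly (\<lambda>P Q. \<Sum>r\<in>UNIV. \<Sum>s\<in>UNIV. Y $ r $ s * D r s P Q)"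
      by (intro matpoly_sum matpoly_mult matpoly_const D)
    from measurable_matpoly[OF this] show "G \<in> borel_measurable \<mu>" unfolding G_def .
    show "S n \<in> borel_measurable \<mu>" for n
      unfolding S_def by (intro borel_measurable_times borel_measurable_diff pm Fm) auto
    show "AE U in \<mu>. (\<lambda>n. S n U) \<longlonglongrightarrow> G U"
    proof (rule AE_I2)
      fix U
      have "((\<lambda>\<theta>. F (p U \<theta>) (q U \<theta>)) has_vector_derivative
        (\<Sum>r\<in>UNIV. \<Sum>s\<in>UNIV. Y $ r $ s * D r s (p U 0) (q U 0))) (at 0)"
        by (rule deriv) (use dp dq in auto)
      from tendsto_slope_sequence[OF this] show "(\<lambda>n. S n U) \<longlonglongrightarrow> G U"
        unfolding S_def G_def p0 q0 .
    qed
    show "AE U in \<mu>. norm (S n U) \<le> L" for n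
    proof (rule AE_I2)
      fix U assume "U \<in> space \<mu>"
      then have "norm (F (p U (inverse (real (Suc n)))) (q U (inverse (real (Suc n)))) - F (p U 0) (q U 0)) \<le> L * \<bar>inverse (real (Suc n))\<bar>"
        by (intro L) (simp add: space_haar)
      then have "norm (S n U) \<le> L * \<bar>inverse (real (Suc n))\<bar> * real (Suc n)"
        unfolding S_def norm_mult norm_of_nat p0 q0 by (intro mult_right_mono) auto
      then show "norm (S n U) \<le> L" by (simp add: mult.assoc del: of_nat_Suc)
    qed
  qed auto
  then have "(\<integral>U. G U \<partial>\<mu>) = 0" unfolding S0 by (simp add: LIMSEQ_const_iff)
  moreover have "(\<integral>U. G U \<partial>\<mu>) = (\<Sum>r\<in>UNIV. \<Sum>s\<in>UNIV. Y $ r $ s * (\<integral>U. D r s U (conj_entries U) \<partial>\<mu>))"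
    unfolding G_def by (subst Bochner_Integration.integral_sum Bochner_Integration.integral_mult_right_zero; (intro Bochner_Integration.integrable_sum integrable_mult_right integrable_matpoly D)?)+ simp
  ultimately have "\<i> * (\<Sum>r\<in>UNIV. \<Sum>s\<in>UNIV. u $ r * cnj (u $ s) * (\<integral>U. D r s U (conj_entries U) \<partial>\<mu>)) = 0"
    unfolding Y_def X_def by (simp add: sum_distrib_left mult.assoc)
  then show ?thesis by simp
qed

end

section \<open>Orthogonality of products of bilinear forms to powers of the determinant\<close>

definition bilin_form :: "complex ^ 'n \<Rightarrow> complex ^ 'n ^ 'n \<Rightarrow> complex ^ 'n \<Rightarrow> complex" where
  "bilin_form b U y = (\<Sum>r\<in>UNIV. \<Sum>s\<in>UNIV. b $ r * U $ r $ s * y $ s)"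

lemma matpoly_bilin_form: "matpoly (\<lambda>P Q. bilin_form b P y)"
  unfolding bilin_form_def by (intro matpoly_sum matpoly_mult matpoly.intros)

lemma bilin_form_add_left: "bilin_form (b + b') U y = bilin_form b U y + bilin_form b' U y"
  by (simp add: bilin_form_def algebra_simps sum.distrib)

lemma bilin_form_scale_left: "bilin_form (c *s b) U y = c * bilin_form b U y"
  by (simp add: bilin_form_def algebra_simps sum_distrib_left)

lemma bilin_form_bound:
  assumes "U \<in> unitary_group"
  shows "norm (bilin_form b U y) \<le> (\<Sum>r\<in>UNIV. norm (b $ r)) * (\<Sum>s\<in>UNIV. norm (y $ s))"
proof -
  have "norm (bilin_form b U y) \<le> (\<Sum>r\<in>UNIV. \<Sum>s\<in>UNIV. norm (b $ r) * norm (y $ s))"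
    unfolding bilin_form_def
  proof (intro sum_norm_le)
    fix r s
    show "norm (b $ r * U $ r $ s * y $ s) \<le> norm (b $ r) * norm (y $ s)"
      using unitary_entry_le_1[OF assms, of r s]
      by (simp add: norm_mult mult_right_mono mult_left_le)
  qed
  then show ?thesis by (simp add: sum_product)
qed

lemma bilin_form_matrix: "bilin_form (B $ i) A y = ((B ** A) *v y) $ i"
proof -
  have "bilin_form (B $ i) A y = (\<Sum>r\<in>UNIV. \<Sum>s\<in>UNIV. B $ i $ r * A $ r $ s * y $ s)" by (simp add: bilin_form_def)
  also have "\<dots> = (\<Sum>s\<in>UNIV. \<Sum>r\<in>UNIV. B $ i $ r * A $ r $ s * y $ s)" by (rule sum.swap)
  finally show ?thesis by (simp add: matrix_vector_mult_def matrix_matrix_mult_def sum_distrib_right)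
qed

lemma cnj_det: "cnj (det U) = det (conj_entries U)"
  by (simp add: det_def)

text \<open>The three factors are those of the test function in \<open>column_form_recursion\<close>
  after a shift along a matrix unit.\<close>

lemma product_rule_at_0:
  fixes a b c e q g h k l :: complex
  shows "((\<lambda>z. (a - z * b) * (c + z * e) * (q + z * g - z * h * (k + z * l)) ^ n) has_field_derivative
    - (b * c * q ^ n) + a * e * q ^ n + a * c * (of_nat n * q ^ (n - 1) * (g - h * k))) (at 0)"
  by (auto intro!: derivative_eq_intros simp: algebra_simps)

context haar begin

text \<open>
  By complex linearity in the generator, \<open>X\<close> need not be skew-Hermitian; \<open>U\<close> and its conjugate
  are then varied as independent matrices.
\<close>

lemma schwinger_dyson:
  fixes F :: "complex ^ 'n ^ 'n \<Rightarrow> complex ^ 'n ^ 'n \<Rightarrow> complex"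
  assumes F: "matpoly F"
    and deriv: "\<And>U. U \<in> unitary_group \<Longrightarrow>
      ((\<lambda>s::complex. F (\<chi> i j. U $ i $ j + s * (X ** U) $ i $ j)
                        (\<chi> i j. cnj (U $ i $ j) - s * (transpose X ** conj_entries U) $ i $ j))
        has_field_derivative d U) (at 0)"
  shows "(\<integral>U. d U \<partial>\<mu>) = 0"
proof -
  obtain D where D: "\<And>r s. matpoly (D r s)" and DD: "\<And>X p q.
    (\<forall>i j. ((\<lambda>\<theta>::real. p \<theta> $ i $ j) has_vector_derivative (X ** p 0) $ i $ j) (at 0)) \<Longrightarrow>
    (\<forall>i j. ((\<lambda>\<theta>. q \<theta> $ i $ j) has_vector_derivative - (transpose X ** q 0) $ i $ j) (at 0)) \<Longrightarrow>
    ((\<lambda>\<theta>. F (p \<theta>) (q \<theta>)) has_vector_derivative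
        (\<Sum>r\<in>UNIV. \<Sum>s\<in>UNIV. X $ r $ s * D r s (p 0) (q 0))) (at 0)"
    using matpoly_derivative[OF F] by blast
  define I where "I r s = (\<integral>U. D r s U (conj_entries U) \<partial>\<mu>)" for r s
  have unit: "(\<Sum>r\<in>UNIV. \<Sum>s\<in>UNIV. u $ r * cnj (u $ s) * I r s) = 0"
    if "(\<Sum>i\<in>UNIV. u $ i * cnj (u $ i)) = 1" for u
    unfolding I_def by (rule rank_one_invariance[OF F D DD that]) auto
  have all: "(\<Sum>r\<in>UNIV. \<Sum>s\<in>UNIV. u $ r * cnj (u $ s) * I r s) = 0" for u
  proof (cases "u = 0")
    case False
    define n2 where "n2 = (\<Sum>i\<in>UNIV. (norm (u $ i))\<^sup>2)"
    have n2: "n2 > 0"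
    proof -
      from False obtain i where "u $ i \<noteq> 0" by (auto simp: vec_eq_iff)
      then have "0 < (norm (u $ i))\<^sup>2" by simp
      also have "\<dots> \<le> n2" unfolding n2_def by (rule member_le_sum) auto
      finally show ?thesis .
    qed
    define c where "c = complex_of_real (1 / sqrt n2)"
    have cc: "c * cnj c = of_real (1 / n2)" using n2 by (simp add: c_def flip: of_real_mult)
    have "(\<Sum>i\<in>UNIV. (c *s u) $ i * cnj ((c *s u) $ i)) = (\<Sum>i\<in>UNIV. c * cnj c * (u $ i * cnj (u $ i)))"
      by (simp add: mult_ac)
    also have "\<dots> = c * cnj c * (\<Sum>i\<in>UNIV. of_real ((norm (u $ i))\<^sup>2))"
      by (simp only: sum_distrib_left complex_norm_square)
    also have "\<dots> = 1" using n2 unfolding cc of_real_sum[symmetric] n2_def[symmetric] by (simp flip: of_real_mult)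
    finally have "(\<Sum>r\<in>UNIV. \<Sum>s\<in>UNIV. (c *s u) $ r * cnj ((c *s u) $ s) * I r s) = 0" by (rule unit)
    moreover have "(\<Sum>r\<in>UNIV. \<Sum>s\<in>UNIV. (c *s u) $ r * cnj ((c *s u) $ s) * I r s) =
      c * cnj c * (\<Sum>r\<in>UNIV. \<Sum>s\<in>UNIV. u $ r * cnj (u $ s) * I r s)"
      by (simp add: sum_distrib_left mult_ac)
    ultimately show ?thesis using cc n2 by simp
  qed simp
  \<comment> \<open>Polarisation: the vector with entries a at r and b at s is used for (a, b) = (1,
    0), (0, 1), (1, 1) and (1, i).\<close>
  have I0: "I r s = 0" for r s
  proof -
    have Q: "a * cnj a * I r r + a * cnj b * I r s + b * cnj a * I s r + b * cnj b * I s s = 0" for a b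
    proof -
      define u :: "complex ^ 'n" where "u = (\<chi> i. (if i = r then a else 0) + (if i = s then b else 0))"
      have "(\<Sum>p\<in>UNIV. \<Sum>q\<in>UNIV. u $ p * cnj (u $ q) * I p q) =
        (\<Sum>p\<in>UNIV. u $ p * (cnj a * I p r + cnj b * I p s))"
      proof (rule sum.cong[OF refl])
        fix p
        have "(\<Sum>q\<in>UNIV. u $ p * cnj (u $ q) * I p q) =
           (\<Sum>q\<in>UNIV. (if q = r then u $ p * cnj a * I p q else 0) + (if q = s then u $ p * cnj b * I p q else 0))"
          by (intro sum.cong) (auto simp: u_def algebra_simps)
        then show "(\<Sum>q\<in>UNIV. u $ p * cnj (u $ q) * I p q) = u $ p * (cnj a * I p r + cnj b * I p s)"
          by (simp add: sum.distrib algebra_simps)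
      qed
      also have "\<dots> = (\<Sum>p\<in>UNIV. (if p = r then a * (cnj a * I p r + cnj b * I p s) else 0)
          + (if p = s then b * (cnj a * I p r + cnj b * I p s) else 0))"
        by (intro sum.cong) (auto simp: u_def algebra_simps)
      also have "\<dots> = a * cnj a * I r r + a * cnj b * I r s + b * cnj a * I s r + b * cnj b * I s s"
        by (simp add: sum.distrib algebra_simps)
      finally show ?thesis using all by simp
    qed
    have "I r r = 0" "I s s = 0" using Q[of 1 0] Q[of 0 1] by auto
    then have "I r s + I s r = 0" "- \<i> * I r s + \<i> * I s r = 0" using Q[of 1 1] Q[of 1 \<i>] by auto
    then show "I r s = 0" by (simp add: add_eq_0_iff2 algebra_simps)
  qed
  \<comment> \<open>Both sides are derivatives at 0 of one real path, the complex parameter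
    \<open>s\<close> being restricted to real values.\<close>
  have d: "d U = (\<Sum>r\<in>UNIV. \<Sum>s\<in>UNIV. X $ r $ s * D r s U (conj_entries U))" if U: "U \<in> unitary_group" for U
  proof -
    define p where "p \<theta> = (\<chi> i j. U $ i $ j + of_real \<theta> * (X ** U) $ i $ j)" for \<theta> :: real
    define q where "q \<theta> = (\<chi> i j. cnj (U $ i $ j) - of_real \<theta> * (transpose X ** conj_entries U) $ i $ j)" for \<theta> :: real
    have p0: "p 0 = U" and q0: "q 0 = conj_entries U" by (simp_all add: p_def q_def vec_eq_iff)
    have "((\<lambda>\<theta>. p \<theta> $ i $ j) has_vector_derivative (X ** p 0) $ i $ j) (at 0)" for i j
    proof -
      have "((\<lambda>z. U $ i $ j + z * (X ** U) $ i $ j) has_field_derivative (X ** U) $ i $ j) (at (of_real 0))"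
        by (auto intro!: derivative_eq_intros)
      from has_vector_derivative_real_field[OF this] show ?thesis unfolding p0 by (simp add: p_def)
    qed
    moreover have "((\<lambda>\<theta>. q \<theta> $ i $ j) has_vector_derivative - (transpose X ** q 0) $ i $ j) (at 0)" for i j
    proof -
      have "((\<lambda>z. cnj (U $ i $ j) - z * (transpose X ** conj_entries U) $ i $ j) has_field_derivative
         - (transpose X ** conj_entries U) $ i $ j) (at (of_real 0))"
        by (auto intro!: derivative_eq_intros)
      from has_vector_derivative_real_field[OF this] show ?thesis unfolding q0 by (simp add: q_def)
    qed
    ultimately have "((\<lambda>\<theta>. F (p \<theta>) (q \<theta>)) has_vector_derivative
        (\<Sum>r\<in>UNIV. \<Sum>s\<in>UNIV. X $ r $ s * D r s (p 0) (q 0))) (at 0)"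
      by (intro DD) auto
    moreover have "((\<lambda>\<theta>. F (p \<theta>) (q \<theta>)) has_vector_derivative d U) (at 0)"
      unfolding p_def q_def by (rule has_vector_derivative_real_field) (use deriv[OF U] in simp)
    ultimately show ?thesis unfolding p0 q0 by (rule vector_derivative_unique_at[symmetric])
  qed
  have "(\<integral>U. d U \<partial>\<mu>) = (\<integral>U. (\<Sum>r\<in>UNIV. \<Sum>s\<in>UNIV. X $ r $ s * D r s U (conj_entries U)) \<partial>\<mu>)"
    by (rule Bochner_Integration.integral_cong) (auto simp: space_haar d)
  also have "\<dots> = (\<Sum>r\<in>UNIV. \<Sum>s\<in>UNIV. X $ r $ s * I r s)"
    unfolding I_def by (simp add: Bochner_Integration.integral_sum integrable_matpoly[OF D])
  finally show ?thesis by (simp add: I0)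
qed

text \<open>The generator is B^(-1) E B with E the matrix unit at (i0, i0). Moving along it
  multiplies row \<open>i0\<close> of \<open>B ** U\<close> by 1 + s and the conjugate determinant
  by 1 - s, so the derivative of the integrand is m i0 - k times the integrand.\<close>

lemma det_power_orthogonal_invertible:
  fixes B :: "complex ^ 'n ^ 'n" and y :: "'n \<Rightarrow> complex ^ 'n"
  assumes B: "det B \<noteq> 0" and m: "m i0 \<noteq> k"
  shows "(\<integral>U. (\<Prod>i\<in>UNIV. bilin_form (B $ i) U (y i) ^ m i) * cnj (det U) ^ k \<partial>\<mu>) = 0"
proof -
  from B obtain B' where B': "B ** B' = mat 1" "B' ** B = mat 1"
    using invertible_det_nz[of B] by (auto simp: invertible_def)
  define E :: "complex ^ 'n ^ 'n" where "E = (\<chi> i j. if i = i0 \<and> j = i0 then 1 else 0)"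
  have EA: "(E ** A) $ i $ j = (if i = i0 then A $ i $ j else 0)" for A :: "complex ^ 'n ^ 'n" and i j
  proof -
    have "(E ** A) $ i $ j = (\<Sum>k\<in>UNIV. if k = i0 then (if i = i0 then A $ k $ j else 0) else 0)"
      unfolding matrix_matrix_mult_def vec_lambda_beta by (intro sum.cong) (auto simp: E_def)
    then show ?thesis by simp
  qed
  define X where "X = B' ** E ** B"
  have BX: "B ** X = E ** B"
    unfolding X_def matrix_mul_assoc B' by simp
  define F where "F P Q = (\<Prod>i\<in>UNIV. bilin_form (B $ i) P (y i) ^ m i) * det Q ^ k" for P Q :: "complex ^ 'n ^ 'n"
  have F: "matpoly F" unfolding F_def
    by (intro matpoly_mult matpoly_prod matpoly_power matpoly_bilin_form matpoly_det_snd)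
  have shift: "F (\<chi> i j. U $ i $ j + s * (X ** U) $ i $ j)
                 (\<chi> i j. cnj (U $ i $ j) - s * (transpose X ** conj_entries U) $ i $ j) =
        (1 + s) ^ m i0 * (1 - s) ^ k * F U (conj_entries U)" for s U
  proof -
    let ?M = "\<chi> i j. U $ i $ j + s * (X ** U) $ i $ j"
    have BM: "(B ** ?M) $ i $ j = (if i = i0 then 1 + s else 1) * (B ** U) $ i $ j" for i j
    proof -
      have "(B ** ?M) $ i $ j = (B ** U) $ i $ j + s * (B ** (X ** U)) $ i $ j"
        unfolding matrix_matrix_mult_def vec_lambda_beta by (simp add: algebra_simps sum.distrib sum_distrib_left)
      also have "B ** (X ** U) = E ** (B ** U)" by (simp add: matrix_mul_assoc BX)
      finally show ?thesis by (simp add: EA algebra_simps)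
    qed
    have b: "bilin_form (B $ i) ?M (y i) = (if i = i0 then 1 + s else 1) * bilin_form (B $ i) U (y i)" for i
      unfolding bilin_form_matrix matrix_vector_mult_def vec_lambda_beta BM
      by (simp add: sum_distrib_left mult.assoc)
    have "(\<Prod>i\<in>UNIV. bilin_form (B $ i) ?M (y i) ^ m i) =
       (\<Prod>i\<in>UNIV. (if i = i0 then (1 + s) ^ m i else 1)) * (\<Prod>i\<in>UNIV. bilin_form (B $ i) U (y i) ^ m i)"
      unfolding b power_mult_distrib prod.distrib[symmetric] by (intro prod.cong) auto
    then have 1: "(\<Prod>i\<in>UNIV. bilin_form (B $ i) ?M (y i) ^ m i) = (1 + s) ^ m i0 * (\<Prod>i\<in>UNIV. bilin_form (B $ i) U (y i) ^ m i)"
      by simp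
    \<comment> \<open>1 - sX is conjugate to \<open>Z\<close> = 1 - sE and so has determinant 1 - s;
      its transpose is the factor acting on the conjugate of \<open>U\<close>.\<close>
    define Z :: "complex ^ 'n ^ 'n" where "Z = (\<chi> i j. (if i = j then if i = i0 then 1 - s else 1 else 0))"
    have dZ: "det Z = 1 - s"
    proof -
      have "det Z = (\<Prod>i\<in>UNIV. Z $ i $ i)" by (rule det_diagonal) (simp add: Z_def)
      then show ?thesis by (simp add: Z_def)
    qed
    have ZB: "(Z ** B) $ i $ j = B $ i $ j - s * (E ** B) $ i $ j" for i j
    proof -
      have "(Z ** B) $ i $ j = (\<Sum>k\<in>UNIV. if i = k then (if i = i0 then 1 - s else 1) * B $ k $ j else 0)"
        unfolding matrix_matrix_mult_def vec_lambda_beta by (intro sum.cong) (auto simp: Z_def)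
      then show ?thesis by (simp add: EA algebra_simps)
    qed
    define T where "T = B' ** (Z ** B)"
    have T: "T $ i $ j = (if i = j then 1 else 0) - s * X $ i $ j" for i j
    proof -
      have "(B' ** (Z ** B)) $ i $ j = (B' ** B) $ i $ j - s * (B' ** (E ** B)) $ i $ j"
        unfolding matrix_matrix_mult_def[of B'] vec_lambda_beta ZB
        by (simp add: algebra_simps sum_subtractf sum_distrib_left)
      then show ?thesis by (simp add: B' X_def matrix_mul_assoc mat_def T_def)
    qed
    have "(\<chi> i j. cnj (U $ i $ j) - s * (transpose X ** conj_entries U) $ i $ j) = transpose T ** conj_entries U"
    proof -
      have "(transpose T ** conj_entries U) $ i $ j = cnj (U $ i $ j) - s * (transpose X ** conj_entries U) $ i $ j" for i j
      proof -
        have "(transpose T ** conj_entries U) $ i $ j =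
           (\<Sum>k\<in>UNIV. (if k = i then cnj (U $ k $ j) else 0) - s * (X $ k $ i * cnj (U $ k $ j)))"
          unfolding matrix_matrix_mult_def transpose_def vec_lambda_beta T
          by (intro sum.cong) (auto simp: algebra_simps)
        then show ?thesis by (simp add: sum_subtractf sum_distrib_left matrix_matrix_mult_def transpose_def)
      qed
      then show ?thesis by (simp add: vec_eq_iff)
    qed
    then have "det (\<chi> i j. cnj (U $ i $ j) - s * (transpose X ** conj_entries U) $ i $ j) =
        det B' * (det Z * det B) * det (conj_entries U)"
      by (simp add: det_mul T_def)
    moreover have "det B' * det B = 1" using B' by (metis det_I det_mul)
    ultimately have 2: "det (\<chi> i j. cnj (U $ i $ j) - s * (transpose X ** conj_entries U) $ i $ j) = (1 - s) * det (conj_entries U)"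
      by (simp add: dZ mult_ac)
    show ?thesis unfolding F_def 1 2 by (simp add: power_mult_distrib)
  qed
  have "(\<integral>U. (of_nat (m i0) - of_nat k) * F U (conj_entries U) \<partial>\<mu>) = 0"
  proof (rule schwinger_dyson[OF F, of X])
    fix U
    show "((\<lambda>s. F (\<chi> i j. U $ i $ j + s * (X ** U) $ i $ j)
                 (\<chi> i j. cnj (U $ i $ j) - s * (transpose X ** conj_entries U) $ i $ j))
        has_field_derivative (of_nat (m i0) - of_nat k) * F U (conj_entries U)) (at 0)"
      unfolding shift by (auto intro!: derivative_eq_intros)
  qed
  then have "(of_nat (m i0) - of_nat k) * (\<integral>U. F U (conj_entries U) \<partial>\<mu>) = 0" by simp
  moreover have "(of_nat (m i0) - of_nat k :: complex) \<noteq> 0" using m by simp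
  ultimately show ?thesis by (simp add: F_def cnj_det)
qed

text \<open>The vectors \<open>b i\<close> may be linearly dependent. Adding epsilon times the
  standard basis makes the matrix of rows invertible for all small nonzero epsilon, and dominated
  convergence returns to epsilon = 0.\<close>

lemma det_power_orthogonal:
  fixes b y :: "'n \<Rightarrow> complex ^ 'n"
  assumes m: "m i0 \<noteq> k"
  shows "(\<integral>U. (\<Prod>i\<in>UNIV. bilin_form (b i) U (y i) ^ m i) * cnj (det U) ^ k \<partial>\<mu>) = 0"
proof -
  define B where "B \<epsilon> = (\<chi> i j. (\<chi> i. b i) $ i $ j + (if i = j then \<epsilon> else 0))" for \<epsilon>
  define f where "f \<epsilon> U = (\<Prod>i\<in>UNIV. bilin_form (B \<epsilon> $ i) U (y i) ^ m i) * cnj (det U) ^ k" for \<epsilon> U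
  have Bi: "B \<epsilon> $ i = b i + \<epsilon> *s axis i 1" for \<epsilon> i
    by (auto simp: B_def vec_eq_iff axis_def)
  have bil: "bilin_form (B \<epsilon> $ i) U (y i) = bilin_form (b i) U (y i) + \<epsilon> * bilin_form (axis i 1) U (y i)" for \<epsilon> i U
    unfolding Bi bilin_form_add_left bilin_form_scale_left ..
  define e where "e n = complex_of_real (inverse (real (Suc n)))" for n
  have e0: "e \<longlonglongrightarrow> 0" unfolding e_def
    by (rule tendsto_eq_rhs[OF tendsto_of_real[OF LIMSEQ_inverse_real_of_nat]]) simp
  have "filterlim e (at 0) sequentially" using e0
    by (auto simp: filterlim_at e_def simp del: of_nat_Suc)
  then have ev: "eventually (\<lambda>n. det (B (e n)) \<noteq> 0) sequentially"
    using eventually_invertible_shift[of "\<chi> i. b i"] unfolding B_def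
    by (rule eventually_compose_filterlim[rotated])
  \<comment> \<open>Bounds the perturbed forms for all |epsilon| <= 1 at once.\<close>
  define K where "K i = (\<Sum>r\<in>UNIV. norm (b i $ r)) * (\<Sum>s\<in>UNIV. norm (y i $ s)) + (\<Sum>r\<in>UNIV. norm ((axis i 1 :: complex ^ 'n) $ r)) * (\<Sum>s\<in>UNIV. norm (y i $ s))" for i
  have K0: "0 \<le> K i" for i unfolding K_def by (intro add_nonneg_nonneg mult_nonneg_nonneg sum_nonneg) auto
  have mp: "matpoly (\<lambda>P Q. (\<Prod>i\<in>UNIV. bilin_form (c i) P (y i) ^ m i) * det Q ^ k)" for c
    by (intro matpoly_mult matpoly_prod matpoly_power matpoly_bilin_form matpoly_det_snd)
  obtain Bd where Bd: "\<And>U :: complex ^ 'n ^ 'n. U \<in> unitary_group \<Longrightarrow> norm (det (conj_entries U)) \<le> Bd"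
    using matpoly_bounded[OF matpoly_det_snd] by blast
  have fm: "f \<epsilon> \<in> borel_measurable \<mu>" for \<epsilon>
    using measurable_matpoly[OF mp] unfolding f_def cnj_det .
  have "(\<lambda>n. \<integral>U. f (e n) U \<partial>\<mu>) \<longlonglongrightarrow> (\<integral>U. f 0 U \<partial>\<mu>)"
  proof (rule integral_dominated_convergence[where w = "\<lambda>_. (\<Prod>i\<in>UNIV. K i ^ m i) * Bd ^ k"])
    show "f 0 \<in> borel_measurable \<mu>" "f (e n) \<in> borel_measurable \<mu>" for n by (rule fm)+
    show "AE U in \<mu>. (\<lambda>n. f (e n) U) \<longlonglongrightarrow> f 0 U"
      unfolding f_def bil by (intro AE_I2 tendsto_intros e0)
    show "AE U in \<mu>. norm (f (e n) U) \<le> (\<Prod>i\<in>UNIV. K i ^ m i) * Bd ^ k" for n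
    proof (rule AE_I2)
      fix U assume "U \<in> space \<mu>"
      then have U: "U \<in> unitary_group" by (simp add: space_haar)
      have en: "norm (e n) \<le> 1" unfolding e_def norm_of_real by (simp add: field_simps)
      have "norm (bilin_form (B (e n) $ i) U (y i)) \<le> K i" for i
      proof -
        have "norm (e n * bilin_form (axis i 1) U (y i)) \<le> norm (bilin_form (axis i 1) U (y i))"
          using en by (simp add: norm_mult mult_right_le_one_le mult_left_le_one_le)
        also have "\<dots> \<le> (\<Sum>r\<in>UNIV. norm ((axis i 1 :: complex ^ 'n) $ r)) * (\<Sum>s\<in>UNIV. norm (y i $ s))"
          by (rule bilin_form_bound[OF U])
        finally show ?thesis unfolding bil K_def
          by (intro norm_triangle_le add_mono bilin_form_bound[OF U])
      qed
      then show "norm (f (e n) U) \<le> (\<Prod>i\<in>UNIV. K i ^ m i) * Bd ^ k"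
        unfolding f_def norm_mult prod_norm[symmetric] norm_power cnj_det using Bd[OF U]
        by (intro mult_mono prod_mono power_mono conjI prod_nonneg)
           (auto simp: K0)
    qed
  qed auto
  moreover have "eventually (\<lambda>n. (\<integral>U. f (e n) U \<partial>\<mu>) = 0) sequentially"
    using ev
  proof eventually_elim
    case (elim n)
    show ?case unfolding f_def by (rule det_power_orthogonal_invertible[where m = m, OF elim m])
  qed
  then have "(\<lambda>n. \<integral>U. f (e n) U \<partial>\<mu>) \<longlonglongrightarrow> 0" by (rule tendsto_eventually)
  ultimately have "(\<integral>U. f 0 U \<partial>\<mu>) = 0" by (rule LIMSEQ_unique)
  then show ?thesis unfolding f_def bil by simp
qed


section \<open>Quadratic forms in a Haar-distributed unit vector\<close>

lemma column_norm:
  assumes "V \<in> unitary_group"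
  shows "(\<Sum>s\<in>UNIV. cnj (V $ s $ c) * V $ s $ c) = 1"
proof -
  have "(conj_transpose V ** V) $ c $ c = 1" using assms by (simp add: unitary_group_def mat_def)
  then show ?thesis by (simp add: matrix_matrix_mult_def conj_transpose_def)
qed

text \<open>This is v* A v for the \<open>c\<close>-th column v of \<open>V\<close>. When
  \<open>V\<close> is Haar distributed, v is uniform on the unit sphere.\<close>

definition column_form :: "'n \<Rightarrow> complex ^ 'n ^ 'n \<Rightarrow> complex ^ 'n ^ 'n \<Rightarrow> complex" where
  "column_form c A V = bilin_form (column c (conj_entries V)) A (column c V)"

lemma column_form_eq: "column_form c A V = (\<Sum>r\<in>UNIV. cnj (V $ r $ c) * (\<Sum>s\<in>UNIV. A $ r $ s * V $ s $ c))"
  by (simp add: column_form_def bilin_form_def column_def sum_distrib_left mult.assoc)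

lemma matpoly_column_form:
  "matpoly (\<lambda>P Q. \<Sum>r\<in>UNIV. Q $ r $ c * (\<Sum>s\<in>UNIV. A $ r $ s * P $ s $ c))"
  by (intro matpoly_sum matpoly_mult matpoly.intros)

lemma integrable_column_form:
  "integrable \<mu> (\<lambda>V. column_form c A V * column_form c B V ^ n)"
proof -
  have "matpoly (\<lambda>P Q. (\<Sum>r\<in>UNIV. Q $ r $ c * (\<Sum>s\<in>UNIV. A $ r $ s * P $ s $ c)) *
     (\<Sum>r\<in>UNIV. Q $ r $ c * (\<Sum>s\<in>UNIV. B $ r $ s * P $ s $ c)) ^ n)"
    by (intro matpoly_mult matpoly_power matpoly_column_form)
  from integrable_matpoly[OF this] show ?thesis by (simp add: column_form_eq)
qed

lemma integrable_column_form_power: "integrable \<mu> (\<lambda>V. column_form c B V ^ n)"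
proof -
  have "matpoly (\<lambda>P Q. (\<Sum>r\<in>UNIV. Q $ r $ c * (\<Sum>s\<in>UNIV. B $ r $ s * P $ s $ c)) ^ n)"
    by (intro matpoly_mult matpoly_power matpoly_column_form)
  from integrable_matpoly[OF this] show ?thesis by (simp add: column_form_eq)
qed

text \<open>
  Iterating this in \<open>A\<close> gives Newton's recursion, so the \<open>n\<close>-th moment of \<open>v\<^sup>* U v\<close> over the unit
  sphere is a multiple of the \<open>n\<close>-th complete symmetric function of the eigenvalues of \<open>U\<close>.
\<close>

lemma column_form_recursion:
  "(of_nat CARD('n) + of_nat n) * (\<integral>V. column_form c A V * column_form c U V ^ n \<partial>\<mu>) =
    trace A * (\<integral>V. column_form c U V ^ n \<partial>\<mu>) +
    of_nat n * (\<integral>V. column_form c (U ** A) V * column_form c U V ^ (n - 1) \<partial>\<mu>)"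
proof -
  define X :: "'n \<Rightarrow> 'n \<Rightarrow> complex ^ 'n ^ 'n" where "X r s = (\<chi> i j. if i = r \<and> j = s then 1 else 0)" for r s
  define av where "av V r = (\<Sum>t\<in>UNIV. A $ r $ t * V $ t $ c)" for V :: "complex ^ 'n ^ 'n" and r
  define uv where "uv V r = (\<Sum>t\<in>UNIV. U $ r $ t * V $ t $ c)" for V :: "complex ^ 'n ^ 'n" and r
  define wu where "wu V s = (\<Sum>r\<in>UNIV. cnj (V $ r $ c) * U $ r $ s)" for V :: "complex ^ 'n ^ 'n" and s
  \<comment> \<open>The test function is conj(v_s) (Av)_r (v* U v)^n, moved along the matrix unit at
    (r, s). The recursion is the sum of the resulting identities over all r and s, in which |v| = 1
    collapses the sum over s.\<close>
  define F where "F r s P Q = Q $ s $ c * (\<Sum>t\<in>UNIV. A $ r $ t * P $ t $ c) *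
     (\<Sum>a\<in>UNIV. Q $ a $ c * (\<Sum>t\<in>UNIV. U $ a $ t * P $ t $ c)) ^ n" for r s and P Q :: "complex ^ 'n ^ 'n"
  define d where "d r s V = - (cnj (V $ r $ c) * av V r * column_form c U V ^ n)
     + cnj (V $ s $ c) * (A $ r $ r * V $ s $ c) * column_form c U V ^ n
     + cnj (V $ s $ c) * av V r * (of_nat n * column_form c U V ^ (n - 1) * (wu V r * V $ s $ c - cnj (V $ r $ c) * uv V s))"
     for r s V
  have XV: "(X r s ** V) $ i $ j = (if i = r then V $ s $ j else 0)" for r s i j and V :: "complex ^ 'n ^ 'n"
  proof -
    have "(X r s ** V) $ i $ j = (\<Sum>k\<in>UNIV. if k = s then (if i = r then V $ k $ j else 0) else 0)"
      unfolding matrix_matrix_mult_def vec_lambda_beta by (intro sum.cong) (auto simp: X_def)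
    then show ?thesis by simp
  qed
  have XT: "(transpose (X r s) ** V) $ i $ j = (if i = s then V $ r $ j else 0)" for r s i j and V :: "complex ^ 'n ^ 'n"
  proof -
    have "transpose (X r s) = X s r" by (auto simp: X_def transpose_def vec_eq_iff)
    then show ?thesis by (simp add: XV)
  qed
  have int0: "(\<integral>V. d r s V \<partial>\<mu>) = 0" for r s
  proof (rule schwinger_dyson[of "F r s" "X r s"])
    show "matpoly (F r s)" unfolding F_def
      by (intro matpoly_mult matpoly_power matpoly_sum matpoly.intros)
  next
    fix V :: "complex ^ 'n ^ 'n" assume V: "V \<in> unitary_group"
    have e1: "(\<Sum>t\<in>UNIV. M $ a $ t * (V $ t $ c + z * (if t = r then V $ s $ c else 0))) =
       (\<Sum>t\<in>UNIV. M $ a $ t * V $ t $ c) + z * (M $ a $ r * V $ s $ c)" for M :: "complex ^ 'n ^ 'n" and a z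
    proof -
      have "(\<Sum>t\<in>UNIV. M $ a $ t * (V $ t $ c + z * (if t = r then V $ s $ c else 0))) =
        (\<Sum>t\<in>UNIV. M $ a $ t * V $ t $ c + (if t = r then z * (M $ a $ t * V $ s $ c) else 0))"
        by (intro sum.cong) (auto simp: algebra_simps)
      then show ?thesis by (simp add: sum.distrib)
    qed
    have e2: "(\<Sum>a\<in>UNIV. (cnj (V $ a $ c) - z * (if a = s then cnj (V $ r $ c) else 0)) *
        ((\<Sum>t\<in>UNIV. U $ a $ t * V $ t $ c) + z * (U $ a $ r * V $ s $ c))) =
       column_form c U V + z * (wu V r * V $ s $ c) - z * cnj (V $ r $ c) * (uv V s + z * (U $ s $ r * V $ s $ c))" for z
    proof -
      have "(\<Sum>a\<in>UNIV. (cnj (V $ a $ c) - z * (if a = s then cnj (V $ r $ c) else 0)) *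
        ((\<Sum>t\<in>UNIV. U $ a $ t * V $ t $ c) + z * (U $ a $ r * V $ s $ c))) =
        (\<Sum>a\<in>UNIV. cnj (V $ a $ c) * uv V a + z * (cnj (V $ a $ c) * U $ a $ r * V $ s $ c)
          - (if a = s then z * cnj (V $ r $ c) * (uv V a + z * (U $ a $ r * V $ s $ c)) else 0))"
        unfolding uv_def by (intro sum.cong) (auto simp: algebra_simps)
      then show ?thesis
        unfolding sum_subtractf sum.distrib
        by (simp add: column_form_eq uv_def wu_def sum_distrib_left sum_distrib_right mult.assoc)
    qed
    have "F r s (\<chi> i j. V $ i $ j + z * (X r s ** V) $ i $ j)
             (\<chi> i j. cnj (V $ i $ j) - z * (transpose (X r s) ** conj_entries V) $ i $ j) =
       (cnj (V $ s $ c) - z * cnj (V $ r $ c)) * (av V r + z * (A $ r $ r * V $ s $ c)) *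
       (column_form c U V + z * (wu V r * V $ s $ c) - z * cnj (V $ r $ c) * (uv V s + z * (U $ s $ r * V $ s $ c))) ^ n" for z
      unfolding F_def vec_lambda_beta XV XT conj_entries_nth e1 e2 by (simp add: av_def)
    moreover have "((\<lambda>z. (cnj (V $ s $ c) - z * cnj (V $ r $ c)) * (av V r + z * (A $ r $ r * V $ s $ c)) *
       (column_form c U V + z * (wu V r * V $ s $ c) - z * cnj (V $ r $ c) * (uv V s + z * (U $ s $ r * V $ s $ c))) ^ n)
       has_field_derivative d r s V) (at 0)"
      unfolding d_def by (rule product_rule_at_0)
    ultimately show "((\<lambda>z. F r s (\<chi> i j. V $ i $ j + z * (X r s ** V) $ i $ j)
             (\<chi> i j. cnj (V $ i $ j) - z * (transpose (X r s) ** conj_entries V) $ i $ j))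
       has_field_derivative d r s V) (at 0)" by simp
  qed
  have int_d: "integrable \<mu> (d r s)" for r s
  proof -
    have "matpoly (\<lambda>P Q. (-1) * (Q $ r $ c * (\<Sum>t\<in>UNIV. A $ r $ t * P $ t $ c) * (\<Sum>r\<in>UNIV. Q $ r $ c * (\<Sum>s\<in>UNIV. U $ r $ s * P $ s $ c)) ^ n)
     + Q $ s $ c * (A $ r $ r * P $ s $ c) * (\<Sum>r\<in>UNIV. Q $ r $ c * (\<Sum>s\<in>UNIV. U $ r $ s * P $ s $ c)) ^ n
     + Q $ s $ c * (\<Sum>t\<in>UNIV. A $ r $ t * P $ t $ c) * (of_nat n * (\<Sum>r\<in>UNIV. Q $ r $ c * (\<Sum>s\<in>UNIV. U $ r $ s * P $ s $ c)) ^ (n - 1)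
       * ((\<Sum>a\<in>UNIV. Q $ a $ c * U $ a $ r) * P $ s $ c + (-1) * (Q $ r $ c * (\<Sum>t\<in>UNIV. U $ s $ t * P $ t $ c)))))"
      by (intro matpoly_add matpoly_mult matpoly_power matpoly_sum matpoly_const matpoly_fst matpoly_snd)
    from integrable_matpoly[OF this] show ?thesis
      by (simp add: d_def[abs_def] column_form_eq av_def uv_def wu_def)
  qed
  have sum_d: "(\<Sum>r\<in>UNIV. \<Sum>s\<in>UNIV. d r s V) =
      trace A * column_form c U V ^ n + of_nat n * (column_form c (U ** A) V * column_form c U V ^ (n - 1))
      - (of_nat CARD('n) + of_nat n) * (column_form c A V * column_form c U V ^ n)" if V: "V \<in> unitary_group" for V
  proof -
    let ?q = "column_form c U V"
    have qa: "column_form c A V = (\<Sum>r\<in>UNIV. cnj (V $ r $ c) * av V r)"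
      by (simp add: column_form_eq av_def)
    have qu: "?q = (\<Sum>s\<in>UNIV. cnj (V $ s $ c) * uv V s)"
      by (simp add: column_form_eq uv_def)
    have qua: "column_form c (U ** A) V = (\<Sum>r\<in>UNIV. wu V r * av V r)"
    proof -
      have "column_form c (U ** A) V = (\<Sum>a\<in>UNIV. \<Sum>t\<in>UNIV. \<Sum>r\<in>UNIV. cnj (V $ a $ c) * U $ a $ r * A $ r $ t * V $ t $ c)"
        by (simp add: column_form_eq matrix_matrix_mult_def sum_distrib_left sum_distrib_right mult.assoc)
      also have "\<dots> = (\<Sum>a\<in>UNIV. \<Sum>r\<in>UNIV. \<Sum>t\<in>UNIV. cnj (V $ a $ c) * U $ a $ r * A $ r $ t * V $ t $ c)"
        by (intro sum.cong refl sum.swap)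
      also have "\<dots> = (\<Sum>r\<in>UNIV. \<Sum>a\<in>UNIV. \<Sum>t\<in>UNIV. cnj (V $ a $ c) * U $ a $ r * A $ r $ t * V $ t $ c)"
        by (rule sum.swap)
      finally show ?thesis by (simp add: wu_def av_def sum_product mult.assoc)
    qed
    have inner: "(\<Sum>s\<in>UNIV. d r s V) = - (of_nat CARD('n) * (cnj (V $ r $ c) * av V r * ?q ^ n))
       + A $ r $ r * ?q ^ n + of_nat n * (wu V r * av V r) * ?q ^ (n - 1)
       - of_nat n * (cnj (V $ r $ c) * av V r) * (?q ^ (n - 1) * ?q)" for r
    proof -
      have "(\<Sum>s\<in>UNIV. d r s V) = (\<Sum>s\<in>UNIV. - (cnj (V $ r $ c) * av V r * ?q ^ n)
        + (A $ r $ r * ?q ^ n + of_nat n * (wu V r * av V r) * ?q ^ (n - 1)) * (cnj (V $ s $ c) * V $ s $ c)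
        - of_nat n * (cnj (V $ r $ c) * av V r) * ?q ^ (n - 1) * (cnj (V $ s $ c) * uv V s))"
        unfolding d_def by (intro sum.cong) (auto simp: algebra_simps)
      also have "\<dots> = - (of_nat CARD('n) * (cnj (V $ r $ c) * av V r * ?q ^ n))
        + (A $ r $ r * ?q ^ n + of_nat n * (wu V r * av V r) * ?q ^ (n - 1)) * (\<Sum>s\<in>UNIV. cnj (V $ s $ c) * V $ s $ c)
        - of_nat n * (cnj (V $ r $ c) * av V r) * ?q ^ (n - 1) * (\<Sum>s\<in>UNIV. cnj (V $ s $ c) * uv V s)"
        unfolding sum_subtractf sum.distrib sum_distrib_left[symmetric] by simp
      finally show ?thesis unfolding column_norm[OF V] qu[symmetric] by simp
    qed
    \<comment> \<open>For n = 0 the truncated exponent n - 1 is harmless because of the factor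
      n.\<close>
    have nq: "of_nat n * (?q ^ (n - 1) * ?q) = of_nat n * ?q ^ n"
      by (cases n) auto
    have "(\<Sum>r\<in>UNIV. \<Sum>s\<in>UNIV. d r s V) = - (of_nat CARD('n) * (column_form c A V * ?q ^ n))
       + trace A * ?q ^ n + of_nat n * column_form c (U ** A) V * ?q ^ (n - 1)
       - column_form c A V * (of_nat n * (?q ^ (n - 1) * ?q))"
    proof -
      have "(\<Sum>r\<in>UNIV. - (K * (x r * Q)) + a r * Q + L * w r * Q' - L * x r * R) =
        - (K * (sum x UNIV * Q)) + sum a UNIV * Q + L * sum w UNIV * Q' - sum x UNIV * (L * R)"
        for x a w :: "'n \<Rightarrow> complex" and K L Q Q' R
        by (simp add: sum.distrib sum_subtractf sum_negf sum_distrib_left sum_distrib_right mult_ac)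
      then show ?thesis unfolding inner qa qua trace_def .
    qed
    then show ?thesis unfolding nq by (simp add: algebra_simps)
  qed
  have "0 = (\<integral>V. (\<Sum>r\<in>UNIV. \<Sum>s\<in>UNIV. d r s V) \<partial>\<mu>)"
    using int0 int_d by (simp add: Bochner_Integration.integral_sum)
  also have "\<dots> = (\<integral>V. trace A * column_form c U V ^ n + of_nat n * (column_form c (U ** A) V * column_form c U V ^ (n - 1))
      - (of_nat CARD('n) + of_nat n) * (column_form c A V * column_form c U V ^ n) \<partial>\<mu>)"
    by (rule Bochner_Integration.integral_cong) (auto simp: space_haar sum_d)
  also have "\<dots> = trace A * (\<integral>V. column_form c U V ^ n \<partial>\<mu>)
     + of_nat n * (\<integral>V. column_form c (U ** A) V * column_form c U V ^ (n - 1) \<partial>\<mu>)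
     - (of_nat CARD('n) + of_nat n) * (\<integral>V. column_form c A V * column_form c U V ^ n \<partial>\<mu>)"
    by (simp add: integrable_column_form integrable_column_form_power)
  finally show ?thesis by simp
qed

end

section \<open>Complete symmetric functions of the eigenvalues\<close>

text \<open>Encoded by the product of the series 1/(1 - z_i X) instead of a sum over monomials,
  since all later identities are identities of this generating series.\<close>

definition complete_sym :: "('n \<Rightarrow> complex) \<Rightarrow> nat \<Rightarrow> complex" where
  "complete_sym z n = fps_nth (\<Prod>i\<in>UNIV. Abs_fps (\<lambda>n. z i ^ n)) n"

primrec matrix_power :: "'a::semiring_1 ^ 'n ^ 'n \<Rightarrow> nat \<Rightarrow> 'a ^ 'n ^ 'n" where
  "matrix_power U 0 = mat 1"
| "matrix_power U (Suc n) = U ** matrix_power U n"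

lemma matrix_power_commute: "matrix_power U n ** U = U ** matrix_power U n"
  by (induction n) (simp_all flip: matrix_mul_assoc)

lemma geometric_fps: "Abs_fps (\<lambda>n. c ^ n) * (1 - fps_const c * fps_X) = (1 :: complex fps)"
proof (rule fps_ext)
  fix n
  show "fps_nth (Abs_fps (\<lambda>n. c ^ n) * (1 - fps_const c * fps_X)) n = fps_nth 1 n"
    by (cases n) (simp_all add: algebra_simps)
qed

lemma fps_of_poly_sign: "fps_of_poly (of_int (sign p) * q) = of_int (sign p) * fps_of_poly (q :: complex poly)"
  by (simp add: sign_def fps_of_poly_uminus)

lemma poly_sign: "poly (of_int (sign p) * q) x = of_int (sign p) * poly (q :: complex poly) x"
  by (simp add: sign_def)

text \<open>Both sides are polynomials in X with equal values everywhere by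
  \<open>det_one_minus_eq_prod\<close>; their equality is carried over to formal power
  series.\<close>

lemma det_fps_eq_prod:
  fixes U :: "complex ^ 'n ^ 'n" and z :: "'n \<Rightarrow> complex"
  assumes "char_polynomial U = (\<Prod>i\<in>UNIV. [:- z i, 1:])"
  shows "det (\<chi> i j. (if i = j then 1 else 0) - fps_const (U $ i $ j) * fps_X) =
    (\<Prod>i\<in>UNIV. 1 - fps_const (z i) * fps_X)"
proof -
  have "poly (det (\<chi> i j. [:if i = j then 1 else 0, - (U $ i $ j):])) x = poly (\<Prod>i\<in>UNIV. [:1, - z i:]) x" for x
  proof -
    have "poly (det (\<chi> i j. [:if i = j then 1 else 0, - (U $ i $ j):])) x =
        det (\<chi> i j. (if i = j then 1 else 0) - x * U $ i $ j)"
      unfolding det_def by (simp add: poly_sum poly_prod poly_sign if_distrib if_distribR cong: if_cong)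
    then show ?thesis using det_one_minus_eq_prod[OF assms, of x] by (simp add: poly_prod)
  qed
  then have "det (\<chi> i j. [:if i = j then 1 else 0, - (U $ i $ j):]) = (\<Prod>i\<in>UNIV. [:1, - z i:])"
    by (intro poly_eqI_degree_lead_coeff poly_ext) auto
  then have "fps_of_poly (det (\<chi> i j. [:if i = j then 1 else 0, - (U $ i $ j):])) = fps_of_poly (\<Prod>i\<in>UNIV. [:1, - z i:])"
    by simp
  moreover have "fps_of_poly (det (\<chi> i j. [:if i = j then 1 else 0, - (U $ i $ j):])) =
     det (\<chi> i j. (if i = j then 1 else 0) - fps_const (U $ i $ j) * fps_X)"
    unfolding det_def
    by (simp add: fps_of_poly_sum fps_of_poly_prod fps_of_poly_sign fps_of_poly_pCons
        if_distrib if_distribR fps_const_neg[symmetric] del: fps_const_neg cong: if_cong)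
  moreover have "fps_of_poly (\<Prod>i\<in>UNIV. [:1, - z i:]) = (\<Prod>i\<in>UNIV. 1 - fps_const (z i) * fps_X)"
    by (simp add: fps_of_poly_prod fps_of_poly_pCons fps_const_neg[symmetric] del: fps_const_neg)
  ultimately show ?thesis by simp
qed

lemma fps_deriv_prod:
  assumes "finite S"
  shows "fps_deriv (\<Prod>k\<in>S. f k :: complex fps) = (\<Sum>i\<in>S. fps_deriv (f i) * (\<Prod>k\<in>S - {i}. f k))"
  using assms
proof (induction S)
  case (insert a S)
  have "(\<Sum>i\<in>S. fps_deriv (f i) * (\<Prod>k\<in>insert a S - {i}. f k)) =
      (\<Sum>i\<in>S. f a * (fps_deriv (f i) * (\<Prod>k\<in>S - {i}. f k)))"
  proof (rule sum.cong[OF refl])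
    fix i assume i: "i \<in> S"
    then have "insert a S - {i} = insert a (S - {i})" using insert.hyps by auto
    then show "fps_deriv (f i) * (\<Prod>k\<in>insert a S - {i}. f k) = f a * (fps_deriv (f i) * (\<Prod>k\<in>S - {i}. f k))"
      using insert.hyps by simp
  qed
  moreover have "insert a S - {a} = S" using insert.hyps by auto
  ultimately show ?case using insert by (simp add: sum_distrib_left)
qed simp

lemma fps_deriv_det:
  fixes M :: "complex fps ^ 'n ^ 'n"
  shows "fps_deriv (det M) = (\<Sum>i\<in>UNIV. det (\<chi> k. if k = i then (\<chi> j. fps_deriv (M $ i $ j)) else M $ k))"
proof -
  have "fps_deriv (of_int (sign p) * (\<Prod>k\<in>UNIV. M $ k $ p k)) =
      (\<Sum>i\<in>UNIV. of_int (sign p) * (fps_deriv (M $ i $ p i) * (\<Prod>k\<in>UNIV - {i}. M $ k $ p k)))" for p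
  proof -
    have "fps_deriv (of_int (sign p) * (\<Prod>k\<in>UNIV. M $ k $ p k)) = of_int (sign p) * fps_deriv (\<Prod>k\<in>UNIV. M $ k $ p k)"
      by (simp add: sign_def)
    then show ?thesis by (simp add: fps_deriv_prod sum_distrib_left)
  qed
  moreover have "(\<Prod>k\<in>UNIV. (\<chi> k. if k = i then (\<chi> j. fps_deriv (M $ i $ j)) else M $ k) $ k $ p k) =
      fps_deriv (M $ i $ p i) * (\<Prod>k\<in>UNIV - {i}. M $ k $ p k)" for i p
    by (subst prod.remove[of _ i]) (auto intro!: prod.cong)
  ultimately have "fps_deriv (det M) = (\<Sum>p | p permutes (UNIV::'n set). \<Sum>i\<in>UNIV. of_int (sign p) *
      (\<Prod>k\<in>UNIV. (\<chi> k. if k = i then (\<chi> j. fps_deriv (M $ i $ j)) else M $ k) $ k $ p k))"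
    unfolding det_def by (simp add: fps_deriv_sum)
  then show ?thesis unfolding det_def by (subst sum.swap) simp
qed

text \<open>By multilinearity the summand l yields a matrix with a repeated row unless l = i.
  Applied to the derivatives of the rows, this becomes Jacobi's formula for the derivative of a
  determinant.\<close>

lemma det_replace_row:
  fixes M :: "'a::comm_ring_1 ^ 'n ^ 'n"
  shows "det (\<chi> k. if k = i then (\<Sum>l\<in>UNIV. c l *s M $ l) else M $ k) = c i * det M"
proof -
  have "det (\<chi> k. if k = i then (\<Sum>l\<in>UNIV. c l *s M $ l) else M $ k) =
    (\<Sum>l\<in>UNIV. det (\<chi> k. if k = i then c l *s M $ l else M $ k))"
    by (rule det_linear_row_sum) simp
  also have "\<dots> = (\<Sum>l\<in>UNIV. if l = i then c i * det M else 0)"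
  proof (rule sum.cong[OF refl])
    fix l
    have "det (\<chi> k. if k = i then c l *s M $ l else M $ k) = c l * det (\<chi> k. if k = i then M $ l else M $ k)"
      by (rule det_row_mul)
    moreover have "det (\<chi> k. if k = i then M $ l else M $ k) = (if l = i then det M else 0)"
    proof (cases "l = i")
      case True
      then have "(\<chi> k. if k = i then M $ l else M $ k) = M" by (simp add: vec_eq_iff)
      then show ?thesis using True by simp
    next
      case False
      have "det (\<chi> k. if k = i then M $ l else M $ k) = 0"
        by (rule det_identical_rows[OF False]) (use False in \<open>simp add: row_def vec_eq_iff\<close>)
      then show ?thesis using False by simp
    qed
    ultimately show "det (\<chi> k. if k = i then c l *s M $ l else M $ k) = (if l = i then c i * det M else 0)"
      by simp
  qed
  finally show ?thesis by simp
qed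

text \<open>Newton's identities in the form H' = H T: \<open>H\<close> is inverse to E = det(1 -
  XU), \<open>T\<close> generates the traces of the powers of \<open>U\<close>, and Jacobi's formula
  gives E' = -T E.\<close>

lemma complete_sym_newton:
  fixes U :: "complex ^ 'n ^ 'n" and z :: "'n \<Rightarrow> complex"
  assumes z: "char_polynomial U = (\<Prod>i\<in>UNIV. [:- z i, 1:])"
  shows "of_nat (Suc n) * complete_sym z (Suc n) = (\<Sum>i\<le>n. complete_sym z i * trace (matrix_power U (Suc (n - i))))"
proof -
  define H where "H = (\<Prod>i\<in>UNIV. Abs_fps (\<lambda>n. z i ^ n))"
  define E where "E = (\<Prod>i\<in>UNIV. 1 - fps_const (z i) * fps_X)"
  define M :: "complex fps ^ 'n ^ 'n" where "M = (\<chi> i j. (if i = j then 1 else 0) - fps_const (U $ i $ j) * fps_X)"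
  define T where "T = Abs_fps (\<lambda>n. trace (matrix_power U (Suc n)))"
  define C where "C i k = Abs_fps (\<lambda>n. matrix_power U (Suc n) $ i $ k)" for i k
  have HE: "H * E = 1"
    unfolding H_def E_def prod.distrib[symmetric] geometric_fps by simp
  have EM: "E = det M" unfolding E_def M_def by (rule det_fps_eq_prod[OF z, symmetric])
  \<comment> \<open>\<open>C\<close> is U(1 - XU)^(-1) and \<open>M\<close> is 1 - XU, so -C M = -U,
    the derivative of \<open>M\<close>: each differentiated row is a combination of rows of
    \<open>M\<close>.\<close>
  have CM: "(\<Sum>k\<in>UNIV. - C i k * M $ k $ j) = fps_deriv (M $ i $ j)" for i j
  proof (rule fps_ext)
    fix n
    have s: "(\<Sum>k\<in>UNIV. - C i k * M $ k $ j) = (\<Sum>k\<in>UNIV. C i k * fps_const (U $ k $ j)) * fps_X - C i j"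
    proof -
      have "(\<Sum>k\<in>UNIV. - C i k * M $ k $ j) =
         (\<Sum>k\<in>UNIV. C i k * fps_const (U $ k $ j) * fps_X - (if k = j then C i k else 0))"
        by (intro sum.cong) (auto simp: M_def algebra_simps)
      then show ?thesis by (simp add: sum_subtractf sum_distrib_right)
    qed
    have "(\<Sum>k\<in>UNIV. matrix_power U (Suc m) $ i $ k * U $ k $ j) = matrix_power U (Suc (Suc m)) $ i $ j" for m
    proof -
      have "(matrix_power U (Suc m) ** U) $ i $ j = matrix_power U (Suc (Suc m)) $ i $ j"
        by (metis matrix_power_commute matrix_power.simps(2))
      then show ?thesis by (simp add: matrix_matrix_mult_def)
    qed
    then have "fps_nth (\<Sum>k\<in>UNIV. - C i k * M $ k $ j) n = (if n = 0 then - (U $ i $ j) else 0)"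
      unfolding s by (cases n) (simp_all add: C_def fps_sum_nth del: matrix_power.simps(2), simp)
    moreover have "fps_nth (fps_deriv (M $ i $ j)) n = (if n = 0 then - (U $ i $ j) else 0)"
      by (simp add: M_def)
    ultimately show "fps_nth (\<Sum>k\<in>UNIV. - C i k * M $ k $ j) n = fps_nth (fps_deriv (M $ i $ j)) n" by simp
  qed
  have "fps_deriv E = (\<Sum>i\<in>UNIV. det (\<chi> k. if k = i then (\<Sum>l\<in>UNIV. - C i l *s M $ l) else M $ k))"
  proof -
    have "(\<chi> j. fps_deriv (M $ i $ j)) = (\<Sum>l\<in>UNIV. - C i l *s M $ l)" for i
      unfolding CM[symmetric] by (simp add: vec_eq_iff sum_component)
    then show ?thesis unfolding EM fps_deriv_det by (simp only:)
  qed
  also have "\<dots> = - T * E"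
    unfolding det_replace_row EM
  proof -
    have "(\<Sum>i\<in>UNIV. C i i) = T" by (rule fps_ext) (simp add: C_def T_def trace_def fps_sum_nth)
    then show "(\<Sum>i\<in>UNIV. - C i i * det M) = - T * det M"
      by (simp add: sum_negf flip: sum_distrib_right)
  qed
  finally have dE: "fps_deriv E = - T * E" .
  have "fps_deriv (H * E) = 0" unfolding HE by simp
  then have "fps_deriv H * E = H * T * E" by (simp add: dE algebra_simps)
  then have "H * (fps_deriv H * E) = H * (H * T * E)" by simp
  then have "fps_deriv H * (H * E) = H * T * (H * E)" by (simp only: mult_ac)
  then have "fps_deriv H = H * T" using HE by simp
  then have "fps_nth (fps_deriv H) n = fps_nth (H * T) n" by simp
  then show ?thesis
    by (simp add: fps_mult_nth T_def H_def complete_sym_def atLeast0AtMost del: matrix_power.simps)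
qed

lemma complete_sym_0 [simp]: "complete_sym z 0 = 1"
proof -
  have "fps_nth (\<Prod>i\<in>A. Abs_fps (\<lambda>n. z i ^ n)) 0 = 1" for A
    by (induction A rule: infinite_finite_induct) auto
  then show ?thesis by (simp add: complete_sym_def)
qed

section \<open>Averages over unit vectors as complete symmetric functions\<close>

context haar begin

definition column_moment :: "'n \<Rightarrow> nat \<Rightarrow> complex ^ 'n ^ 'n \<Rightarrow> complex" where
  "column_moment c n U = (\<integral>V. column_form c U V ^ n \<partial>\<mu>)"

text \<open>The ratio of consecutive binomials absorbs the factor N + n of
  \<open>column_form_recursion\<close>.\<close>

lemma binomial_shift:
  assumes "N \<ge> 1"
  shows "real ((N + Suc b - 1) choose Suc b) * real (Suc b) = real ((N + b - 1) choose b) * (real N + real b)"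
proof -
  obtain M where M: "N = Suc M" using assms by (cases N) auto
  have "(M + Suc b choose Suc b) * Suc b = Suc (M + b) * (M + b choose b)"
    using Suc_times_binomial_eq[of "M + b" b] by simp
  then have "real ((M + Suc b choose Suc b) * Suc b) = real (Suc (M + b) * (M + b choose b))" by (rule arg_cong)
  then show ?thesis unfolding M of_nat_mult by (simp add: algebra_simps del: binomial_Suc_Suc)
qed

text \<open>The normalised moments satisfy Newton's recursion with initial value 1, which determines
  them. The binomial is the dimension of the n-th symmetric power, as the case U = 1 shows.\<close>

lemma complete_sym_eq_column_moment:
  fixes z :: "'n \<Rightarrow> complex"
  assumes z: "char_polynomial U = (\<Prod>i\<in>UNIV. [:- z i, 1:])"
  shows "complete_sym z n = of_nat ((CARD('n) + n - 1) choose n) * column_moment c n U"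
proof -
  let ?N = "CARD('n)"
  have N1: "?N \<ge> 1" by (simp add: Suc_leI)
  define t where "t b = of_nat ((?N + b - 1) choose b) * column_moment c b U" for b
  \<comment> \<open>One factor of the form carries U^a. The recursion trades a power of the form for
    U^(a+1), and unrolling it to b = 0 gives the sum of t_i tr U^(a+b-i); the case a = 1 is Newton's
    recursion.\<close>
  define S where "S a b = of_nat ((?N + b - 1) choose b) * (of_nat ?N + of_nat b) *
      (\<integral>V. column_form c (matrix_power U a) V * column_form c U V ^ b \<partial>\<mu>)" for a b
  have S_Suc: "S a (Suc b) = trace (matrix_power U a) * t (Suc b) + S (Suc a) b" for a b
  proof -
    have "real ((?N + Suc b - 1) choose Suc b) * real (Suc b) = real ((?N + b - 1) choose b) * (real ?N + real b)"
      by (rule binomial_shift[OF N1])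
    then have "complex_of_real (real ((?N + Suc b - 1) choose Suc b) * real (Suc b)) = complex_of_real (real ((?N + b - 1) choose b) * (real ?N + real b))"
      by simp
    then have bin: "(of_nat ((?N + Suc b - 1) choose Suc b) * of_nat (Suc b) :: complex) = of_nat ((?N + b - 1) choose b) * (of_nat ?N + of_nat b)"
      by (simp del: of_nat_Suc)
    have "S a (Suc b) = of_nat ((?N + Suc b - 1) choose Suc b) * (trace (matrix_power U a) * column_moment c (Suc b) U +
      of_nat (Suc b) * (\<integral>V. column_form c (U ** matrix_power U a) V * column_form c U V ^ b \<partial>\<mu>))"
      unfolding S_def mult.assoc column_form_recursion by (simp add: column_moment_def del: of_nat_Suc)
    also have "\<dots> = trace (matrix_power U a) * t (Suc b) + of_nat ((?N + Suc b - 1) choose Suc b) * of_nat (Suc b) *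
       (\<integral>V. column_form c (matrix_power U (Suc a)) V * column_form c U V ^ b \<partial>\<mu>)"
      by (simp add: t_def algebra_simps del: of_nat_Suc)
    also have "\<dots> = trace (matrix_power U a) * t (Suc b) + S (Suc a) b"
      unfolding bin S_def ..
    finally show ?thesis .
  qed
  have S_0: "S a 0 = trace (matrix_power U a) * t 0" for a
    using column_form_recursion[where n = 0 and c = c and A = "matrix_power U a" and U = U] by (simp add: S_def t_def column_moment_def)
  have S_sum: "S a b = (\<Sum>i\<le>b. t i * trace (matrix_power U (a + b - i)))" for a b
  proof (induction b arbitrary: a)
    case 0 then show ?case by (simp add: S_0)
  next
    case (Suc b)
    have "S a (Suc b) = trace (matrix_power U a) * t (Suc b) + (\<Sum>i\<le>b. t i * trace (matrix_power U (Suc a + b - i)))"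
      unfolding S_Suc Suc.IH ..
    also have "\<dots> = (\<Sum>i\<le>Suc b. t i * trace (matrix_power U (a + Suc b - i)))" by simp
    finally show ?case .
  qed
  have newton: "of_nat (Suc b) * t (Suc b) = (\<Sum>i\<le>b. t i * trace (matrix_power U (Suc (b - i))))" for b
  proof -
    have "real ((?N + Suc b - 1) choose Suc b) * real (Suc b) = real ((?N + b - 1) choose b) * (real ?N + real b)"
      by (rule binomial_shift[OF N1])
    then have "complex_of_real (real ((?N + Suc b - 1) choose Suc b) * real (Suc b)) = complex_of_real (real ((?N + b - 1) choose b) * (real ?N + real b))"
      by simp
    then have bin: "(of_nat ((?N + Suc b - 1) choose Suc b) * of_nat (Suc b) :: complex) = of_nat ((?N + b - 1) choose b) * (of_nat ?N + of_nat b)"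
      by (simp del: of_nat_Suc)
    have "of_nat (Suc b) * t (Suc b) = S 1 b"
      unfolding S_def bin[symmetric] t_def column_moment_def by (simp add: mult_ac matrix_mul_rid del: of_nat_Suc)
    also have "\<dots> = (\<Sum>i\<le>b. t i * trace (matrix_power U (Suc (b - i))))"
      unfolding S_sum by (intro sum.cong) (auto simp: Suc_diff_le)
    finally show ?thesis .
  qed
  have "complete_sym z n = t n"
  proof (induction n rule: less_induct)
    case (less n)
    show ?case
    proof (cases n)
      case 0 then show ?thesis by (simp add: t_def column_moment_def prob_space)
    next
      case (Suc b)
      have "of_nat (Suc b) * complete_sym z (Suc b) = of_nat (Suc b) * t (Suc b)"
        unfolding complete_sym_newton[OF z] newton using less Suc by (intro sum.cong) auto
      then show ?thesis using Suc by (simp del: of_nat_Suc)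
    qed
  qed
  then show ?thesis by (simp add: t_def)
qed

lemma column_form_bound:
  assumes "U \<in> unitary_group" "V \<in> unitary_group"
  shows "norm (column_form c U V) \<le> (real CARD('n))\<^sup>2"
proof -
  have "norm (column_form c U V) \<le> (\<Sum>r\<in>UNIV. norm (column c (conj_entries V) $ r)) * (\<Sum>s\<in>UNIV. norm (column c V $ s))"
    unfolding column_form_def by (rule bilin_form_bound[OF assms(1)])
  also have "\<dots> \<le> (\<Sum>r\<in>(UNIV::'n set). 1) * (\<Sum>s\<in>(UNIV::'n set). 1)"
    by (intro mult_mono sum_mono sum_nonneg) (auto simp: column_def unitary_entry_le_1[OF assms(2)])
  finally show ?thesis by (simp add: power2_eq_square)
qed

lemma measurable_column_form_pair:
  "(\<lambda>(U, V). column_form c U V) \<in> borel_measurable (\<mu> \<Otimes>\<^sub>M \<mu>)"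
proof -
  have 1: "(\<lambda>p. fst p $ i $ j) \<in> borel_measurable (\<mu> \<Otimes>\<^sub>M \<mu>)" for i j
    by (rule measurable_compose[OF measurable_fst measurable_entry])
  have 2: "(\<lambda>p. snd p $ i $ j) \<in> borel_measurable (\<mu> \<Otimes>\<^sub>M \<mu>)" for i j
    by (rule measurable_compose[OF measurable_snd measurable_entry])
  have 3: "(\<lambda>p. cnj (snd p $ i $ j)) \<in> borel_measurable (\<mu> \<Otimes>\<^sub>M \<mu>)" for i j
    by (rule measurable_compose[OF 2 borel_measurable_continuous_onI]) (intro continuous_intros)
  show ?thesis unfolding column_form_eq case_prod_beta
    by (intro borel_measurable_sum borel_measurable_times 1 2 3)
qed

lemma measurable_column_moment: "column_moment c n \<in> borel_measurable \<mu>"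
proof -
  have "(\<lambda>(U, V). column_form c U V ^ n) \<in> borel_measurable (\<mu> \<Otimes>\<^sub>M \<mu>)"
    using borel_measurable_power[OF measurable_column_form_pair[of c], where n = n] by (simp add: case_prod_beta)
  then show ?thesis unfolding column_moment_def[abs_def] by (rule borel_measurable_lebesgue_integral)
qed

lemma column_moment_bound:
  assumes "U \<in> unitary_group"
  shows "norm (column_moment c n U) \<le> ((real CARD('n))\<^sup>2) ^ n"
proof -
  have "norm (column_moment c n U) \<le> (\<integral>V. norm (column_form c U V ^ n) \<partial>\<mu>)"
    unfolding column_moment_def by (rule integral_norm_bound)
  also have "\<dots> \<le> (\<integral>V. ((real CARD('n))\<^sup>2) ^ n \<partial>\<mu>)"
  proof (rule integral_mono)
    fix V assume "V \<in> space \<mu>"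
    then show "norm (column_form c U V ^ n) \<le> ((real CARD('n))\<^sup>2) ^ n"
      unfolding norm_power by (intro power_mono column_form_bound assms) (auto simp: space_haar)
  qed (auto intro: integrable_norm integrable_column_form_power)
  finally show ?thesis by (simp add: prob_space)
qed

text \<open>Each step of the induction averages one more bilinear form over a column of an
  independent Haar matrix \<open>V\<close>. For fixed \<open>V\<close> the induction hypothesis
  applies with that column inserted, which is why \<open>b\<close> and \<open>y\<close> are
  arbitrary; Fubini exchanges the two integrations.\<close>

lemma column_moment_orthogonal_aux:
  fixes m :: "'n \<Rightarrow> nat"
  assumes m: "m i0 \<noteq> k" and "finite S"
  shows "(\<integral>U. (\<Prod>i\<in>S. column_moment c (m i) U) * ((\<Prod>i\<in>-S. bilin_form (b i) U (y i) ^ m i) * cnj (det U) ^ k) \<partial>\<mu>) = 0"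
  using assms(2)
proof (induction S arbitrary: b y rule: finite_induct)
  case empty
  then show ?case using det_power_orthogonal[where m = m, OF m, of b y] by simp
next
  case (insert j S)
  define G where "G U = (\<Prod>i\<in>S. column_moment c (m i) U) * ((\<Prod>i\<in>-(insert j S). bilin_form (b i) U (y i) ^ m i) * cnj (det U) ^ k)" for U
  have mp: "matpoly (\<lambda>P Q. (\<Prod>i\<in>-(insert j S). bilin_form (b i) P (y i) ^ m i) * det Q ^ k)"
    by (intro matpoly_mult matpoly_prod matpoly_power matpoly_bilin_form matpoly_det_snd)
  have Gm: "G \<in> borel_measurable \<mu>"
    unfolding G_def cnj_det
    by (intro borel_measurable_times[OF _ measurable_matpoly[OF mp]] borel_measurable_prod measurable_column_moment)
  obtain B where B: "\<And>U :: complex ^ 'n ^ 'n. U \<in> unitary_group \<Longrightarrow>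
      norm ((\<Prod>i\<in>-(insert j S). bilin_form (b i) U (y i) ^ m i) * det (conj_entries U) ^ k) \<le> B"
    using matpoly_bounded[OF mp] by blast
  define D where "D = (\<Prod>i\<in>S. ((real CARD('n))\<^sup>2) ^ m i) * B"
  have GD: "norm (G U) \<le> D" if "U \<in> unitary_group" for U
  proof -
    have "norm (\<Prod>i\<in>S. column_moment c (m i) U) \<le> (\<Prod>i\<in>S. ((real CARD('n))\<^sup>2) ^ m i)"
      unfolding prod_norm[symmetric] by (intro prod_mono conjI norm_ge_zero column_moment_bound that)
    then show ?thesis
      unfolding G_def cnj_det norm_mult[of "prod _ S"] D_def
      by (rule mult_mono[OF _ B[OF that]]) (auto intro: prod_nonneg)
  qed
  interpret pr: pair_prob_space \<mu> \<mu> ..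
  have fm: "(\<lambda>(U, V). column_form c U V ^ m j * G U) \<in> borel_measurable (\<mu> \<Otimes>\<^sub>M \<mu>)"
    using borel_measurable_times[OF borel_measurable_power[OF measurable_column_form_pair[of c], where n = "m j"] measurable_compose[OF measurable_fst Gm]]
    by (simp add: case_prod_beta)
  have int: "integrable (\<mu> \<Otimes>\<^sub>M \<mu>) (\<lambda>(U, V). column_form c U V ^ m j * G U)"
  proof (rule pr.P.integrable_const_bound[OF _ fm, where B = "((real CARD('n))\<^sup>2) ^ m j * D"])
    show "AE p in \<mu> \<Otimes>\<^sub>M \<mu>. norm (case p of (U, V) \<Rightarrow> column_form c U V ^ m j * G U) \<le> ((real CARD('n))\<^sup>2) ^ m j * D"
      by (rule AE_I2) (auto simp: space_pair_measure space_haar norm_mult norm_power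
          intro!: mult_mono power_mono column_form_bound GD)
  qed
  have zero: "(\<integral>U. column_form c U V ^ m j * G U \<partial>\<mu>) = 0" for V
  proof -
    define b' where "b' = b(j := column c (conj_entries V))"
    define y' where "y' = y(j := column c V)"
    have "- S = insert j (- insert j S)" using insert.hyps by auto
    then have "(\<Prod>i\<in>-S. bilin_form (b' i) U (y' i) ^ m i) =
       column_form c U V ^ m j * (\<Prod>i\<in>-(insert j S). bilin_form (b i) U (y i) ^ m i)" for U
      by (simp add: b'_def y'_def column_form_def)
    then have "column_form c U V ^ m j * G U = (\<Prod>i\<in>S. column_moment c (m i) U) * ((\<Prod>i\<in>-S. bilin_form (b' i) U (y' i) ^ m i) * cnj (det U) ^ k)" for U
      unfolding G_def by (simp only: mult_ac)
    then show ?thesis using insert.IH[of b' y'] by simp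
  qed
  have "(\<integral>U. (\<Prod>i\<in>insert j S. column_moment c (m i) U) * ((\<Prod>i\<in>-(insert j S). bilin_form (b i) U (y i) ^ m i) * cnj (det U) ^ k) \<partial>\<mu>)
     = (\<integral>U. column_moment c (m j) U * G U \<partial>\<mu>)"
    using insert.hyps by (simp add: G_def mult.assoc)
  also have "\<dots> = (\<integral>U. (\<integral>V. column_form c U V ^ m j * G U \<partial>\<mu>) \<partial>\<mu>)"
    by (simp add: column_moment_def)
  also have "\<dots> = (\<integral>V. (\<integral>U. column_form c U V ^ m j * G U \<partial>\<mu>) \<partial>\<mu>)"
    by (rule pr.Fubini_integral[OF int, symmetric])
  also have "\<dots> = 0" by (simp add: zero)
  finally show ?case .
qed

lemma complete_sym_det_orthogonal:
  fixes z :: "complex ^ 'n ^ 'n \<Rightarrow> 'n \<Rightarrow> complex" and m :: "'n \<Rightarrow> nat"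
  assumes z: "\<And>U. char_polynomial U = (\<Prod>i\<in>UNIV. [:- z U i, 1:])" and m: "m i0 \<noteq> k"
  shows "(\<integral>U. (\<Prod>i\<in>UNIV. complete_sym (z U) (m i)) * cnj (det U) ^ k \<partial>\<mu>) = 0"
proof -
  have "(\<Prod>i\<in>UNIV. complete_sym (z U) (m i)) * cnj (det U) ^ k =
     (\<Prod>i\<in>UNIV. of_nat ((CARD('n) + m i - 1) choose m i)) * ((\<Prod>i\<in>UNIV. column_moment i0 (m i) U) * cnj (det U) ^ k)" for U
    by (simp add: complete_sym_eq_column_moment[OF z, where c = i0] prod.distrib)
  then have "(\<integral>U. (\<Prod>i\<in>UNIV. complete_sym (z U) (m i)) * cnj (det U) ^ k \<partial>\<mu>) =
      (\<Prod>i\<in>UNIV. of_nat ((CARD('n) + m i - 1) choose m i)) * (\<integral>U. (\<Prod>i\<in>UNIV. column_moment i0 (m i) U) * cnj (det U) ^ k \<partial>\<mu>)"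
    by (simp only: integral_mult_right_zero)
  then show ?thesis using column_moment_orthogonal_aux[where m = m and S = UNIV and c = i0, OF m] by simp
qed

text \<open>\<open>z\<close> is an arbitrary labelling of the eigenvalues; measurability comes from
  the moments, which are integrals of jointly measurable functions.\<close>

lemma measurable_complete_sym:
  fixes z :: "complex ^ 'n ^ 'n \<Rightarrow> 'n \<Rightarrow> complex"
  assumes z: "\<And>U. char_polynomial U = (\<Prod>i\<in>UNIV. [:- z U i, 1:])"
  shows "(\<lambda>U. complete_sym (z U) n) \<in> borel_measurable \<mu>"
  unfolding complete_sym_eq_column_moment[OF z, where c = undefined]
  by (intro borel_measurable_times measurable_column_moment) auto

lemma complete_sym_bounded:
  fixes z :: "complex ^ 'n ^ 'n \<Rightarrow> 'n \<Rightarrow> complex"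
  assumes z: "\<And>U. char_polynomial U = (\<Prod>i\<in>UNIV. [:- z U i, 1:])"
  shows "\<exists>B. \<forall>U\<in>unitary_group. norm (complete_sym (z U) n) \<le> B"
proof (intro exI ballI)
  fix U :: "complex ^ 'n ^ 'n" assume "U \<in> unitary_group"
  then show "norm (complete_sym (z U) n) \<le> norm (of_nat ((CARD('n) + n - 1) choose n) :: complex) * ((real CARD('n))\<^sup>2) ^ n"
    unfolding complete_sym_eq_column_moment[OF z, where c = undefined] norm_mult
    by (intro mult_left_mono column_moment_bound) auto
qed

end

section \<open>Alternants and integrals of class functions\<close>

text \<open>A permutation preserves the sum of \<open>e\<close>, so none of the inequalities can be
  strict.\<close>

lemma permutation_decreasing_imp_id:
  fixes e :: "'n::finite \<Rightarrow> nat"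
  assumes p: "p permutes UNIV" and e: "inj e" and le: "\<And>i. e (p i) \<le> e i"
  shows "p = id"
proof -
  have "(\<Sum>i\<in>UNIV. e (p i)) = (\<Sum>i\<in>UNIV. e i)"
    using sum.permute[OF p, of e] by (simp add: comp_def)
  then have "(\<Sum>i\<in>UNIV. e i - e (p i)) = 0"
    by (simp add: sum_subtractf_nat le)
  then have "e i \<le> e (p i)" for i by simp
  then have "e (p i) = e i" for i using le by (intro le_antisym)
  then show ?thesis using e by (auto simp: inj_def fun_eq_iff)
qed

text \<open>The index type carries no order, so triangularity is measured by an injective numbering
  \<open>e\<close>. A permutation other than the identity must increase \<open>e\<close> somewhere
  and thus meets a zero entry.\<close>

lemma det_triangular:
  fixes A :: "'a::comm_ring_1 ^ 'n ^ 'n" and e :: "'n \<Rightarrow> nat"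
  assumes e: "inj e" and A: "\<And>i j. e i < e j \<Longrightarrow> A $ i $ j = 0"
  shows "det A = (\<Prod>i\<in>UNIV. A $ i $ i)"
proof -
  have "of_int (sign p) * (\<Prod>i\<in>UNIV. A $ i $ p i) = (if p = id then (\<Prod>i\<in>UNIV. A $ i $ i) else 0)"
    if p: "p permutes (UNIV :: 'n set)" for p
  proof (cases "p = id")
    case True
    then show ?thesis by simp
  next
    case False
    then obtain i where "e i < e (p i)"
      using permutation_decreasing_imp_id[OF p e] by (meson leI)
    then have "A $ i $ p i = 0" by (rule A)
    then have "(\<Prod>i\<in>UNIV. A $ i $ p i) = 0" by (intro prod_zero) auto
    then show ?thesis using False by simp
  qed
  then have "det A = (\<Sum>p | p permutes (UNIV :: 'n set). if p = id then (\<Prod>i\<in>UNIV. A $ i $ i) else 0)"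
    unfolding det_def by (intro sum.cong) auto
  then show ?thesis by (simp add: permutes_id finite_permutations)
qed

lemma det_triangular':
  fixes A :: "'a::comm_ring_1 ^ 'n ^ 'n" and e :: "'n \<Rightarrow> nat"
  assumes e: "inj e" and A: "\<And>i j. e j < e i \<Longrightarrow> A $ i $ j = 0"
  shows "det A = (\<Prod>i\<in>UNIV. A $ i $ i)"
proof -
  have "det (transpose A) = (\<Prod>i\<in>UNIV. transpose A $ i $ i)"
    by (rule det_triangular[OF e]) (simp add: transpose_def A)
  then show ?thesis by (simp only: det_transpose) (simp add: transpose_def)
qed

lemma poly_eq_sum_index:
  fixes p :: "'a::comm_ring_1 poly" and e :: "'n::finite \<Rightarrow> nat"
  assumes e: "bij_betw e UNIV {..<CARD('n)}" and p: "degree p < CARD('n)"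
  shows "poly p x = (\<Sum>j\<in>UNIV. coeff p (e j) * x ^ e j)"
proof -
  have "poly p x = (\<Sum>i\<le>degree p. coeff p i * x ^ i)" by (rule poly_altdef)
  also have "\<dots> = (\<Sum>i<CARD('n). coeff p i * x ^ i)"
    using p by (intro sum.mono_neutral_left) (auto simp: coeff_eq_0)
  also have "\<dots> = (\<Sum>j\<in>UNIV. coeff p (e j) * x ^ e j)"
    using sum.reindex_bij_betw[OF e, of "\<lambda>i. coeff p i * x ^ i"] by simp
  finally show ?thesis .
qed

text \<open>The matrix of values is the Vandermonde matrix times the transposed matrix of
  coefficients.\<close>

lemma det_poly_rows:
  fixes x :: "'n::finite \<Rightarrow> 'a::comm_ring_1" and e :: "'n \<Rightarrow> nat"
  assumes e: "bij_betw e UNIV {..<CARD('n)}" and p: "\<And>j. degree (p j) < CARD('n)"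
  shows "det (\<chi> i j. poly (p j) (x i)) = det (\<chi> i j. x i ^ e j) * det (\<chi> i j. coeff (p i) (e j))"
proof -
  have "(\<chi> i j. poly (p j) (x i)) = (\<chi> i j. x i ^ e j) ** transpose (\<chi> i j. coeff (p i) (e j))"
    by (simp add: vec_eq_iff matrix_matrix_mult_def transpose_def poly_eq_sum_index[OF e p] mult.commute)
  then show ?thesis by (simp add: det_mul)
qed

lemma det_monic_coefficients:
  fixes e :: "'n::finite \<Rightarrow> nat"
  assumes e: "inj e" and p: "\<And>j. degree (p j) = e j" "\<And>j. lead_coeff (p j) = (1::'a::comm_ring_1)"
  shows "det (\<chi> i j. coeff (p i) (e j)) = 1"
proof -
  have "det (\<chi> i j. coeff (p i) (e j)) = (\<Prod>i\<in>UNIV. (\<chi> i j. coeff (p i) (e j)) $ i $ i)"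
    by (rule det_triangular[OF e]) (simp add: p coeff_eq_0)
  also have "\<dots> = 1" by (intro prod.neutral) (simp add: p(2) flip: p(1))
  finally show ?thesis .
qed

text \<open>Passing to the Newton basis makes the Vandermonde matrix triangular.\<close>

lemma det_vandermonde:
  fixes x :: "'n::finite \<Rightarrow> 'a::idom" and e :: "'n \<Rightarrow> nat"
  assumes e: "bij_betw e UNIV {..<CARD('n)}"
  shows "det (\<chi> i j. x i ^ e j) = (\<Prod>i\<in>UNIV. \<Prod>i' | e i' < e i. x i - x i')"
proof -
  have inj: "inj e" using e by (simp add: bij_betw_def)
  define p where "p j = (\<Prod>i | e i < e j. [:- x i, 1:])" for j
  have lt: "e j < CARD('n)" for j using bij_betwE[OF e] by auto
  have card: "card {i. e i < e j} = e j" for j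
  proof -
    have "e ` {i. e i < e j} = {..<e j}"
    proof -
      have "{..<e j} \<subseteq> e ` UNIV"
        using e lt[of j] by (auto simp: bij_betw_def)
      then show ?thesis by auto
    qed
    then show ?thesis using card_image[of e "{i. e i < e j}"] inj by (simp add: inj_on_def)
  qed
  have deg: "degree (p j) = e j" for j
    unfolding p_def by (subst degree_prod_eq_sum_degree) (auto simp: card)
  have lead: "lead_coeff (p j) = 1" for j
    unfolding p_def lead_coeff_prod by simp
  have lt: "e j < CARD('n)" for j using bij_betwE[OF e] by auto
  have "det (\<chi> i j. poly (p j) (x i)) = det (\<chi> i j. x i ^ e j)"
    using det_poly_rows[OF e, of p x] det_monic_coefficients[OF inj deg lead] lt by (simp add: deg)
  moreover have "det (\<chi> i j. poly (p j) (x i)) = (\<Prod>i\<in>UNIV. (\<chi> i j. poly (p j) (x i)) $ i $ i)"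
    by (rule det_triangular[OF inj]) (auto simp: p_def poly_prod)
  ultimately show ?thesis by (simp add: p_def poly_prod)
qed

lemma det_vandermonde_nonzero:
  fixes x :: "'n::finite \<Rightarrow> 'a::idom" and e :: "'n \<Rightarrow> nat"
  assumes e: "bij_betw e UNIV {..<CARD('n)}" and x: "inj x"
  shows "det (\<chi> i j. x i ^ e j) \<noteq> 0"
  unfolding det_vandermonde[OF e] using x by (auto simp: inj_def)

text \<open>Complete symmetric functions of negative index are 0; truncated subtraction alone would
  yield index 0 and the value 1.\<close>

definition complete_sym_shift :: "('n \<Rightarrow> complex) \<Rightarrow> nat \<Rightarrow> nat \<Rightarrow> complex" where
  "complete_sym_shift z n a = (if a \<le> n then complete_sym z (n - a) else 0)"

text \<open>The series 1/(1 - z_l X) is the full generating series times the product of the other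
  factors 1 - z_l' X, a polynomial of degree below N; the identity compares coefficients of
  X^n.\<close>

lemma sum_coeff_mult_power_complete_sym:
  fixes z :: "'n::finite \<Rightarrow> complex" and e :: "'n \<Rightarrow> nat"
  assumes e: "bij_betw e UNIV {..<CARD('n)}"
  shows "z l ^ n = (\<Sum>j\<in>UNIV. complete_sym_shift z n (e j) * fps_nth (\<Prod>l'\<in>UNIV - {l}. 1 - fps_const (z l') * fps_X) (e j))"
proof -
  define D where "D = (\<Prod>l'\<in>UNIV - {l}. [:1, - z l':])"
  have D: "(\<Prod>l'\<in>UNIV - {l}. 1 - fps_const (z l') * fps_X) = fps_of_poly D"
    by (simp add: D_def fps_of_poly_prod fps_of_poly_pCons fps_const_neg[symmetric] del: fps_const_neg)
  have "degree D \<le> (\<Sum>l'\<in>UNIV - {l}. degree [:1, - z l':])"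
    unfolding D_def using degree_prod_sum_le[of "UNIV - {l}" "\<lambda>l'. [:1, - z l':]"] by simp
  also have "\<dots> \<le> (\<Sum>l'\<in>UNIV - {l}. 1)" by (intro sum_mono) auto
  also have "\<dots> < CARD('n)" by (simp add: card_Diff_singleton)
  finally have deg: "degree D < CARD('n)" .
  let ?H = "\<Prod>i\<in>UNIV. Abs_fps (\<lambda>n. z i ^ n)"
  have "Abs_fps (\<lambda>n. z l ^ n) = ?H * fps_of_poly D"
  proof -
    have "?H = Abs_fps (\<lambda>n. z l ^ n) * (\<Prod>i\<in>UNIV - {l}. Abs_fps (\<lambda>n. z i ^ n))"
      by (rule prod.remove) auto
    moreover have "(\<Prod>i\<in>UNIV - {l}. Abs_fps (\<lambda>n. z i ^ n)) * fps_of_poly D = 1"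
      unfolding D[symmetric] prod.distrib[symmetric] geometric_fps by simp
    ultimately show ?thesis by (simp add: mult.assoc)
  qed
  then have "z l ^ n = fps_nth (?H * fps_of_poly D) n" by (metis fps_nth_Abs_fps)
  also have "\<dots> = fps_nth (fps_of_poly D * ?H) n" by (simp add: mult.commute)
  also have "\<dots> = (\<Sum>a=0..n. coeff D a * complete_sym z (n - a))"
    by (simp add: fps_mult_nth complete_sym_def)
  also have "\<dots> = (\<Sum>a\<in>{0..n} \<union> {..<CARD('n)}. coeff D a * complete_sym_shift z n a)"
    by (intro sum.mono_neutral_cong_left) (auto simp: complete_sym_shift_def)
  also have "\<dots> = (\<Sum>a<CARD('n). coeff D a * complete_sym_shift z n a)"
    using deg by (intro sum.mono_neutral_right) (auto simp: coeff_eq_0)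
  also have "\<dots> = (\<Sum>j\<in>UNIV. coeff D (e j) * complete_sym_shift z n (e j))"
    using sum.reindex_bij_betw[OF e, of "\<lambda>a. coeff D a * complete_sym_shift z n a"] by simp
  finally show ?thesis unfolding D by (simp add: mult.commute)
qed

lemma poly_eq_sum_atMost:
  fixes p :: "'a::comm_ring_1 poly"
  assumes "degree p \<le> L" shows "poly p x = (\<Sum>n\<le>L. coeff p n * x ^ n)"
  unfolding poly_altdef using assms by (intro sum.mono_neutral_left) (auto simp: coeff_eq_0)

text \<open>Dividing the alternant \<open>det (q\<^sub>i(z\<^sub>l) G(z\<^sub>l))\<close> by the Vandermonde determinant of \<open>z\<close>.\<close>

lemma det_complete_sym_distinct:
  fixes z :: "'n::finite \<Rightarrow> complex" and e :: "'n \<Rightarrow> nat"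
  assumes e: "bij_betw e UNIV {..<CARD('n)}" and q: "\<And>i. degree (q i) < CARD('n)"
    and L: "\<And>i. degree (q i * G) \<le> L" and z: "inj z"
  shows "det (\<chi> i j. \<Sum>n\<le>L. coeff (q i * G) n * complete_sym_shift z n (e j)) =
    det (\<chi> i j. coeff (q i) (e j)) * (\<Prod>l\<in>UNIV. poly G (z l))"
proof -
  \<comment> \<open>Column l lists the coefficients of the product over l' other than l, so
    multiplication by \<open>C\<close> turns shifted complete symmetric functions into powers of
    z_l.\<close>
  define C where "C = (\<chi> j l. fps_nth (\<Prod>l'\<in>UNIV - {l}. 1 - fps_const (z l') * fps_X) (e j))"
  have rows: "(\<chi> i j. \<Sum>n\<le>L. coeff (r i) n * complete_sym_shift z n (e j)) ** C = (\<chi> i l. poly (r i) (z l))"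
    if "\<And>i. degree (r i) \<le> L" for r and L
  proof -
    have "(\<Sum>j\<in>UNIV. (\<Sum>n\<le>L. coeff (r i) n * complete_sym_shift z n (e j)) * C $ j $ l) = poly (r i) (z l)" for i l
    proof -
      have "(\<Sum>j\<in>UNIV. (\<Sum>n\<le>L. coeff (r i) n * complete_sym_shift z n (e j)) * C $ j $ l) =
         (\<Sum>j\<in>UNIV. \<Sum>n\<le>L. coeff (r i) n * (complete_sym_shift z n (e j) * C $ j $ l))"
        by (simp add: sum_distrib_right mult.assoc)
      also have "\<dots> = (\<Sum>n\<le>L. coeff (r i) n * (\<Sum>j\<in>UNIV. complete_sym_shift z n (e j) * C $ j $ l))"
        by (subst sum.swap) (simp add: sum_distrib_left)
      also have "\<dots> = (\<Sum>n\<le>L. coeff (r i) n * z l ^ n)"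
        unfolding C_def vec_lambda_beta sum_coeff_mult_power_complete_sym[OF e, symmetric] ..
      finally show ?thesis by (simp add: poly_eq_sum_atMost[OF that])
    qed
    then show ?thesis by (simp add: vec_eq_iff matrix_matrix_mult_def)
  qed
  have lt: "e j < CARD('n)" for j using bij_betwE[OF e] by auto
  have inj: "inj e" using e by (simp add: bij_betw_def)
  have V: "det (\<chi> i l. poly (r i) (z l)) = det (\<chi> i j. z i ^ e j) * det (\<chi> i j. coeff (r i) (e j))"
    if "\<And>i. degree (r i) < CARD('n)" for r
  proof -
    have "transpose (\<chi> i l. poly (r i) (z l)) = (\<chi> i j. poly (r j) (z i))"
      by (simp add: transpose_def vec_eq_iff)
    then have "det (\<chi> i l. poly (r i) (z l)) = det (\<chi> i j. poly (r j) (z i))"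
      by (metis det_transpose)
    then show ?thesis using det_poly_rows[OF e that] by simp
  qed
  define M where "M = (\<chi> i j. \<Sum>n\<le>L. coeff (q i * G) n * complete_sym_shift z n (e j))"
  have "det M * det C = det (\<chi> i l. poly (q i * G) (z l))"
    unfolding M_def det_mul[symmetric] rows[of "\<lambda>i. q i * G", OF L] ..
  also have "\<dots> = (\<Prod>l\<in>UNIV. poly G (z l)) * det (\<chi> i l. poly (q i) (z l))"
  proof -
    have "det (\<chi> i l. poly (q i * G) (z l)) = det (transpose (\<chi> i l. poly (q i * G) (z l)))"
      by simp
    also have "transpose (\<chi> i l. poly (q i * G) (z l)) = (\<chi> l. poly G (z l) *s (\<chi> i. poly (q i) (z l)))"
      by (simp add: transpose_def vec_eq_iff mult.commute)
    also have "det \<dots> = (\<Prod>l\<in>UNIV. poly G (z l)) * det (\<chi> l. (\<chi> i. poly (q i) (z l)))"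
      by (rule det_rows_mul)
    also have "(\<chi> l. (\<chi> i. poly (q i) (z l))) = transpose (\<chi> i l. poly (q i) (z l))"
      by (simp add: transpose_def vec_eq_iff)
    finally show ?thesis by simp
  qed
  also have "\<dots> = (\<Prod>l\<in>UNIV. poly G (z l)) * det (\<chi> i j. coeff (q i) (e j)) * det (\<chi> i j. z i ^ e j)"
    using V[OF q] by simp
  finally have 1: "det M * det C = (\<Prod>l\<in>UNIV. poly G (z l)) * det (\<chi> i j. coeff (q i) (e j)) * det (\<chi> i j. z i ^ e j)" .
  \<comment> \<open>The same factorisation with monomials for the polynomials and G = 1: the matrix
    of complete symmetric functions is then unitriangular, so \<open>C\<close> has the Vandermonde
    determinant, which can be cancelled.\<close>
  have "det C = det (\<chi> i j. z i ^ e j)"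
  proof -
    let ?m = "\<lambda>i. monom (1::complex) (e i)"
    let ?A = "\<chi> i j. \<Sum>n\<le>CARD('n). coeff (?m i) n * complete_sym_shift z n (e j)"
    have A: "?A $ i $ j = complete_sym_shift z (e i) (e j)" for i j
    proof -
      have "?A $ i $ j = (\<Sum>n\<le>CARD('n). if n = e i then complete_sym_shift z n (e j) else 0)"
        unfolding vec_lambda_beta by (intro sum.cong) auto
      also have "\<dots> = complete_sym_shift z (e i) (e j)" using lt[of i] by simp
      finally show ?thesis .
    qed
    have "det ?A = (\<Prod>i\<in>UNIV. ?A $ i $ i)"
      by (rule det_triangular[OF inj]) (simp only: A, simp add: complete_sym_shift_def)
    also have "\<dots> = 1" by (simp only: A) (simp add: complete_sym_shift_def)
    finally have "det ?A = 1" .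
    moreover have "det ?A * det C = det (\<chi> i l. poly (?m i) (z l))"
      unfolding det_mul[symmetric] using rows[of ?m "CARD('n)"] lt
      by (simp add: degree_monom_eq less_imp_le)
    moreover have "(\<chi> i l. poly (?m i) (z l)) = transpose (\<chi> i j. z i ^ e j)"
      by (simp add: transpose_def vec_eq_iff poly_monom)
    ultimately show ?thesis by simp
  qed
  with 1 det_vandermonde_nonzero[OF e z] show ?thesis unfolding M_def by (simp add: mult.commute)
qed

lemma continuous_on_fps_nth_prod:
  assumes "\<And>i n. continuous_on A (\<lambda>x. fps_nth (f i x) n :: complex)"
  shows "continuous_on A (\<lambda>x. fps_nth (\<Prod>i\<in>S. f i x) n)"
proof (induction S arbitrary: n rule: infinite_finite_induct)
  case (insert i S)
  then show ?case by (simp add: fps_mult_nth continuous_intros assms)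
qed auto

text \<open>Both sides are continuous in the nodes. The shifted nodes z_l + epsilon e(l) collide for
  finitely many epsilon only, so the case of distinct nodes extends to the limit epsilon ->
  0.\<close>

lemma det_complete_sym:
  fixes z :: "'n::finite \<Rightarrow> complex" and e :: "'n \<Rightarrow> nat"
  assumes e: "bij_betw e UNIV {..<CARD('n)}" and q: "\<And>i. degree (q i) < CARD('n)"
    and L: "\<And>i. degree (q i * G) \<le> L"
  shows "det (\<chi> i j. \<Sum>n\<le>L. coeff (q i * G) n * complete_sym_shift z n (e j)) =
    det (\<chi> i j. coeff (q i) (e j)) * (\<Prod>l\<in>UNIV. poly G (z l))"
proof -
  define w where "w \<epsilon> l = z l + \<epsilon> * of_nat (e l)" for \<epsilon> l
  define f where "f \<epsilon> = det (\<chi> i j. \<Sum>n\<le>L. coeff (q i * G) n * complete_sym_shift (w \<epsilon>) n (e j))" for \<epsilon>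
  define g where "g \<epsilon> = det (\<chi> i j. coeff (q i) (e j)) * (\<Prod>l\<in>UNIV. poly G (w \<epsilon> l))" for \<epsilon>
  have inj: "inj e" using e by (simp add: bij_betw_def)
  have ev: "eventually (\<lambda>\<epsilon>. f \<epsilon> = g \<epsilon>) (at 0)"
  proof -
    define B where "B = (\<lambda>(l, l'). (z l - z l') / (of_nat (e l') - of_nat (e l))) ` (UNIV :: ('n \<times> 'n) set)"
    have "finite B" by (simp add: B_def)
    then have "open (- (B - {0}))" by (intro open_Compl finite_imp_closed) auto
    then have "eventually (\<lambda>x. x \<in> - (B - {0})) (at 0)"
      by (intro eventually_at_in_open') auto
    then have "eventually (\<lambda>x. x \<notin> B) (at 0)"
      using eventually_neq_at_within[of 0 0 UNIV] by eventually_elim auto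
    then show ?thesis
    proof eventually_elim
      case (elim \<epsilon>)
      have "inj (w \<epsilon>)"
      proof (rule injI, rule ccontr)
        fix l l' assume "w \<epsilon> l = w \<epsilon> l'" and ne: "l \<noteq> l'"
        then have "z l - z l' = \<epsilon> * (of_nat (e l') - of_nat (e l))" by (simp add: w_def algebra_simps)
        moreover have "(of_nat (e l') - of_nat (e l) :: complex) \<noteq> 0" using ne inj by (auto simp: inj_def)
        ultimately have "\<epsilon> = (z l - z l') / (of_nat (e l') - of_nat (e l))" by simp
        then have "\<epsilon> \<in> B" by (force simp: B_def)
        with elim show False by simp
      qed
      then show ?case unfolding f_def g_def by (intro det_complete_sym_distinct e q L)
    qed
  qed
  have cw: "continuous_on UNIV (\<lambda>\<epsilon>. complete_sym (w \<epsilon>) n)" for n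
    unfolding complete_sym_def w_def by (rule continuous_on_fps_nth_prod) (simp add: continuous_intros)
  have cs: "continuous_on UNIV (\<lambda>\<epsilon>. complete_sym_shift (w \<epsilon>) n a)" for n a
    unfolding complete_sym_shift_def by (cases "a \<le> n") (simp_all add: cw)
  have "continuous_on UNIV f"
    unfolding f_def det_def by (simp add: continuous_intros cs)
  then have f0: "(f \<longlongrightarrow> f 0) (at 0)" by (simp add: continuous_on_def)
  have "continuous_on UNIV g"
    unfolding g_def w_def by (intro continuous_intros)
  then have "(g \<longlongrightarrow> g 0) (at 0)" by (simp add: continuous_on_def)
  then have "(f \<longlongrightarrow> g 0) (at 0)" using tendsto_cong[OF ev] by blast
  with f0 have "f 0 = g 0" by (rule tendsto_unique[rotated]) simp
  moreover have "w 0 = z" by (simp add: w_def fun_eq_iff)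
  ultimately show ?thesis by (simp add: f_def g_def)
qed

context haar begin

text \<open>Expanding the determinant of complete symmetric functions gives one integral for each
  permutation \<open>p\<close> and each choice \<open>f\<close> of degrees. Orthogonality leaves f i
  = k + e (p i), all survivors have the same integral, and their coefficients reassemble into a
  determinant.\<close>

lemma integral_class_polynomial:
  fixes z :: "complex ^ 'n ^ 'n \<Rightarrow> 'n \<Rightarrow> complex" and e :: "'n \<Rightarrow> nat"
  assumes z: "\<And>U. char_polynomial U = (\<Prod>i\<in>UNIV. [:- z U i, 1:])"
    and e: "bij_betw e UNIV {..<CARD('n)}" and q: "\<And>i. degree (q i) < CARD('n)"
  shows "det (\<chi> i j. coeff (q i) (e j)) * (\<integral>U. (\<Prod>l\<in>UNIV. poly G (z U l)) * cnj (det U) ^ k \<partial>\<mu>) =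
     (\<integral>U. (\<Prod>l\<in>(UNIV::'n set). complete_sym (z U) k) * cnj (det U) ^ k \<partial>\<mu>) * det (\<chi> i j. coeff (q i * G) (k + e j))"
proof -
  define c where "c = (\<integral>U. (\<Prod>l\<in>(UNIV::'n set). complete_sym (z U) k) * cnj (det U) ^ k \<partial>\<mu>)"
  \<comment> \<open>Also at least k + N, so that the surviving degrees k + e (p i) lie in the
    summation range.\<close>
  define L where "L = Max (range (\<lambda>i. degree (q i * G))) + k + CARD('n)"
  have L: "degree (q i * G) \<le> L" for i
    unfolding L_def by (meson Max_ge UNIV_I finite finite_imageI image_eqI le_add1 order_trans)
  have lt: "e j < CARD('n)" for j using bij_betwE[OF e] by auto
  have Lk: "k + e j \<le> L" for j using lt[of j] by (simp add: L_def)
  define a where "a i n = coeff (q i * G) n" for i n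
  define h where "h U n j = complete_sym_shift (z U) n (e j)" for U n j
  define F where "F p f U = (\<Prod>i\<in>UNIV. h U (f i) (p i)) * cnj (det U) ^ k" for p :: "'n \<Rightarrow> 'n" and f :: "'n \<Rightarrow> nat" and U
  have hm: "(\<lambda>U. h U n j) \<in> borel_measurable \<mu>" for n j
    unfolding h_def complete_sym_shift_def by (cases "e j \<le> n") (simp_all add: measurable_complete_sym[OF z])
  have hb: "\<exists>B. \<forall>U\<in>unitary_group. norm (h U n j) \<le> B" for n j
    unfolding h_def complete_sym_shift_def using complete_sym_bounded[OF z] by (cases "e j \<le> n") auto
  obtain H where H: "\<And>n j U. U \<in> unitary_group \<Longrightarrow> norm (h U n j) \<le> H n j" using hb by metis
  have dm: "(\<lambda>U. cnj (det U) ^ k) \<in> borel_measurable \<mu>"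
    using measurable_matpoly[OF matpoly_power[OF matpoly_det_snd]] unfolding cnj_det .
  obtain D where D: "\<And>U :: complex ^ 'n ^ 'n. U \<in> unitary_group \<Longrightarrow> norm (cnj (det U) ^ k) \<le> D"
    using matpoly_bounded[OF matpoly_power[OF matpoly_det_snd]] unfolding cnj_det by blast
  have Fi: "integrable \<mu> (F p f)" for p f
  proof (rule integrable_const_bound)
    show "F p f \<in> borel_measurable \<mu>" unfolding F_def
      by (intro borel_measurable_times borel_measurable_prod hm dm)
    show "AE U in \<mu>. norm (F p f U) \<le> (\<Prod>i\<in>UNIV. H (f i) (p i)) * D"
    proof (rule AE_I2)
      fix U assume "U \<in> space \<mu>"
      then have U: "U \<in> unitary_group" by (simp add: space_haar)
      have "norm (\<Prod>i\<in>UNIV. h U (f i) (p i)) \<le> (\<Prod>i\<in>UNIV. H (f i) (p i))"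
        unfolding prod_norm[symmetric] by (intro prod_mono conjI norm_ge_zero H U)
      then show "norm (F p f U) \<le> (\<Prod>i\<in>UNIV. H (f i) (p i)) * D"
        unfolding F_def norm_mult[of "prod _ _"]
        by (rule mult_mono[OF _ D[OF U]]) (auto intro!: prod_nonneg order_trans[OF norm_ge_zero H[OF U]])
    qed
  qed
  \<comment> \<open>The index at i is f i - e (p i), and orthogonality forces every index to be k.
    If some f i is below e (p i), a factor of negative index makes the product 0.\<close>
  have Fint: "(\<integral>U. F p f U \<partial>\<mu>) = (if \<forall>i. f i = k + e (p i) then c else 0)" for p f
  proof (cases "\<forall>i. e (p i) \<le> f i")
    case True
    then have F: "F p f = (\<lambda>U. (\<Prod>i\<in>UNIV. complete_sym (z U) (f i - e (p i))) * cnj (det U) ^ k)"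
      by (simp add: F_def h_def complete_sym_shift_def fun_eq_iff)
    show ?thesis
    proof (cases "\<forall>i. f i = k + e (p i)")
      case True
      then show ?thesis by (simp add: F c_def)
    next
      case False
      then obtain i where "f i - e (p i) \<noteq> k" using \<open>\<forall>i. e (p i) \<le> f i\<close>
        by (metis le_add_diff_inverse2)
      then have "(\<integral>U. F p f U \<partial>\<mu>) = 0"
        unfolding F by (intro complete_sym_det_orthogonal[OF z, where m = "\<lambda>i. f i - e (p i)"])
      then show ?thesis by (simp only: False if_False)
    qed
  next
    case False
    then obtain i where i: "f i < e (p i)" by (meson leI)
    then have "(\<Prod>i\<in>UNIV. h U (f i) (p i)) = 0" for U
      by (intro prod_zero bexI[of _ i]) (auto simp: h_def complete_sym_shift_def)
    then have "(\<integral>U. F p f U \<partial>\<mu>) = 0" unfolding F_def by (simp only: mult_zero_left integral_zero)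
    moreover have "\<not> (\<forall>i. f i = k + e (p i))" using i by (metis add.commute le_add1 linorder_not_less)
    ultimately show ?thesis by (simp only: if_False)
  qed
  have expand: "det (\<chi> i j. coeff (q i) (e j)) * ((\<Prod>l\<in>UNIV. poly G (z U l)) * cnj (det U) ^ k) =
     (\<Sum>p | p permutes (UNIV :: 'n set). \<Sum>f\<in>PiE UNIV (\<lambda>_. {..L}). of_int (sign p) * (\<Prod>i\<in>UNIV. a i (f i)) * F p f U)" for U
  proof -
    have "det (\<chi> i j. coeff (q i) (e j)) * (\<Prod>l\<in>UNIV. poly G (z U l)) = det (\<chi> i j. \<Sum>n\<le>L. a i n * h U n j)"
      unfolding a_def h_def by (rule det_complete_sym[OF e q L, symmetric])
    also have "\<dots> = (\<Sum>p | p permutes (UNIV :: 'n set). of_int (sign p) * (\<Prod>i\<in>UNIV. \<Sum>n\<le>L. a i n * h U n (p i)))"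
      by (simp add: det_def)
    also have "\<dots> = (\<Sum>p | p permutes (UNIV :: 'n set). of_int (sign p) * (\<Sum>f\<in>PiE UNIV (\<lambda>_. {..L}). \<Prod>i\<in>UNIV. a i (f i) * h U (f i) (p i)))"
      by (subst prod_sum_PiE) auto
    finally show ?thesis
      by (simp add: F_def prod.distrib sum_distrib_left sum_distrib_right mult_ac)
  qed
  have "det (\<chi> i j. coeff (q i) (e j)) * (\<integral>U. (\<Prod>l\<in>UNIV. poly G (z U l)) * cnj (det U) ^ k \<partial>\<mu>) =
     (\<integral>U. det (\<chi> i j. coeff (q i) (e j)) * ((\<Prod>l\<in>UNIV. poly G (z U l)) * cnj (det U) ^ k) \<partial>\<mu>)"
    by simp
  also have "\<dots> = (\<Sum>p | p permutes (UNIV :: 'n set). \<Sum>f\<in>PiE UNIV (\<lambda>_. {..L}). of_int (sign p) * (\<Prod>i\<in>UNIV. a i (f i)) * (\<integral>U. F p f U \<partial>\<mu>))"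
    unfolding expand by (simp add: Bochner_Integration.integral_sum Fi)
  also have "\<dots> = (\<Sum>p | p permutes (UNIV :: 'n set). of_int (sign p) * (\<Prod>i\<in>UNIV. a i (k + e (p i))) * c)"
  proof (rule sum.cong[OF refl])
    fix p :: "'n \<Rightarrow> 'n"
    have "(\<Sum>f\<in>PiE UNIV (\<lambda>_. {..L}). of_int (sign p) * (\<Prod>i\<in>UNIV. a i (f i)) * (\<integral>U. F p f U \<partial>\<mu>)) =
      (\<Sum>f\<in>PiE UNIV (\<lambda>_. {..L}). if f = (\<lambda>i. k + e (p i)) then of_int (sign p) * (\<Prod>i\<in>UNIV. a i (f i)) * c else 0)"
      unfolding Fint by (intro sum.cong) (auto simp: fun_eq_iff)
    also have "\<dots> = of_int (sign p) * (\<Prod>i\<in>UNIV. a i (k + e (p i))) * c"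
      using Lk by (subst sum.delta) (auto simp: finite_PiE)
    finally show "(\<Sum>f\<in>PiE UNIV (\<lambda>_. {..L}). of_int (sign p) * (\<Prod>i\<in>UNIV. a i (f i)) * (\<integral>U. F p f U \<partial>\<mu>)) =
      of_int (sign p) * (\<Prod>i\<in>UNIV. a i (k + e (p i))) * c" .
  qed
  also have "\<dots> = c * det (\<chi> i j. coeff (q i * G) (k + e j))"
    by (simp add: det_def a_def sum_distrib_left mult_ac)
  finally show ?thesis unfolding c_def .
qed

end

section \<open>The Laguerre generating function\<close>

lemma det_scale_columns:
  fixes a :: "'n::finite \<Rightarrow> 'n \<Rightarrow> 'a::comm_ring_1"
  shows "det (\<chi> i j. c j * a i j) = (\<Prod>j\<in>UNIV. c j) * det (\<chi> i j. a i j)"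
proof -
  have "det (\<chi> i j. c j * a i j) = det (transpose (\<chi> i j. c j * a i j))" by simp
  also have "transpose (\<chi> i j. c j * a i j) = (\<chi> j. c j *s (\<chi> i. a i j))"
    by (simp add: transpose_def vec_eq_iff)
  also have "det \<dots> = (\<Prod>j\<in>UNIV. c j) * det (\<chi> j. (\<chi> i. a i j))" by (rule det_rows_mul)
  also have "(\<chi> j. (\<chi> i. a i j)) = transpose (\<chi> i j. a i j)" by (simp add: transpose_def)
  finally show ?thesis by simp
qed

definition fps_truncate :: "complex fps \<Rightarrow> nat \<Rightarrow> complex poly" where
  "fps_truncate F L = (\<Sum>n\<le>L. monom (fps_nth F n) n)"

lemma coeff_fps_truncate: "coeff (fps_truncate F L) n = (if n \<le> L then fps_nth F n else 0)"
  by (simp add: fps_truncate_def coeff_sum)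

lemma poly_fps_truncate: "poly (fps_truncate F L) x = (\<Sum>n\<le>L. fps_nth F n * x ^ n)"
  by (simp add: fps_truncate_def poly_sum poly_monom)

lemma coeff_mult_fps_truncate:
  assumes "n \<le> L" shows "coeff (q * fps_truncate F L) n = fps_nth (fps_of_poly q * F) n"
  using assms by (auto simp: coeff_mult fps_mult_nth coeff_fps_truncate atLeast0AtMost intro!: sum.cong)

text \<open>The expansion of (1-x)^(2k) exp(sx/(1-x)), the generating function of the Laguerre
  polynomials with parameter -2k-1 at -s.\<close>

definition laguerre_fps :: "nat \<Rightarrow> complex \<Rightarrow> complex fps" where
  "laguerre_fps k s = (1 - fps_X) ^ (2 * k) * (fps_exp s oo (fps_X * inverse (1 - fps_X)))"

text \<open>x/(1-x) is half the Cayley transform (1+x)/(1-x) minus 1/2, and the Cayley transform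
  maps the disc to the right half-plane. This bounds the exponential in the Laguerre function on the
  disc.\<close>

lemma Re_cayley_ge:
  fixes x :: complex assumes "norm x \<le> 1" shows "Re (x / (1 - x)) \<ge> - 1 / 2 \<or> x = 1"
proof (cases "x = 1")
  case False
  define C where "C = (1 + x) / (1 - x)"
  have "x / (1 - x) = C / 2 - 1 / 2" using False by (simp add: field_simps C_def)
  moreover have "Re C \<ge> 0"
  proof -
    have "(Re x)\<^sup>2 + (Im x)\<^sup>2 \<le> 1" using assms by (simp add: cmod_def)
    then have "0 \<le> Re (1 + x) * Re (1 - x) + Im (1 + x) * Im (1 - x)"
      by (simp add: algebra_simps power2_eq_square)
    then show ?thesis by (simp add: C_def Re_divide)
  qed
  ultimately have "Re (x / (1 - x)) \<ge> - 1 / 2" by simp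
  then show ?thesis by simp
qed simp

text \<open>\<open>z\<close> labels the eigenvalues of each matrix independently, with no regularity
  in the matrix; \<open>e\<close> numbers the index type, which has no order of its own.\<close>

locale haar_eigenvalues = haar \<mu> for \<mu> :: "(complex ^ 'n ^ 'n) measure" +
  fixes z :: "complex ^ 'n ^ 'n \<Rightarrow> 'n \<Rightarrow> complex" and e :: "'n \<Rightarrow> nat"
  assumes z: "\<And>U. char_polynomial U = (\<Prod>i\<in>UNIV. [:- z U i, 1:])"
    and e: "bij_betw e UNIV {..<CARD('n)}"
begin

lemma norm_z: "U \<in> unitary_group \<Longrightarrow> norm (z U l) = 1"
proof (rule unitary_char_polynomial_root)
  show "poly (char_polynomial U) (z U l) = 0"
    unfolding z poly_prod by (rule prod_zero) auto
qed

lemma det_eq_prod_z: "det U = (\<Prod>l\<in>UNIV. z U l)"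
proof -
  have "det (\<chi> i. (-1) *s (U $ i)) = (\<Prod>i\<in>(UNIV::'n set). -1) * det (\<chi> i. U $ i)" by (rule det_rows_mul)
  moreover have "det (\<chi> i. (-1) *s (U $ i)) = poly (char_polynomial U) 0"
    unfolding poly_char_polynomial by (rule arg_cong[where f = det]) (simp add: vec_eq_iff)
  moreover have "poly (char_polynomial U) 0 = (\<Prod>i\<in>(UNIV::'n set). -1) * (\<Prod>l\<in>UNIV. z U l)"
    unfolding z poly_prod prod.distrib[symmetric] by (rule prod.cong) simp_all
  moreover have "(\<Prod>i\<in>(UNIV::'n set). -1 :: complex) \<noteq> 0" by simp
  ultimately show ?thesis by simp
qed

text \<open>With monomials as the auxiliary polynomials, \<open>det_complete_sym\<close> writes the
  product as a determinant in complete symmetric functions, which are measurable.\<close>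

lemma measurable_class_polynomial: "(\<lambda>U. \<Prod>l\<in>UNIV. poly G (z U l)) \<in> borel_measurable \<mu>"
proof -
  have lt: "e j < CARD('n)" for j using bij_betwE[OF e] by auto
  have inj: "inj e" using e by (simp add: bij_betw_def)
  define q where "q i = monom (1::complex) (e i)" for i
  define L where "L = CARD('n) + degree G"
  have q: "degree (q i) < CARD('n)" for i using lt by (simp add: q_def degree_monom_eq)
  have "degree (q i * G) \<le> L" for i
    using degree_mult_le[of "q i" G] q[of i] by (simp add: L_def)
  from det_complete_sym[OF e q this] have "(\<Prod>l\<in>UNIV. poly G (z U l)) =
      det (\<chi> i j. \<Sum>n\<le>L. coeff (q i * G) n * complete_sym_shift (z U) n (e j))" for U
    using det_monic_coefficients[OF inj, of q] by (simp add: q_def degree_monom_eq)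
  moreover have "(\<lambda>U. complete_sym_shift (z U) n a) \<in> borel_measurable \<mu>" for n a
    unfolding complete_sym_shift_def by (cases "a \<le> n") (simp_all add: measurable_complete_sym[OF z])
  ultimately show ?thesis by (simp add: det_def)
qed

lemma measurable_cnj_det_power: "(\<lambda>U. cnj (det U) ^ k) \<in> borel_measurable \<mu>"
  using measurable_matpoly[OF matpoly_power[OF matpoly_det_snd]] unfolding cnj_det .

lemma norm_det: "(U :: complex ^ 'n ^ 'n) \<in> unitary_group \<Longrightarrow> norm (det U) = 1"
  unfolding det_eq_prod_z prod_norm[symmetric] by (rule prod.neutral) (simp add: norm_z)

text \<open>Independent of the class function that is integrated;
  \<open>characteristic_function\<close> eliminates it by a comparison at t = 0.\<close>

definition det_constant :: "nat \<Rightarrow> complex" where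
  "det_constant k = (\<integral>U. (\<Prod>l\<in>(UNIV::'n set). complete_sym (z U) k) * cnj (det U) ^ k \<partial>\<mu>)"

text \<open>At radius r < 1 the Taylor polynomials of \<open>g\<close> converge and are bounded by
  the absolutely convergent sum \<open>S\<close>, so the polynomial case passes to the limit.
  Scaling the variable by r contributes r^(kN).\<close>

lemma integral_class_function_disc:
  assumes g: "g has_fps_expansion F" "g holomorphic_on ball 0 1" and r: "0 < r" "r < 1"
    and q: "\<And>i. degree (q i) < CARD('n)" "det (\<chi> i j. coeff (q i) (e j)) = 1"
  shows "(\<integral>U. (\<Prod>l\<in>UNIV. g (of_real r * z U l)) * cnj (det U) ^ k \<partial>\<mu>) =
    det_constant k * of_real r ^ (k * CARD('n)) * det (\<chi> i j. fps_nth (fps_of_poly (q i) * F) (k + e j))" (is "?I = ?R")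
    and "(\<lambda>U. \<Prod>l\<in>UNIV. g (of_real r * z U l)) \<in> borel_measurable \<mu>"
proof -
  let ?r = "complex_of_real r"
  have lt: "e j < CARD('n)" for j using bij_betwE[OF e] by auto
  have sums: "(\<lambda>n. fps_nth F n * x ^ n) sums g x" if "norm x < 1" for x
    by (rule has_fps_expansion_imp_sums_complex[OF g(1), where r = 1])
       (use g(2) that in \<open>auto simp: one_ereal_def\<close>)
  have rad: "fps_conv_radius F \<ge> 1"
    by (rule holomorphic_on_imp_fps_conv_radius_ge[OF g(1)]) (use g(2) in \<open>simp add: one_ereal_def\<close>)
  have abs_sum: "summable (\<lambda>n. norm (fps_nth F n * ?r ^ n))"
  proof -
    have "ereal (norm ?r) < conv_radius (fps_nth F)"
      using r rad unfolding fps_conv_radius_def by (metis abs_of_pos ereal_less(3) less_le_trans norm_of_real one_ereal_def)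
    from abs_summable_in_conv_radius[OF this] show ?thesis .
  qed
  define S where "S = (\<Sum>n. norm (fps_nth F n * ?r ^ n))"
  define G where "G L = pcompose (fps_truncate F L) [:0, ?r:]" for L
  have G: "poly (G L) x = (\<Sum>n\<le>L. fps_nth F n * (?r * x) ^ n)" for L x
    by (simp add: G_def poly_pcompose poly_fps_truncate mult.commute)
  have Gb: "norm (poly (G L) x) \<le> S" if "norm x = 1" for L x
  proof -
    have "norm (poly (G L) x) \<le> (\<Sum>n\<le>L. norm (fps_nth F n * ?r ^ n))"
      unfolding G using that by (intro sum_norm_le) (simp add: norm_mult norm_power)
    also have "\<dots> \<le> S" unfolding S_def by (rule sum_le_suminf[OF abs_sum]) auto
    finally show ?thesis .
  qed
  have Glim: "(\<lambda>L. poly (G L) x) \<longlonglongrightarrow> g (?r * x)" if "norm x = 1" for x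
    unfolding G using sums[of "?r * x"] that r
    by (simp add: sums_def_le norm_mult)
  have lim: "(\<lambda>L. \<Prod>l\<in>UNIV. poly (G L) (z U l)) \<longlonglongrightarrow> (\<Prod>l\<in>UNIV. g (?r * z U l))" if "U \<in> space \<mu>" for U
    using that by (intro tendsto_prod Glim norm_z) (simp add: space_haar)
  show meas: "(\<lambda>U. \<Prod>l\<in>UNIV. g (?r * z U l)) \<in> borel_measurable \<mu>"
    by (rule borel_measurable_LIMSEQ_metric[OF measurable_class_polynomial lim])
  have "(\<lambda>L. \<integral>U. (\<Prod>l\<in>UNIV. poly (G L) (z U l)) * cnj (det U) ^ k \<partial>\<mu>) \<longlonglongrightarrow> ?I"
  proof (rule integral_dominated_convergence[where w = "\<lambda>_. S ^ CARD('n)"])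
    show "AE U in \<mu>. (\<lambda>L. (\<Prod>l\<in>UNIV. poly (G L) (z U l)) * cnj (det U) ^ k) \<longlonglongrightarrow> (\<Prod>l\<in>UNIV. g (?r * z U l)) * cnj (det U) ^ k"
      by (intro AE_I2 tendsto_mult lim tendsto_const)
    show "AE U in \<mu>. norm ((\<Prod>l\<in>UNIV. poly (G L) (z U l)) * cnj (det U) ^ k) \<le> S ^ CARD('n)" for L
    proof (rule AE_I2)
      fix U assume "U \<in> space \<mu>"
      then have U: "U \<in> unitary_group" by (simp add: space_haar)
      have "(\<Prod>l\<in>(UNIV::'n set). norm (poly (G L) (z U l))) \<le> (\<Prod>l\<in>(UNIV::'n set). S)"
        by (intro prod_mono conjI norm_ge_zero Gb norm_z U)
      then show "norm ((\<Prod>l\<in>UNIV. poly (G L) (z U l)) * cnj (det U) ^ k) \<le> S ^ CARD('n)"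
        by (simp add: norm_mult norm_power norm_det[OF U] prod_norm)
    qed
  qed (intro borel_measurable_times meas measurable_class_polynomial measurable_cnj_det_power | simp)+
  moreover have "eventually (\<lambda>L. (\<integral>U. (\<Prod>l\<in>UNIV. poly (G L) (z U l)) * cnj (det U) ^ k \<partial>\<mu>) = ?R) sequentially"
    using eventually_ge_at_top[of "k + CARD('n)"]
  proof eventually_elim
    case (elim L)
    \<comment> \<open>Scaling \<open>q\<close> together with \<open>G\<close> turns the coefficient
      of x^n of the product into r^n times the unscaled one; the common factor r^(sum e)
      cancels.\<close>
    define q' where "q' i = pcompose (q i) [:0, ?r:]" for i
    have q': "degree (q' i) < CARD('n)" for i
      using degree_pcompose_le[of "q i" "[:0, ?r:]"] q(1)[of i] by (simp add: q'_def split: if_splits)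
    have P0: "(\<Prod>j\<in>UNIV. ?r ^ e j) \<noteq> 0" using r by simp
    have "det (\<chi> i j. coeff (q' i) (e j)) = (\<Prod>j\<in>UNIV. ?r ^ e j) * det (\<chi> i j. coeff (q i) (e j))"
      unfolding q'_def coeff_pcompose_linear by (rule det_scale_columns)
    moreover have "det (\<chi> i j. coeff (q' i * G L) (k + e j)) =
       (\<Prod>j\<in>UNIV. ?r ^ (k + e j)) * det (\<chi> i j. fps_nth (fps_of_poly (q i) * F) (k + e j))"
    proof -
      have "coeff (q' i * G L) (k + e j) = ?r ^ (k + e j) * fps_nth (fps_of_poly (q i) * F) (k + e j)" for i j
      proof -
        \<comment> \<open>Truncation at \<open>L\<close> does not affect the coefficients that
          occur.\<close>
        have "k + e j \<le> L" using elim lt[of j] by simp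
        then show ?thesis
          unfolding q'_def G_def pcompose_mult[symmetric] coeff_pcompose_linear
          by (simp add: coeff_mult_fps_truncate)
      qed
      then show ?thesis by (simp add: det_scale_columns)
    qed
    moreover have "(\<Prod>j\<in>UNIV. ?r ^ (k + e j)) = ?r ^ (k * CARD('n)) * (\<Prod>j\<in>UNIV. ?r ^ e j)"
      by (simp add: power_add prod.distrib power_mult)
    moreover have "det (\<chi> i j. coeff (q' i) (e j)) * (\<integral>U. (\<Prod>l\<in>UNIV. poly (G L) (z U l)) * cnj (det U) ^ k \<partial>\<mu>) =
        det_constant k * det (\<chi> i j. coeff (q' i * G L) (k + e j))"
      unfolding det_constant_def by (rule integral_class_polynomial[OF z e q'])
    ultimately have "(\<Prod>j\<in>UNIV. ?r ^ e j) * (\<integral>U. (\<Prod>l\<in>UNIV. poly (G L) (z U l)) * cnj (det U) ^ k \<partial>\<mu>) =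
        det_constant k * (?r ^ (k * CARD('n)) * (\<Prod>j\<in>UNIV. ?r ^ e j) * det (\<chi> i j. fps_nth (fps_of_poly (q i) * F) (k + e j)))"
      using q(2) by (simp only: mult_1_right)
    then have "(\<Prod>j\<in>UNIV. ?r ^ e j) * (\<integral>U. (\<Prod>l\<in>UNIV. poly (G L) (z U l)) * cnj (det U) ^ k \<partial>\<mu>) = (\<Prod>j\<in>UNIV. ?r ^ e j) * ?R"
      by (simp only: mult_ac)
    then show ?case by (rule mult_left_cancel[OF P0, THEN iffD1])
  qed
  then have "(\<lambda>L. \<integral>U. (\<Prod>l\<in>UNIV. poly (G L) (z U l)) * cnj (det U) ^ k \<partial>\<mu>) \<longlonglongrightarrow> ?R"
    by (rule tendsto_eventually)
  ultimately show "?I = ?R" by (rule LIMSEQ_unique)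
qed

text \<open>\<open>f\<close> is the radial limit of \<open>g\<close>, which need not extend
  continuously to the circle; the uniform bound \<open>B\<close> on the disc dominates the
  integrands as r -> 1.\<close>

lemma integral_class_function_boundary:
  assumes g: "g has_fps_expansion F" "g holomorphic_on ball 0 1"
    and B: "\<And>x. norm x < 1 \<Longrightarrow> norm (g x) \<le> B"
    and f: "\<And>x. norm x = 1 \<Longrightarrow> (\<lambda>n. g (of_real (1 - inverse (real (Suc (Suc n)))) * x)) \<longlonglongrightarrow> f x"
    and q: "\<And>i. degree (q i) < CARD('n)" "det (\<chi> i j. coeff (q i) (e j)) = 1"
  shows "(\<integral>U. (\<Prod>l\<in>UNIV. f (z U l)) * cnj (det U) ^ k \<partial>\<mu>) =
    det_constant k * det (\<chi> i j. fps_nth (fps_of_poly (q i) * F) (k + e j))" (is "?I = ?R")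
proof -
  \<comment> \<open>Starting at 1/2 keeps every radius strictly between 0 and 1.\<close>
  define r where "r n = 1 - inverse (real (Suc (Suc n)))" for n
  have r: "0 < r n" "r n < 1" for n by (simp_all add: r_def field_simps)
  have r1: "r \<longlonglongrightarrow> 1"
  proof -
    have "(\<lambda>n. inverse (real (Suc (Suc n)))) \<longlonglongrightarrow> 0"
      using LIMSEQ_Suc[OF LIMSEQ_inverse_real_of_nat] .
    from tendsto_diff[OF tendsto_const[of 1] this] show ?thesis by (simp add: r_def[abs_def])
  qed
  note disc = integral_class_function_disc[OF g r q]
  have lim: "(\<lambda>n. \<Prod>l\<in>UNIV. g (of_real (r n) * z U l)) \<longlonglongrightarrow> (\<Prod>l\<in>UNIV. f (z U l))" if "U \<in> space \<mu>" for U
    unfolding r_def using that by (intro tendsto_prod f norm_z) (simp add: space_haar)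
  have meas: "(\<lambda>U. \<Prod>l\<in>UNIV. f (z U l)) \<in> borel_measurable \<mu>"
    by (rule borel_measurable_LIMSEQ_metric[OF disc(2) lim])
  have "(\<lambda>n. \<integral>U. (\<Prod>l\<in>UNIV. g (of_real (r n) * z U l)) * cnj (det U) ^ k \<partial>\<mu>) \<longlonglongrightarrow> ?I"
  proof (rule integral_dominated_convergence[where w = "\<lambda>_. B ^ CARD('n)"])
    show "AE U in \<mu>. (\<lambda>n. (\<Prod>l\<in>UNIV. g (of_real (r n) * z U l)) * cnj (det U) ^ k) \<longlonglongrightarrow> (\<Prod>l\<in>UNIV. f (z U l)) * cnj (det U) ^ k"
      by (intro AE_I2 tendsto_mult lim tendsto_const)
    show "AE U in \<mu>. norm ((\<Prod>l\<in>UNIV. g (of_real (r n) * z U l)) * cnj (det U) ^ k) \<le> B ^ CARD('n)" for n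
    proof (rule AE_I2)
      fix U assume "U \<in> space \<mu>"
      then have U: "U \<in> unitary_group" by (simp add: space_haar)
      have "(\<Prod>l\<in>(UNIV::'n set). norm (g (of_real (r n) * z U l))) \<le> (\<Prod>l\<in>(UNIV::'n set). B)"
        using r[of n] by (intro prod_mono conjI norm_ge_zero B) (simp add: norm_mult norm_z[OF U])
      then show "norm ((\<Prod>l\<in>UNIV. g (of_real (r n) * z U l)) * cnj (det U) ^ k) \<le> B ^ CARD('n)"
        by (simp add: norm_mult norm_power norm_det[OF U] prod_norm)
    qed
  qed (intro borel_measurable_times meas disc(2) measurable_cnj_det_power | simp)+
  then have "(\<lambda>n. det_constant k * of_real (r n) ^ (k * CARD('n)) * det (\<chi> i j. fps_nth (fps_of_poly (q i) * F) (k + e j))) \<longlonglongrightarrow> ?I"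
    unfolding disc(1) .
  moreover have "(\<lambda>n. det_constant k * of_real (r n) ^ (k * CARD('n)) * det (\<chi> i j. fps_nth (fps_of_poly (q i) * F) (k + e j))) \<longlonglongrightarrow>
      det_constant k * of_real 1 ^ (k * CARD('n)) * det (\<chi> i j. fps_nth (fps_of_poly (q i) * F) (k + e j))"
    by (intro tendsto_mult tendsto_power tendsto_of_real tendsto_const r1)
  then have "(\<lambda>n. det_constant k * of_real (r n) ^ (k * CARD('n)) * det (\<chi> i j. fps_nth (fps_of_poly (q i) * F) (k + e j))) \<longlonglongrightarrow> ?R"
    by simp
  ultimately show "?I = ?R" by (rule LIMSEQ_unique)
qed

lemma integral_laguerre:
  assumes k: "1 \<le> k" and t: "0 \<le> t"
    and q: "\<And>i. degree (q i) < CARD('n)" "det (\<chi> i j. coeff (q i) (e j)) = 1"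
  shows "(\<integral>U. (\<Prod>l\<in>UNIV. (1 - z U l) ^ (2 * k) * exp (- 2 * of_real t * (z U l / (1 - z U l)))) * cnj (det U) ^ k \<partial>\<mu>) =
    det_constant k * det (\<chi> i j. fps_nth (fps_of_poly (q i) * laguerre_fps k (- 2 * of_real t)) (k + e j))"
proof -
  let ?s = "- 2 * complex_of_real t"
  define g where "g x = (1 - x) ^ (2 * k) * exp (?s * (x / (1 - x)))" for x :: complex
  have h1: "g has_fps_expansion laguerre_fps k ?s"
  proof -
    have "((\<lambda>x. exp (?s * x)) \<circ> (\<lambda>x. x * inverse (1 - x))) has_fps_expansion (fps_exp ?s oo (fps_X * inverse (1 - fps_X)))"
      by (intro has_fps_expansion_compose has_fps_expansion_exp has_fps_expansion_mult has_fps_expansion_inverse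
           has_fps_expansion_diff has_fps_expansion_1 has_fps_expansion_fps_X) auto
    then have "(\<lambda>x. (1 - x) ^ (2 * k) * ((\<lambda>x. exp (?s * x)) \<circ> (\<lambda>x. x * inverse (1 - x))) x) has_fps_expansion laguerre_fps k ?s"
      unfolding laguerre_fps_def
      by (intro has_fps_expansion_mult has_fps_expansion_power has_fps_expansion_diff has_fps_expansion_1 has_fps_expansion_fps_X)
    then show ?thesis unfolding g_def[abs_def] comp_def divide_inverse .
  qed
  have h2: "g holomorphic_on ball 0 1"
    unfolding g_def[abs_def] by (intro holomorphic_intros) auto
  have eb: "norm (exp (?s * (x / (1 - x)))) \<le> exp t" if "norm x \<le> 1" for x
  proof (cases "x = 1")
    case False
    then have "Re (x / (1 - x)) \<ge> - 1 / 2" using Re_cayley_ge[OF that] by simp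
    then have "2 * t * Re (x / (1 - x)) \<ge> 2 * t * (- 1 / 2)" using t by (intro mult_left_mono) auto
    moreover have "Re (?s * w) = - (2 * t * Re w)" for w by simp
    from this[of "x / (1 - x)"] calculation have "Re (?s * (x / (1 - x))) \<le> t" by linarith
    then show ?thesis unfolding norm_exp_eq_Re by simp
  qed (use t in simp)
  have B: "norm (g x) \<le> 2 ^ (2 * k) * exp t" if "norm x < 1" for x
  proof -
    have "norm (1 - x) \<le> 2" using that norm_triangle_ineq4[of 1 x] by simp
    then show ?thesis unfolding g_def norm_mult norm_power using that
      by (intro mult_mono power_mono eb) auto
  qed
  \<comment> \<open>At x = 1 the exponential stays bounded by exp t while (1-y)^(2k) tends to 0, as
    k >= 1. The value \<open>g 1\<close> is 0 as well, division by zero turning the exponential into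
    1.\<close>
  have f: "(\<lambda>n. g (of_real (1 - inverse (real (Suc (Suc n)))) * x)) \<longlonglongrightarrow> g x" if x: "norm x = 1" for x
  proof -
    define y where "y n = complex_of_real (1 - inverse (real (Suc (Suc n)))) * x" for n
    have "(\<lambda>n. inverse (real (Suc (Suc n)))) \<longlonglongrightarrow> 0"
      using LIMSEQ_Suc[OF LIMSEQ_inverse_real_of_nat] .
    from this have "y \<longlonglongrightarrow> complex_of_real (1 - 0) * x"
      unfolding y_def by (intro tendsto_mult tendsto_of_real tendsto_diff tendsto_const)
    then have y: "y \<longlonglongrightarrow> x" by simp
    have ny: "norm (y n) \<le> 1" for n
      unfolding y_def norm_mult x norm_of_real by (simp add: field_simps)
    have "(\<lambda>n. g (y n)) \<longlonglongrightarrow> g x"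
    proof (cases "x = 1")
      case False
      then show ?thesis unfolding g_def
        by (intro tendsto_mult tendsto_power tendsto_diff tendsto_const tendsto_exp tendsto_divide y) auto
    next
      case True
      have "(\<lambda>n. (1 - y n) ^ (2 * k)) \<longlonglongrightarrow> (1 - x) ^ (2 * k)" by (intro tendsto_power tendsto_diff tendsto_const y)
      then have "(\<lambda>n. (1 - y n) ^ (2 * k)) \<longlonglongrightarrow> 0" using True k by (simp add: power_0_left)
      then have "(\<lambda>n. norm ((1 - y n) ^ (2 * k)) * exp t) \<longlonglongrightarrow> 0"
        by (rule tendsto_mult_left_zero[OF tendsto_norm_zero])
      moreover have "norm (g (y n)) \<le> norm ((1 - y n) ^ (2 * k)) * exp t" for n
        unfolding g_def norm_mult by (intro mult_left_mono eb ny) auto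
      then have "eventually (\<lambda>n. norm (g (y n)) \<le> norm ((1 - y n) ^ (2 * k)) * exp t) sequentially"
        by (intro always_eventually allI)
      ultimately have "(\<lambda>n. g (y n)) \<longlonglongrightarrow> 0"
        by (rule Lim_null_comparison[rotated])
      then show ?thesis using True k by (simp add: g_def power_0_left)
    qed
    then show ?thesis by (simp add: y_def)
  qed
  show ?thesis
    using integral_class_function_boundary[where f = g, OF h1 h2 B f q] unfolding g_def by blast
qed

end

section \<open>Hook lengths by columns\<close>

text \<open>The parts of the conjugate partition. Columns are numbered through \<open>e\<close>,
  because the index type of the matrices serves as the set of the N columns.\<close>

definition column_length :: "('n \<Rightarrow> nat) \<Rightarrow> nat list \<Rightarrow> 'n \<Rightarrow> nat" where
  "column_length e la c = card {i. i < length la \<and> e c < la ! i}"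

text \<open>Partitions with at most k rows and N columns; wider ones are annihilated by the factor
  [-N]_lambda.\<close>

definition box_partitions :: "nat \<Rightarrow> nat \<Rightarrow> nat list set" where
  "box_partitions k N = {la. sorted_wrt (\<ge>) la \<and> (\<forall>x\<in>set la. 0 < x \<and> x \<le> N) \<and> length la \<le> k}"

lemma box_partitions_nth:
  assumes "la \<in> box_partitions k N" "i < length la"
  shows "0 < la ! i" "la ! i \<le> N"
  using assms by (auto simp: box_partitions_def)

lemma box_partitions_antimono:
  assumes "la \<in> box_partitions k N" "i \<le> i'" "i' < length la"
  shows "la ! i' \<le> la ! i"
  using assms by (cases "i = i'") (auto simp: box_partitions_def sorted_wrt_iff_nth_less)

lemma initial_segment_eq:
  fixes A :: "nat set"
  assumes "finite A" "\<And>i j. j \<in> A \<Longrightarrow> i \<le> j \<Longrightarrow> i \<in> A"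
  shows "A = {..<card A}"
proof -
  have "A \<subseteq> {..<card A}"
  proof
    fix j assume j: "j \<in> A"
    then have "{..j} \<subseteq> A" using assms(2) by auto
    then have "card {..j} \<le> card A" using assms(1) by (rule card_mono[rotated])
    then show "j \<in> {..<card A}" by simp
  qed
  from card_subset_eq[OF finite_lessThan this] show ?thesis by simp
qed

lemma less_column_length_iff:
  assumes "la \<in> box_partitions k N"
  shows "i < column_length e la c \<longleftrightarrow> i < length la \<and> e c < la ! i"
proof -
  have "{i. i < length la \<and> e c < la ! i} = {..<column_length e la c}"
    unfolding column_length_def
  proof (rule initial_segment_eq)
    fix i j assume j: "j \<in> {i. i < length la \<and> e c < la ! i}" and "i \<le> j"
    then have "la ! j \<le> la ! i" using box_partitions_antimono[OF assms] by simp
    then show "i \<in> {i. i < length la \<and> e c < la ! i}" using j \<open>i \<le> j\<close> by simp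
  qed simp
  then have "i \<in> {i. i < length la \<and> e c < la ! i} \<longleftrightarrow> i \<in> {..<column_length e la c}" by (rule arg_cong)
  then show ?thesis by simp
qed

lemma column_length_le:
  assumes "la \<in> box_partitions k N"
  shows "column_length e la c \<le> k"
proof -
  have "column_length e la c \<le> card {..<length la}"
    unfolding column_length_def by (intro card_mono) auto
  then show ?thesis using assms by (auto simp: box_partitions_def)
qed

lemma column_length_antimono:
  assumes "e c \<le> e c'"
  shows "column_length e la c' \<le> column_length e la c"
  unfolding column_length_def using assms by (intro card_mono) auto

lemma prod_falling: "u \<le> M \<Longrightarrow> (\<Prod>i<u. real M - real i) = fact M / fact (M - u)"
proof (induction u)
  case (Suc u)
  have "fact (M - u) = real (M - u) * fact (M - Suc u)"
    using Suc.prems by (metis Suc_diff_Suc Suc_le_lessD fact_Suc of_nat_fact of_nat_mult)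
  moreover have "(\<Prod>i<Suc u. real M - real i) = fact M / fact (M - u) * real (M - u)"
    using Suc by (simp add: of_nat_diff)
  ultimately show ?case using Suc.prems by simp
qed simp

context
  fixes e :: "'n::finite \<Rightarrow> nat" and N :: nat
  assumes e: "bij_betw e UNIV {..<N}"
begin

lemma inj_e: "inj e" using e by (simp add: bij_betw_def)

lemma e_less: "e c < N" using bij_betwE[OF e] by auto

lemma card_UNIV_eq: "N = CARD('n)" using bij_betw_same_card[OF e] by simp

lemma card_e_less: assumes "a \<le> N" shows "card {c. e c < a} = a"
proof -
  have "e ` {c. e c < a} = {..<a}" using e assms by (auto simp: bij_betw_def)
  moreover have "card (e ` {c. e c < a}) = card {c. e c < a}"
    by (rule card_image) (rule inj_on_subset[OF inj_e subset_UNIV])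
  ultimately show ?thesis by simp
qed

lemma card_e_greater: "card {c'. e c < e c'} = N - 1 - e c"
proof -
  have "{c'. e c < e c'} = UNIV - {c'. e c' < Suc (e c)}" by auto
  then have "card {c'. e c < e c'} = CARD('n) - card {c'. e c' < Suc (e c)}"
    by (simp add: card_Diff_subset)
  then show ?thesis using card_e_less[of "Suc (e c)"] e_less[of c] card_UNIV_eq by simp
qed

lemma sum_column_length:
  assumes "la \<in> box_partitions k N"
  shows "(\<Sum>c\<in>UNIV. column_length e la c) = sum_list la"
proof -
  have "(\<Sum>c\<in>UNIV. column_length e la c) = (\<Sum>c\<in>UNIV. \<Sum>i<length la. if e c < la ! i then 1 else 0)"
  proof (rule sum.cong[OF refl])
    fix c
    have "column_length e la c = card ({..<length la} \<inter> {i. e c < la ! i})"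
      unfolding column_length_def by (rule arg_cong[where f = card]) auto
    then show "column_length e la c = (\<Sum>i<length la. if e c < la ! i then 1 else 0)"
      by (simp add: sum.If_cases)
  qed
  also have "\<dots> = (\<Sum>i<length la. \<Sum>c\<in>UNIV. if e c < la ! i then 1 else 0)" by (rule sum.swap)
  also have "\<dots> = (\<Sum>i<length la. la ! i)"
  proof (rule sum.cong[OF refl])
    fix i assume "i \<in> {..<length la}"
    then have "la ! i \<le> N" using box_partitions_nth[OF assms] by simp
    then show "(\<Sum>c\<in>UNIV. if e c < la ! i then 1 else 0) = la ! i"
      using card_e_less by (simp add: sum.If_cases)
  qed
  also have "\<dots> = sum_list la" by (simp add: sum_list_sum_nth atLeast0LessThan)
  finally show ?thesis .
qed

lemma prod_boxes_by_columns:
  assumes "la \<in> box_partitions k N"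
  shows "(\<Prod>i<length la. \<Prod>j<la ! i. f i j) = (\<Prod>c\<in>UNIV. \<Prod>i<column_length e la c. f i (e c) :: 'a::comm_monoid_mult)"
proof -
  have "(\<Prod>i<length la. \<Prod>j<la ! i. f i j) = (\<Prod>i<length la. \<Prod>c | e c < la ! i. f i (e c))"
  proof (rule prod.cong[OF refl])
    fix i assume "i \<in> {..<length la}"
    then have "la ! i \<le> N" using box_partitions_nth[OF assms] by simp
    then have im: "e ` {c. e c < la ! i} = {..<la ! i}"
      using e by (auto simp: bij_betw_def)
    have "inj_on e {c. e c < la ! i}" using inj_e by (rule inj_on_subset) simp
    from prod.reindex[OF this, of "f i"] show "(\<Prod>j<la ! i. f i j) = (\<Prod>c | e c < la ! i. f i (e c))"
      unfolding im comp_def .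
  qed
  also have "\<dots> = (\<Prod>i<length la. \<Prod>c\<in>UNIV. if e c < la ! i then f i (e c) else 1)"
    by (rule prod.cong[OF refl]) (simp add: prod.If_cases)
  also have "\<dots> = (\<Prod>c\<in>UNIV. \<Prod>i<length la. if e c < la ! i then f i (e c) else 1)"
    by (rule prod.swap)
  also have "\<dots> = (\<Prod>c\<in>UNIV. \<Prod>i<column_length e la c. f i (e c))"
  proof (rule prod.cong[OF refl])
    fix c
    have "{..<length la} \<inter> {i. e c < la ! i} = {..<column_length e la c}"
      using less_column_length_iff[OF assms, of _ e c] by auto
    then show "(\<Prod>i<length la. if e c < la ! i then f i (e c) else 1) = (\<Prod>i<column_length e la c. f i (e c))"
      by (simp add: prod.If_cases)
  qed
  finally show ?thesis .
qed

text \<open>The conjugate partition plus the staircase N-1, ..., 1, 0, which makes its parts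
  strictly decreasing: the beta-numbers of the conjugate partition.\<close>

definition shifted_column :: "nat list \<Rightarrow> 'n \<Rightarrow> nat" where
  "shifted_column la c = column_length e la c + (N - 1 - e c)"

lemma shifted_column_less:
  assumes "e c < e c'" shows "shifted_column la c' < shifted_column la c"
  using column_length_antimono[of e c c' la] assms e_less[of c'] unfolding shifted_column_def by simp

text \<open>In column \<open>c\<close> the hook lengths and the differences \<open>m\<^sub>c - m\<^sub>c\<^sub>'\<close> fill up \<open>{1..m\<^sub>c}\<close>.\<close>

lemma hook_length_column:
  assumes la: "la \<in> box_partitions k N"
  shows "(\<Prod>i<column_length e la c. hook_length la i (e c)) *
    (\<Prod>c' | e c < e c'. shifted_column la c - shifted_column la c') = fact (shifted_column la c)"
proof -
  let ?\<mu> = "column_length e la" and ?m = "shifted_column la"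
  \<comment> \<open>Arm plus leg plus one, with rows and columns numbered from 0.\<close>
  define h where "h i = la ! i + ?\<mu> c - i - e c - 1" for i
  have box: "i < ?\<mu> c' \<longleftrightarrow> i < length la \<and> e c' < la ! i" for i c' by (rule less_column_length_iff[OF la])
  have hook: "hook_length la i (e c) = h i" if i: "i < ?\<mu> c" for i
  proof -
    have 1: "{j'. e c < j' \<and> j' < la ! i} = {Suc (e c)..<la ! i}" by auto
    have 2: "{i'. i < i' \<and> i' < length la \<and> e c < la ! i'} = {Suc i..<?\<mu> c}"
      unfolding set_eq_iff mem_Collect_eq atLeastLessThan_iff box by auto
    have 3: "card {Suc (e c)..<la ! i} = la ! i - Suc (e c)" "card {Suc i..<?\<mu> c} = ?\<mu> c - Suc i" by simp_all
    have "e c < la ! i" using i box[of i c] by simp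
    then show ?thesis unfolding hook_length_def 1 2 3 h_def using i by linarith
  qed
  have h_eq: "h i + (i + e c + 1) = la ! i + ?\<mu> c" if i: "i < ?\<mu> c" for i
  proof -
    have "e c < la ! i" using i box[of i c] by simp
    then show ?thesis using i unfolding h_def by linarith
  qed
  have m_eq: "?m c + (e c + 1) = ?\<mu> c + N" for c
    using e_less[of c] unfolding shifted_column_def by simp
  have inj_h: "inj_on h {..<?\<mu> c}"
  proof (rule inj_onI)
    fix i i' assume i: "i \<in> {..<?\<mu> c}" "i' \<in> {..<?\<mu> c}" and eq: "h i = h i'"
    have *: False if "a < b" "a < ?\<mu> c" "b < ?\<mu> c" "h a = h b" for a b
    proof -
      have "la ! b \<le> la ! a" using box_partitions_antimono[OF la, of a b] that box[of b c] by simp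
      then show False using that h_eq[of a] h_eq[of b] by linarith
    qed
    show "i = i'"
    proof (rule linorder_cases[of i i'])
      assume "i < i'" then show ?thesis using *[of i i'] i eq by simp
    next
      assume "i' < i" then show ?thesis using *[of i' i] i eq by simp
    qed
  qed
  define g where "g c' = ?m c - ?m c'" for c'
  have mless: "?m c' < ?m c" if "e c < e c'" for c' using shifted_column_less[OF that] .
  have g_eq: "g c' + ?m c' = ?m c" if "e c < e c'" for c' using mless[OF that] by (simp add: g_def)
  have inj_g: "inj_on g {c'. e c < e c'}"
  proof (rule inj_onI)
    fix a b assume a: "a \<in> {c'. e c < e c'}" "b \<in> {c'. e c < e c'}" and eq: "g a = g b"
    then have "?m a = ?m b" using g_eq[of a] g_eq[of b] by simp
    then have "\<not> e a < e b" "\<not> e b < e a"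
      using shifted_column_less[of a b la] shifted_column_less[of b a la] by auto
    then have "e a = e b" by simp
    then show "a = b" using inj_e by (simp add: inj_def)
  qed
  have h_range: "h ` {..<?\<mu> c} \<subseteq> {1..?m c}"
  proof
    fix x assume "x \<in> h ` {..<?\<mu> c}"
    then obtain i where i: "i < ?\<mu> c" and x: "x = h i" by auto
    have "e c < la ! i" "i < length la" using i box[of i c] by auto
    moreover have "la ! i \<le> N" using box_partitions_nth[OF la] calculation by simp
    ultimately have "1 \<le> h i" "h i \<le> ?m c" using i h_eq[OF i] m_eq[of c] by linarith+
    then show "x \<in> {1..?m c}" by (simp add: x)
  qed
  have g_range: "g ` {c'. e c < e c'} \<subseteq> {1..?m c}"
  proof
    fix x assume "x \<in> g ` {c'. e c < e c'}"
    then obtain c' where c': "e c < e c'" "x = g c'" by auto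
    then show "x \<in> {1..?m c}" using g_eq[OF c'(1)] mless[OF c'(1)] by simp
  qed
  \<comment> \<open>A common value would force \<open>la ! i\<close> plus the length of column c' to
    be i + 1 + e c'. This sum is larger if the box (i, e c') lies in the diagram and smaller if it
    does not.\<close>
  have disj: "h ` {..<?\<mu> c} \<inter> g ` {c'. e c < e c'} = {}"
  proof (rule ccontr)
    assume "h ` {..<?\<mu> c} \<inter> g ` {c'. e c < e c'} \<noteq> {}"
    then obtain i c' where i: "i < ?\<mu> c" and c': "e c < e c'" and eq: "h i = g c'" by auto
    have il: "e c < la ! i" "i < length la" using i box[of i c] by auto
    have "?\<mu> c' \<le> ?\<mu> c" using column_length_antimono[of e c c' la] c' by simp
    then have eq': "la ! i + ?\<mu> c' = i + 1 + e c'"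
      using eq h_eq[OF i] g_eq[OF c'] m_eq[of c] m_eq[of c'] by linarith
    show False
    proof (cases "i < ?\<mu> c'")
      case True
      then show False using box[of i c'] eq' by simp
    next
      case False
      then have "\<not> e c' < la ! i" using box[of i c'] il by simp
      then show False using eq' False by simp
    qed
  qed
  \<comment> \<open>The two disjoint sets together have as many elements as {1..m_c}, hence exhaust
    it.\<close>
  have "card (h ` {..<?\<mu> c} \<union> g ` {c'. e c < e c'}) = ?\<mu> c + (N - 1 - e c)"
    by (subst card_Un_disjoint[OF _ _ disj]) (simp_all add: card_image[OF inj_h] card_image[OF inj_g] card_e_greater)
  then have "h ` {..<?\<mu> c} \<union> g ` {c'. e c < e c'} = {1..?m c}"
  proof (intro card_subset_eq)
    show "h ` {..<?\<mu> c} \<union> g ` {c'. e c < e c'} \<subseteq> {1..?m c}" using h_range g_range by (rule Un_least)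
  qed (simp_all add: shifted_column_def)
  then have "fact (?m c) = \<Prod>(h ` {..<?\<mu> c} \<union> g ` {c'. e c < e c'})" by (simp only: fact_prod of_nat_id)
  also have "\<dots> = \<Prod>(h ` {..<?\<mu> c}) * \<Prod>(g ` {c'. e c < e c'})"
    by (rule prod.union_disjoint[OF _ _ disj]) simp_all
  also have "\<dots> = (\<Prod>i<?\<mu> c. h i) * (\<Prod>c' | e c < e c'. g c')"
    by (simp only: prod.reindex[OF inj_h] prod.reindex[OF inj_g] comp_def)
  also have "(\<Prod>i<?\<mu> c. h i) = (\<Prod>i<?\<mu> c. hook_length la i (e c))" by (simp add: hook)
  finally show ?thesis by (simp add: g_def)
qed

lemma hook_product_columns:
  assumes la: "la \<in> box_partitions k N"
  shows "hook_product la * (\<Prod>c\<in>UNIV. \<Prod>c' | e c < e c'. shifted_column la c - shifted_column la c') =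
    (\<Prod>c\<in>UNIV. fact (shifted_column la c))"
  unfolding hook_product_def prod_boxes_by_columns[OF la] prod.distrib[symmetric] hook_length_column[OF la] ..

text \<open>Column c contributes a falling factorial starting at r + e c, of length at most k. It is
  applied with r = k and r = 2k.\<close>

lemma gen_pochhammer_nat_columns:
  assumes la: "la \<in> box_partitions k N" and k: "k \<le> r"
  shows "gen_pochhammer (real r) la = (\<Prod>c\<in>UNIV. fact (r + e c) / fact (r + N - 1 - shifted_column la c))"
  unfolding gen_pochhammer_def prod_boxes_by_columns[OF la]
proof (rule prod.cong[OF refl])
  fix c
  have le: "column_length e la c \<le> r + e c" using column_length_le[OF la, of e c] k by simp
  have "(\<Prod>i<column_length e la c. real r + real (e c) - real i) = (\<Prod>i<column_length e la c. real (r + e c) - real i)"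
    by simp
  also have "\<dots> = fact (r + e c) / fact (r + e c - column_length e la c)"
    by (rule prod_falling[OF le])
  also have "r + e c - column_length e la c = r + N - 1 - shifted_column la c"
    using e_less[of c] le unfolding shifted_column_def by linarith
  finally show "(\<Prod>i<column_length e la c. real r + real (e c) - real i) = fact (r + e c) / fact (r + N - 1 - shifted_column la c)" .
qed

lemma gen_pochhammer_neg_columns:
  assumes la: "la \<in> box_partitions k N"
  shows "gen_pochhammer (- real N) la = (\<Prod>c\<in>UNIV. (-1) ^ column_length e la c * (fact (shifted_column la c) / fact (N - 1 - e c)))"
  unfolding gen_pochhammer_def prod_boxes_by_columns[OF la]
proof (rule prod.cong[OF refl])
  fix c
  have "(\<Prod>i<u. - real N + real (e c) - real i) = (-1) ^ u * (fact (u + (N - 1 - e c)) / fact (N - 1 - e c))" for u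
  proof (induction u)
    case (Suc u)
    have "(\<Prod>i<Suc u. - real N + real (e c) - real i) =
       (-1) ^ u * (fact (u + (N - 1 - e c)) / fact (N - 1 - e c)) * (- real N + real (e c) - real u)"
      by (simp only: prod.lessThan_Suc Suc.IH)
    also have "- real N + real (e c) - real u = - real (Suc u + (N - 1 - e c))"
      using e_less[of c] by (simp add: of_nat_diff)
    finally show ?case by (simp add: field_simps)
  qed simp
  then show "(\<Prod>i<column_length e la c. - real N + real (e c) - real i) =
      (-1) ^ column_length e la c * (fact (shifted_column la c) / fact (N - 1 - e c))"
    by (simp add: shifted_column_def)
qed

text \<open>One decreasing representative for each N-element subset of {0..K-1}: the index set of
  the Cauchy-Binet sum.\<close>

definition strict_columns :: "nat \<Rightarrow> ('n \<Rightarrow> nat) set" where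
  "strict_columns K = {m. (\<forall>c c'. e c < e c' \<longrightarrow> m c' < m c) \<and> (\<forall>c. m c < K)}"

lemma strict_columns_diff:
  assumes m: "m \<in> strict_columns K" and "e c \<le> e c'"
  shows "m c' + (e c' - e c) \<le> m c"
  using assms(2)
proof (induction "e c' - e c" arbitrary: c')
  case 0
  then have "e c = e c'" by simp
  then have "c = c'" using inj_e by (simp add: inj_def)
  then show ?case by simp
next
  case (Suc d)
  then have "e c' > 0" by simp
  have "e c' - 1 \<in> e ` UNIV" using e e_less[of c'] by (auto simp: bij_betw_def)
  then obtain c'' where c'': "e c'' = e c' - 1" by auto
  have "m c'' + (e c'' - e c) \<le> m c" using Suc c'' by (intro Suc.hyps) auto
  moreover have "m c' < m c''" using m c'' \<open>e c' > 0\<close> by (auto simp: strict_columns_def)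
  ultimately show ?case using c'' Suc by simp
qed

text \<open>Partitions in the k by N box correspond to N-element subsets of {0..k+N-1}, which turns
  the Cauchy-Binet sum into a sum over partitions.\<close>

lemma shifted_column_bij:
  assumes N0: "0 < N"
  shows "bij_betw shifted_column (box_partitions k N) (strict_columns (k + N))"
proof (rule bij_betwI')
  fix la lb assume la: "la \<in> box_partitions k N" and lb: "lb \<in> box_partitions k N"
  show "shifted_column la = shifted_column lb \<longleftrightarrow> la = lb"
  proof
    assume "shifted_column la = shifted_column lb"
    then have eq: "column_length e la = column_length e lb"
      by (auto simp: fun_eq_iff shifted_column_def)
    have iff: "i < length la \<and> a < la ! i \<longleftrightarrow> i < length lb \<and> a < lb ! i" if "a < N" for i a
    proof -
      have "a \<in> e ` UNIV" using e that by (auto simp: bij_betw_def)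
      then obtain c where "a = e c" by auto
      then show ?thesis using less_column_length_iff[OF la, of i e c] less_column_length_iff[OF lb, of i e c] eq by simp
    qed
    have len: "i < length la \<longleftrightarrow> i < length lb" for i
      using iff[OF N0, of i] box_partitions_nth(1)[OF la, of i] box_partitions_nth(1)[OF lb, of i] by auto
    have "length la = length lb" using len[of "length la"] len[of "length lb"] by simp
    moreover have "la ! i = lb ! i" if i: "i < length la" for i
    proof (rule ccontr)
      assume ne: "la ! i \<noteq> lb ! i"
      have i': "i < length lb" using i len by simp
      have le: "la ! i \<le> N" "lb ! i \<le> N"
        using box_partitions_nth(2)[OF la i] box_partitions_nth(2)[OF lb i'] by auto
      show False
      proof (rule linorder_cases[of "la ! i" "lb ! i"])
        assume "la ! i < lb ! i" then show False using iff[of "la ! i" i] i i' le by simp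
      next
        assume "lb ! i < la ! i" then show False using iff[of "lb ! i" i] i i' le by simp
      qed (use ne in simp)
    qed
    ultimately show "la = lb" by (rule nth_equalityI)
  qed simp
next
  fix la assume la: "la \<in> box_partitions k N"
  show "shifted_column la \<in> strict_columns (k + N)"
  proof -
    have "shifted_column la c < k + N" for c
      unfolding shifted_column_def by (rule add_le_less_mono[OF column_length_le[OF la]]) (use N0 in simp)
    then show ?thesis unfolding strict_columns_def using shifted_column_less by simp
  qed
next
  fix m assume m: "m \<in> strict_columns (k + N)"
  have lower: "N - 1 - e c \<le> m c" for c
  proof -
    have "N - 1 \<in> e ` UNIV" using e N0 by (auto simp: bij_betw_def)
    then obtain c' where c': "e c' = N - 1" by auto
    then have "e c \<le> e c'" using e_less[of c] by simp
    from strict_columns_diff[OF m this] show ?thesis unfolding c' by (rule add_leD2)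
  qed
  define u where "u c = m c - (N - 1 - e c)" for c
  have mu: "m c = u c + (N - 1 - e c)" for c using lower by (simp add: u_def)
  have anti: "u c' \<le> u c" if "e c \<le> e c'" for c c'
  proof -
    have "N - 1 - e c = (N - 1 - e c') + (e c' - e c)" using that e_less[of c'] by simp
    then have "u c' + (N - 1 - e c') + (e c' - e c) \<le> u c + ((N - 1 - e c') + (e c' - e c))"
      using strict_columns_diff[OF m that] unfolding mu[of c] mu[of c'] by simp
    then show ?thesis by simp
  qed
  have "0 \<in> e ` UNIV" using e N0 by (auto simp: bij_betw_def)
  then obtain c0 where c0: "e c0 = 0" by auto
  have uk: "u c \<le> k" for c
  proof -
    have "m c0 < k + N" using m by (simp add: strict_columns_def)
    then have "u c0 \<le> k" using mu[of c0] c0 N0 by simp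
    then show ?thesis using anti[of c0 c] c0 by simp
  qed
  \<comment> \<open>The conjugate of the partition with column lengths \<open>u\<close>; column
    \<open>c0\<close> has number 0, so \<open>u c0\<close> is the number of rows.\<close>
  define la where "la = map (\<lambda>i. card {c. i < u c}) [0..<u c0]"
  have less_card: "e c < card {c. i < u c} \<longleftrightarrow> i < u c" for c i
  proof -
    have "e ` {c. i < u c} = {..<card (e ` {c. i < u c})}"
    proof (rule initial_segment_eq)
      fix a b assume "b \<in> e ` {c. i < u c}" "a \<le> b"
      then obtain c where c: "b = e c" "i < u c" by auto
      have "a < N" using \<open>a \<le> b\<close> e_less[of c] c by simp
      then have "a \<in> e ` UNIV" using e by (auto simp: bij_betw_def)
      then obtain c' where "a = e c'" by auto
      then show "a \<in> e ` {c. i < u c}" using anti[of c' c] c \<open>a \<le> b\<close> by simp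
    qed simp
    moreover have "card (e ` {c. i < u c}) = card {c. i < u c}"
      by (rule card_image) (rule inj_on_subset[OF inj_e subset_UNIV])
    ultimately have "e c \<in> e ` {c. i < u c} \<longleftrightarrow> e c < card {c. i < u c}" by simp
    moreover have "e c \<in> e ` {c. i < u c} \<longleftrightarrow> i < u c" by (simp add: inj_image_mem_iff[OF inj_e])
    ultimately show ?thesis by simp
  qed
  have la: "la \<in> box_partitions k N"
  proof -
    have "sorted_wrt (\<ge>) la"
      unfolding sorted_wrt_iff_nth_less la_def by (auto intro!: card_mono)
    moreover have "0 < x \<and> x \<le> N" if "x \<in> set la" for x
    proof -
      obtain i where i: "i < u c0" "x = card {c. i < u c}" using \<open>x \<in> set la\<close> by (auto simp: la_def)
      have "card {c. i < u c} \<le> CARD('n)" by (rule card_mono) auto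
      then show ?thesis using less_card[of c0 i] i c0 card_UNIV_eq by simp
    qed
    ultimately show ?thesis using uk[of c0] by (auto simp: box_partitions_def la_def)
  qed
  have "column_length e la c = u c" for c
  proof -
    have "{i. i < length la \<and> e c < la ! i} = {..<u c}"
    proof -
      have "u c \<le> u c0" using anti[of c0 c] c0 by simp
      then show ?thesis by (auto simp: la_def less_card)
    qed
    then show ?thesis by (simp add: column_length_def)
  qed
  then have "shifted_column la = m" by (auto simp: fun_eq_iff shifted_column_def mu)
  then show "\<exists>la\<in>box_partitions k N. m = shifted_column la" using la by blast
qed

end

section \<open>Expansion of the Laguerre determinant\<close>

text \<open>Powers W^c with c above the index have zero coefficient, so all inner sums may run up to
  the same n and be exchanged.\<close>

lemma fps_compose_mult_nth:
  fixes A E W :: "complex fps"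
  assumes W: "fps_nth W 0 = 0"
  shows "fps_nth (A * (E oo W)) n = (\<Sum>c\<le>n. fps_nth E c * fps_nth (A * W ^ c) n)"
proof -
  have z: "fps_nth (W ^ c) i = 0" if "i < c" for i c
    using startsby_zero_power_prefix[OF W] that by blast
  have "fps_nth (A * (E oo W)) n = (\<Sum>i\<le>n. fps_nth A i * (\<Sum>c\<le>n - i. fps_nth E c * fps_nth (W ^ c) (n - i)))"
    by (simp add: fps_mult_nth fps_compose_nth atLeast0AtMost)
  also have "\<dots> = (\<Sum>i\<le>n. fps_nth A i * (\<Sum>c\<le>n. fps_nth E c * fps_nth (W ^ c) (n - i)))"
  proof (rule sum.cong[OF refl])
    fix i
    have "(\<Sum>c\<le>n - i. fps_nth E c * fps_nth (W ^ c) (n - i)) = (\<Sum>c\<le>n. fps_nth E c * fps_nth (W ^ c) (n - i))"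
      by (rule sum.mono_neutral_left) (auto simp: z)
    then show "fps_nth A i * (\<Sum>c\<le>n - i. fps_nth E c * fps_nth (W ^ c) (n - i)) = fps_nth A i * (\<Sum>c\<le>n. fps_nth E c * fps_nth (W ^ c) (n - i))"
      by simp
  qed
  also have "\<dots> = (\<Sum>i\<le>n. \<Sum>c\<le>n. fps_nth E c * (fps_nth A i * fps_nth (W ^ c) (n - i)))"
    by (simp add: sum_distrib_left mult_ac)
  also have "\<dots> = (\<Sum>c\<le>n. \<Sum>i\<le>n. fps_nth E c * (fps_nth A i * fps_nth (W ^ c) (n - i)))"
    by (rule sum.swap)
  finally show ?thesis by (simp add: fps_mult_nth sum_distrib_left atLeast0AtMost)
qed

text \<open>The left one of two rectangular factors of the Laguerre coefficient matrix, with
  intermediate index m < k + N.\<close>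

definition exp_weight :: "complex \<Rightarrow> nat \<Rightarrow> nat \<Rightarrow> complex" where
  "exp_weight s a m = (if a \<le> m then s ^ (m - a) / fact (m - a) else 0)"

text \<open>The coefficient of x^(k+j) in x^m (1-x)^(2k+N-1-m); for j < N the guard keeps the
  truncated exponent exact.\<close>

definition power_weight :: "nat \<Rightarrow> nat \<Rightarrow> nat \<Rightarrow> nat \<Rightarrow> complex" where
  "power_weight k N m j = (if m \<le> k + j then fps_nth ((1 - fps_X) ^ (2 * k + N - 1 - m)) (k + j - m) else 0)"

text \<open>This is the reason for the basis x^a (1-x)^(N-1-a): multiplied by (1-x)^(2k) (x/(1-x))^c
  it becomes x^m (1-x)^(2k+N-1-m) with m = a + c, so a and j interact only through m.\<close>

lemma laguerre_coefficient:
  assumes a: "a < N" and j: "j < N"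
  shows "fps_nth (fps_of_poly ([:0, 1:] ^ a * [:1, -1:] ^ (N - 1 - a)) * laguerre_fps k s) (k + j) =
    (\<Sum>m<k + N. exp_weight s a m * power_weight k N m j)"
proof -
  let ?b = "2 * k + N - 1 - a" and ?n = "k + j"
  let ?W = "fps_X * inverse (1 - fps_X) :: complex fps"
  let ?A = "fps_X ^ a * (1 - fps_X) ^ ?b :: complex fps"
  have inv: "inverse (1 - fps_X) * (1 - fps_X) = (1 :: complex fps)" by (rule inverse_mult_eq_1) simp
  have "fps_of_poly ([:0, 1:] ^ a * [:1, -1:] ^ (N - 1 - a)) = (fps_X ^ a * (1 - fps_X) ^ (N - 1 - a) :: complex fps)"
    by (simp add: fps_of_poly_mult fps_of_poly_power fps_of_poly_pCons fps_const_neg[symmetric] del: fps_const_neg)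
  moreover have "(1 - fps_X) ^ (N - 1 - a) * (1 - fps_X) ^ (2 * k) = ((1 - fps_X) ^ ?b :: complex fps)"
  proof -
    have "N - 1 - a + 2 * k = ?b" using a by simp
    then show ?thesis unfolding power_add[symmetric] by (rule arg_cong)
  qed
  ultimately have "fps_of_poly ([:0, 1:] ^ a * [:1, -1:] ^ (N - 1 - a)) * laguerre_fps k s = ?A * (fps_exp s oo ?W)"
    by (simp add: laguerre_fps_def mult.assoc)
  then have "fps_nth (fps_of_poly ([:0, 1:] ^ a * [:1, -1:] ^ (N - 1 - a)) * laguerre_fps k s) ?n =
     (\<Sum>c\<le>?n. fps_nth (fps_exp s) c * fps_nth (?A * ?W ^ c) ?n)"
    by (simp only: fps_compose_mult_nth fps_mult_nth_0 fps_X_nth) (simp add: fps_compose_mult_nth)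
  also have "\<dots> = (\<Sum>c\<le>?n. exp_weight s a (a + c) * power_weight k N (a + c) j)"
  proof (rule sum.cong[OF refl])
    fix c
    have W: "?A * ?W ^ c = fps_X ^ (a + c) * ((1 - fps_X) ^ ?b * inverse (1 - fps_X) ^ c)"
      by (simp add: power_mult_distrib power_add mult_ac)
    have "fps_nth (?A * ?W ^ c) ?n = power_weight k N (a + c) j"
    proof (cases "a + c \<le> ?n")
      case False
      then show ?thesis unfolding W fps_X_power_mult_nth by (simp add: power_weight_def)
    next
      case True
      then have bc: "?b = (?b - c) + c" using j by simp
      have "(1 - fps_X) ^ ?b * inverse (1 - fps_X) ^ c = ((1 - fps_X) ^ (?b - c) :: complex fps)"
      proof -
        have "(1 - fps_X) ^ ?b * inverse (1 - fps_X) ^ c = (1 - fps_X) ^ (?b - c) * (inverse (1 - fps_X) * (1 - fps_X :: complex fps)) ^ c"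
          by (subst bc) (simp only: power_add power_mult_distrib mult_ac)
        then show ?thesis by (simp add: inv)
      qed
      then have "fps_nth (?A * ?W ^ c) ?n = fps_nth ((1 - fps_X) ^ (?b - c)) (?n - (a + c))"
        unfolding W fps_X_power_mult_nth using True by simp
      moreover have "?b - c = 2 * k + N - 1 - (a + c)" by simp
      ultimately show ?thesis using True by (simp add: power_weight_def)
    qed
    then show "fps_nth (fps_exp s) c * fps_nth (?A * ?W ^ c) ?n = exp_weight s a (a + c) * power_weight k N (a + c) j"
      by (simp add: exp_weight_def)
  qed
  also have "\<dots> = (\<Sum>m\<in>{a..a + ?n}. exp_weight s a m * power_weight k N m j)"
    by (rule sum.reindex_bij_witness[where i = "\<lambda>m. m - a" and j = "\<lambda>c. a + c"]) auto
  also have "\<dots> = (\<Sum>m\<in>{a..a + ?n} \<union> {..<k + N}. exp_weight s a m * power_weight k N m j)"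
    by (rule sum.mono_neutral_left) (use j in \<open>auto simp: exp_weight_def power_weight_def\<close>)
  also have "\<dots> = (\<Sum>m<k + N. exp_weight s a m * power_weight k N m j)"
    by (rule sum.mono_neutral_right) (use j in \<open>auto simp: exp_weight_def power_weight_def\<close>)
  finally show ?thesis .
qed

section \<open>The Cauchy-Binet formula\<close>

context
  fixes e :: "'n::finite \<Rightarrow> nat" and N :: nat
  assumes e: "bij_betw e UNIV {..<N}"
begin

lemma strict_columns_iff:
  assumes "m \<in> strict_columns e K" shows "m c < m c' \<longleftrightarrow> e c' < e c"
proof -
  have s: "e a < e b \<Longrightarrow> m b < m a" for a b using assms by (simp add: strict_columns_def[OF e])
  show ?thesis
  proof (rule linorder_cases[of "e c" "e c'"])
    assume "e c < e c'" then show ?thesis using s[of c c'] by simp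
  next
    assume "e c = e c'"
    then have "c = c'" using inj_e[OF e] by (simp add: inj_def)
    then show ?thesis by simp
  next
    assume "e c' < e c" then show ?thesis using s[of c' c] by simp
  qed
qed

text \<open>Recovers the permutation from the composite \<open>m \<circ> p\<close>: the number of
  values exceeding the one at i is the rank of \<open>p i\<close>.\<close>

lemma strict_columns_rank:
  assumes m: "m \<in> strict_columns e K" and p: "p permutes UNIV"
  shows "card {j. m (p i) < m (p j)} = e (p i)"
proof -
  have "{j. m (p i) < m (p j)} = {j. e (p j) < e (p i)}"
    using strict_columns_iff[OF m] by simp
  also have "p ` \<dots> = {j. e j < e (p i)}"
    using permutes_surj[OF p] by auto
  then have "card {j. e (p j) < e (p i)} = card {j. e j < e (p i)}"
    using card_image[of p "{j. e (p j) < e (p i)}", OF inj_on_subset[OF permutes_inj[OF p] subset_UNIV]] by simp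
  also have "\<dots> = e (p i)" by (rule card_e_less[OF e]) (use e_less[OF e, of "p i"] in simp)
  finally show ?thesis using strict_columns_iff[OF m] by simp
qed

text \<open>Sorting: every injective function is a decreasing one composed with a unique
  permutation.\<close>

lemma strict_columns_permutations_bij:
  "bij_betw (\<lambda>(m, p). m \<circ> p) (strict_columns e K \<times> {p. p permutes (UNIV :: 'n set)}) {f. inj f \<and> (\<forall>i. f i < K)}"
proof (rule bij_betwI')
  fix x y assume x: "x \<in> strict_columns e K \<times> {p. p permutes (UNIV :: 'n set)}" and y: "y \<in> strict_columns e K \<times> {p. p permutes (UNIV :: 'n set)}"
  obtain m p where mp: "x = (m, p)" by (cases x)
  obtain m' p' where mp': "y = (m', p')" by (cases y)
  show "((case x of (m, p) \<Rightarrow> m \<circ> p) = (case y of (m, p) \<Rightarrow> m \<circ> p)) = (x = y)"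
  proof
    assume "(case x of (m, p) \<Rightarrow> m \<circ> p) = (case y of (m, p) \<Rightarrow> m \<circ> p)"
    then have eq: "m (p i) = m' (p' i)" for i by (simp add: mp mp' fun_eq_iff)
    have m: "m \<in> strict_columns e K" "p permutes UNIV" "m' \<in> strict_columns e K" "p' permutes UNIV"
      using x y by (auto simp: mp mp')
    have "e (p i) = e (p' i)" for i
      using strict_columns_rank[OF m(1,2), of i] strict_columns_rank[OF m(3,4), of i] eq by simp
    then have pp: "p i = p' i" for i using inj_e[OF e] by (simp add: inj_def)
    have "m j = m' j" for j
    proof -
      obtain i where "j = p i" using permutes_surj[OF m(2)] by auto
      then show ?thesis using eq[of i] pp by simp
    qed
    then show "x = y" using pp by (auto simp: mp mp' fun_eq_iff)
  qed simp
next
  fix x assume "x \<in> strict_columns e K \<times> {p. p permutes (UNIV :: 'n set)}"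
  then obtain m p where mp: "x = (m, p)" "m \<in> strict_columns e K" "p permutes UNIV" by auto
  have "inj m"
  proof (rule injI)
    fix a b assume "m a = m b"
    then have "\<not> e a < e b" "\<not> e b < e a" using strict_columns_iff[OF mp(2), of a b] strict_columns_iff[OF mp(2), of b a] by auto
    then have "e a = e b" by simp
    then show "a = b" using inj_e[OF e] by (simp add: inj_def)
  qed
  then have "inj (m \<circ> p)" using permutes_inj[OF mp(3)] by (rule inj_compose)
  then show "(case x of (m, p) \<Rightarrow> m \<circ> p) \<in> {f. inj f \<and> (\<forall>i. f i < K)}"
    using mp by (simp add: strict_columns_def[OF e])
next
  fix f :: "'n \<Rightarrow> nat" assume "f \<in> {f. inj f \<and> (\<forall>i. f i < K)}"
  then have f: "inj f" "\<And>i. f i < K" by auto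
  define r where "r i = card {j. f i < f j}" for i
  have r_less: "r i < N" for i
  proof -
    have "{j. f i < f j} \<subset> UNIV" by auto
    then have "r i < CARD('n)" unfolding r_def by (intro psubset_card_mono) auto
    then show ?thesis using card_UNIV_eq[OF e] by simp
  qed
  have r_mono: "r i < r j" if "f j < f i" for i j
    unfolding r_def using that by (intro psubset_card_mono) auto
  have "inj r"
  proof (rule injI)
    fix a b assume "r a = r b"
    then have "\<not> f a < f b" "\<not> f b < f a" using r_mono[of a b] r_mono[of b a] by auto
    then show "a = b" using f(1) by (simp add: inj_def)
  qed
  define p where "p i = inv_into UNIV e (r i)" for i
  have ep: "e (p i) = r i" for i
    unfolding p_def using e r_less[of i] by (intro f_inv_into_f) (auto simp: bij_betw_def)
  have "inj p"
  proof (rule injI)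
    fix a b assume "p a = p b"
    then have "r a = r b" using ep by metis
    then show "a = b" using \<open>inj r\<close> by (simp add: inj_def)
  qed
  then have "bij p" using finite_UNIV_inj_surj[of p] by (simp add: bij_def)
  then have p: "p permutes UNIV" by (intro bij_imp_permutes) auto
  define m where "m = f \<circ> inv p"
  have "m \<in> strict_columns e K"
  proof -
    have "m c' < m c" if "e c < e c'" for c c'
    proof -
      obtain a b where ab: "c = p a" "c' = p b" using permutes_surj[OF p] by blast
      have "r a < r b" using that by (simp add: ab ep)
      then have "f a \<noteq> f b" using f(1) by (auto simp: inj_def)
      moreover have "\<not> f a < f b" using r_mono less_asym[OF \<open>r a < r b\<close>] by blast
      ultimately have "f a \<noteq> f b" "\<not> f a < f b" by simp_all
      then have "f b < f a" by simp
      then show ?thesis by (simp add: m_def ab permutes_inverses(2)[OF p])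
    qed
    then show ?thesis using f(2) by (simp add: strict_columns_def[OF e] m_def)
  qed
  moreover have "m \<circ> p = f" by (simp add: m_def fun_eq_iff permutes_inverses(2)[OF p])
  ultimately show "\<exists>x\<in>strict_columns e K \<times> {p. p permutes (UNIV :: 'n set)}. f = (case x of (m, p) \<Rightarrow> m \<circ> p)"
    using p by (intro bexI[of _ "(m, p)"]) auto
qed

lemma finite_strict_columns: "finite (strict_columns e K)"
proof (rule finite_subset)
  show "strict_columns e K \<subseteq> {f. \<forall>i. f i \<in> {..<K}}" by (auto simp: strict_columns_def[OF e])
  show "finite {f :: 'n \<Rightarrow> nat. \<forall>i. f i \<in> {..<K}}"
    using finite_PiE[of "UNIV :: 'n set" "\<lambda>_. {..<K}"] by (simp add: PiE_UNIV_domain Pi_def)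
qed

text \<open>Expanding each row gives a sum over functions \<open>f\<close>. Those that repeat a
  value select equal rows of \<open>b\<close> and vanish; the injective ones are grouped by their
  sets of values.\<close>

lemma cauchy_binet:
  fixes c :: "'n \<Rightarrow> nat \<Rightarrow> complex" and b :: "nat \<Rightarrow> 'n \<Rightarrow> complex"
  shows "det (\<chi> i j. \<Sum>m<K. c i m * b m j) =
    (\<Sum>m\<in>strict_columns e K. det (\<chi> i j. c i (m j)) * det (\<chi> i j. b (m i) j))"
proof -
  define G where "G f = (\<Prod>i\<in>UNIV. c i (f i)) * det (\<chi> i j. b (f i) j)" for f :: "'n \<Rightarrow> nat"
  have fin: "finite {f :: 'n \<Rightarrow> nat. \<forall>i. f i \<in> {..<K}}"
    using finite_PiE[of "UNIV :: 'n set" "\<lambda>_. {..<K}"] by (simp add: PiE_UNIV_domain Pi_def)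
  have "det (\<chi> i j. \<Sum>m<K. c i m * b m j) =
     (\<Sum>p | p permutes (UNIV :: 'n set). of_int (sign p) * (\<Sum>f\<in>PiE UNIV (\<lambda>_. {..<K}). \<Prod>i\<in>UNIV. c i (f i) * b (f i) (p i)))"
    unfolding det_def vec_lambda_beta by (subst prod_sum_PiE) auto
  also have "\<dots> = (\<Sum>p | p permutes (UNIV :: 'n set). \<Sum>f | \<forall>i. f i \<in> {..<K}. of_int (sign p) * ((\<Prod>i\<in>UNIV. c i (f i)) * (\<Prod>i\<in>UNIV. b (f i) (p i))))"
    by (simp add: sum_distrib_left prod.distrib PiE_UNIV_domain Pi_def)
  also have "\<dots> = (\<Sum>f | \<forall>i. f i \<in> {..<K}. \<Sum>p | p permutes (UNIV :: 'n set). of_int (sign p) * ((\<Prod>i\<in>UNIV. c i (f i)) * (\<Prod>i\<in>UNIV. b (f i) (p i))))"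
    by (rule sum.swap)
  also have "\<dots> = (\<Sum>f | \<forall>i. f i \<in> {..<K}. G f)"
    by (simp add: G_def det_def sum_distrib_left mult_ac)
  also have "\<dots> = (\<Sum>f | inj f \<and> (\<forall>i. f i < K). G f)"
  proof (rule sum.mono_neutral_right[OF fin])
    show "\<forall>f\<in>{f. \<forall>i. f i \<in> {..<K}} - {f. inj f \<and> (\<forall>i. f i < K)}. G f = 0"
    proof
      fix f :: "'n \<Rightarrow> nat" assume "f \<in> {f. \<forall>i. f i \<in> {..<K}} - {f. inj f \<and> (\<forall>i. f i < K)}"
      then have "\<not> inj f" by auto
      then obtain i i' where "i \<noteq> i'" "f i = f i'" by (auto simp: inj_def)
      then have "det (\<chi> i j. b (f i) j) = 0"
        by (intro det_identical_rows[of i i']) (auto simp: row_def)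
      then show "G f = 0" by (simp add: G_def)
    qed
  qed auto
  also have "\<dots> = (\<Sum>(m, p)\<in>strict_columns e K \<times> {p. p permutes (UNIV :: 'n set)}. G (m \<circ> p))"
    using sum.reindex_bij_betw[OF strict_columns_permutations_bij[of K], of G] by (simp add: case_prod_beta)
  also have "\<dots> = (\<Sum>m\<in>strict_columns e K. \<Sum>p | p permutes UNIV. G (m \<circ> p))"
    by (rule sum.cartesian_product[symmetric])
  also have "\<dots> = (\<Sum>m\<in>strict_columns e K. det (\<chi> i j. c i (m j)) * det (\<chi> i j. b (m i) j))"
  proof (rule sum.cong[OF refl])
    fix m
    have "G (m \<circ> p) = of_int (sign p) * (\<Prod>i\<in>UNIV. c i (m (p i))) * det (\<chi> i j. b (m i) j)"
      if "p permutes UNIV" for p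
      using det_permute_rows[OF that, of "\<chi> i j. b (m i) j"] by (simp add: G_def)
    then show "(\<Sum>p | p permutes UNIV. G (m \<circ> p)) = det (\<chi> i j. c i (m j)) * det (\<chi> i j. b (m i) j)"
      by (simp add: det_def sum_distrib_right)
  qed
  finally show ?thesis .
qed

end

section \<open>Evaluation of the minors as Vandermonde determinants\<close>

definition falling_poly :: "nat \<Rightarrow> complex poly" where
  "falling_poly a = (\<Prod>i<a. [:- of_nat i, 1:])"

lemma degree_falling_poly [simp]: "degree (falling_poly a) = a"
  unfolding falling_poly_def by (subst degree_prod_eq_sum_degree) auto

lemma lead_coeff_falling_poly: "lead_coeff (falling_poly a) = 1"
  unfolding falling_poly_def lead_coeff_prod by simp

lemma poly_falling_poly: "poly (falling_poly a) (of_nat n) = (if a \<le> n then fact n / fact (n - a) else 0)"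
proof (cases "a \<le> n")
  case True
  have "poly (falling_poly a) (of_nat n) = of_real (\<Prod>i<a. real n - real i)"
    by (simp add: falling_poly_def poly_prod)
  also have "\<dots> = of_real (fact n / fact (n - a))" using prod_falling[OF True] by simp
  finally show ?thesis using True by simp
next
  case False
  then have "(\<Prod>i<a. of_nat n - of_nat i :: complex) = 0"
    by (intro prod_zero bexI[of _ n]) auto
  then show ?thesis using False by (simp add: falling_poly_def poly_prod)
qed

lemma fps_one_minus_X_power_nth: "fps_nth ((1 - fps_X) ^ M :: complex fps) r = (-1) ^ r * of_nat (M choose r)"
proof -
  have "(1 - fps_X) ^ M = (fps_of_poly ([:1, -1:] ^ M) :: complex fps)"
    by (simp add: fps_of_poly_power fps_of_poly_pCons fps_const_neg[symmetric] del: fps_const_neg)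
  then show ?thesis
    by (simp only: fps_of_poly_nth) (cases "r \<le> M", simp_all add: coeff_linear_poly_power coeff_eq_0 degree_linear_power)
qed


lemma C_coeff_0 [simp]: "C_coeff N 0 k = 1"
proof -
  have "partitions k 0 = {[]}"
  proof -
    have "la = []" if "la \<in> partitions k 0" for la
      using that by (cases la) (auto simp: partitions_def)
    then show ?thesis by (auto simp: partitions_def)
  qed
  then show ?thesis by (simp add: C_coeff_def gen_pochhammer_def hook_product_def)
qed

text \<open>If the diagram is wider than N, its first row contains the box in column N, counted from
  0, with factor -N + N = 0.\<close>

lemma gen_pochhammer_neg_eq_0:
  assumes "la \<in> partitions k p" "la \<notin> box_partitions k N"
  shows "gen_pochhammer (- real N) la = 0"
proof -
  obtain x where x: "x \<in> set la" "N < x" using assms by (auto simp: partitions_def box_partitions_def not_le)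
  then obtain i where i: "i < length la" "la ! i = x" by (auto simp: in_set_conv_nth)
  have "la ! i \<le> la ! 0"
    using assms(1) i(1) by (cases "i = 0") (auto simp: partitions_def sorted_wrt_iff_nth_less)
  then have N: "N < la ! 0" using i x by simp
  have z: "(\<Prod>j<la ! 0. - real N + real j - real 0) = 0"
    using N by (intro prod_zero bexI[of _ N]) auto
  have "\<exists>i\<in>{..<length la}. (\<Prod>j<la ! i. - real N + real j - real i) = 0"
    by (rule bexI[of _ 0]) (rule z, use i(1) in auto)
  then show ?thesis unfolding gen_pochhammer_def by (intro prod_zero) simp_all
qed

context
  fixes e :: "'n::finite \<Rightarrow> nat" and N :: nat
  assumes e: "bij_betw e UNIV {..<N}"
begin

lemma sum_e_reverse: "(\<Sum>c\<in>UNIV. N - 1 - e c) = (\<Sum>c\<in>UNIV. e c)"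
  using sum.reindex_bij_betw[OF e, of "\<lambda>i. N - 1 - i"] sum.reindex_bij_betw[OF e, of "\<lambda>i. i"]
    sum.nat_diff_reindex[of "\<lambda>i. i" N] by simp

lemma bij_e: "bij_betw e UNIV {..<CARD('n)}"
  using e card_UNIV_eq[OF e] by simp

text \<open>All nonzero Leibniz terms carry the same power of s. Writing 1/(m-a)! as a falling
  factorial of m divided by m! leaves monic polynomials in m, hence a Vandermonde
  determinant.\<close>

lemma det_exp_weight:
  "det (\<chi> i j. exp_weight s (e i) (m j)) =
    s ^ ((\<Sum>c\<in>UNIV. m c) - (\<Sum>c\<in>UNIV. e c)) * (\<Prod>c\<in>UNIV. 1 / fact (m c)) * det (\<chi> i j. of_nat (m i) ^ e j)"
proof -
  let ?w = "\<lambda>a n. if a \<le> n then 1 / fact (n - a) else 0 :: complex"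
  let ?d = "(\<Sum>c\<in>UNIV. m c) - (\<Sum>c\<in>UNIV. e c)"
  have "(\<Prod>i\<in>UNIV. exp_weight s (e i) (m (p i))) = s ^ ?d * (\<Prod>i\<in>UNIV. ?w (e i) (m (p i)))"
    if p: "p permutes UNIV" for p
  proof (cases "\<forall>i. e i \<le> m (p i)")
    case True
    have "(\<Prod>i\<in>UNIV. s ^ (m (p i) - e i)) = s ^ (\<Sum>i\<in>UNIV. m (p i) - e i)" by (simp add: power_sum)
    also have "(\<Sum>i\<in>UNIV. m (p i) - e i) = (\<Sum>i\<in>UNIV. m (p i)) - (\<Sum>i\<in>UNIV. e i)"
      using True by (intro sum_subtractf_nat) auto
    also have "(\<Sum>i\<in>UNIV. m (p i)) = (\<Sum>i\<in>UNIV. m i)" using sum.permute[OF p, of m] by (simp add: comp_def)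
    finally have "(\<Prod>i\<in>UNIV. s ^ (m (p i) - e i)) = s ^ ?d" .
    then show ?thesis using True by (simp add: exp_weight_def prod_dividef)
  next
    case False
    then obtain i where "\<not> e i \<le> m (p i)" by auto
    then have z: "(\<Prod>i\<in>UNIV. exp_weight s (e i) (m (p i))) = 0" "(\<Prod>i\<in>UNIV. ?w (e i) (m (p i))) = 0"
      by (intro prod_zero bexI[of _ i]; simp add: exp_weight_def)+
    show ?thesis unfolding z by simp
  qed
  then have "det (\<chi> i j. exp_weight s (e i) (m j)) = s ^ ?d * det (\<chi> i j. ?w (e i) (m j))"
    unfolding det_def sum_distrib_left by (intro sum.cong) (auto simp: mult_ac)
  also have "(\<chi> i j. ?w (e i) (m j)) = (\<chi> i j. 1 / fact (m j) * poly (falling_poly (e i)) (of_nat (m j)))"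
    by (simp add: vec_eq_iff poly_falling_poly)
  also have "det \<dots> = (\<Prod>c\<in>UNIV. 1 / fact (m c)) * det (\<chi> i j. poly (falling_poly (e i)) (of_nat (m j)))"
    by (rule det_scale_columns)
  also have "det (\<chi> i j. poly (falling_poly (e i)) (of_nat (m j))) = det (\<chi> i j. poly (falling_poly (e j)) (of_nat (m i)))"
  proof -
    have "(\<chi> i j. poly (falling_poly (e i)) (of_nat (m j))) = transpose (\<chi> i j. poly (falling_poly (e j)) (of_nat (m i)))"
      by (simp add: transpose_def)
    then show ?thesis by (simp only: det_transpose)
  qed
  also have "\<dots> = det (\<chi> i j. of_nat (m i) ^ e j) * det (\<chi> i j. coeff (falling_poly (e i)) (e j))"
    by (rule det_poly_rows[OF bij_e]) (use e_less[OF e] card_UNIV_eq[OF e] in simp)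
  also have "det (\<chi> i j. coeff (falling_poly (e i)) (e j)) = 1"
    by (rule det_monic_coefficients[OF inj_e[OF e]]) (simp_all add: lead_coeff_falling_poly[simplified])
  finally show ?thesis by simp
qed

text \<open>As a polynomial in n this is (k+N-1-n)!/(k+b-n)!, the part of
  \<open>power_weight\<close> in which row and column are not separated.\<close>

definition column_poly :: "nat \<Rightarrow> nat \<Rightarrow> complex poly" where
  "column_poly k b = pcompose (falling_poly (N - 1 - b)) [:of_nat (k + N - 1), -1:]"

definition point_weight :: "nat \<Rightarrow> nat \<Rightarrow> complex" where
  "point_weight k n = (-1) ^ n * fact (2 * k + N - 1 - n) / fact (k + N - 1 - n)"

text \<open>The binomial (2k+N-1-n choose k+b-n) splits into a factor in b, a factor in n and a
  polynomial in n of degree N-1-b. For n > k + b the falling factorial vanishes by itself.\<close>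

lemma power_weight_eq:
  assumes b: "b < N" and n: "n < k + N"
  shows "power_weight k N n b = (-1) ^ (k + b) / fact (k + N - 1 - b) * (point_weight k n * poly (column_poly k b) (of_nat n))"
proof -
  have "poly (column_poly k b) (of_nat n) = poly (falling_poly (N - 1 - b)) (of_nat (k + N - 1 - n))"
    using n by (simp add: column_poly_def poly_pcompose of_nat_diff algebra_simps)
  also have "\<dots> = (if n \<le> k + b then fact (k + N - 1 - n) / fact (k + b - n) else 0)"
  proof -
    have "N - 1 - b \<le> k + N - 1 - n \<longleftrightarrow> n \<le> k + b" using b n by linarith
    moreover have "k + N - 1 - n - (N - 1 - b) = k + b - n" using b n by linarith
    ultimately show ?thesis unfolding poly_falling_poly by simp
  qed
  finally have 1: "poly (column_poly k b) (of_nat n) = (if n \<le> k + b then fact (k + N - 1 - n) / fact (k + b - n) else 0)" .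
  show ?thesis
  proof (cases "n \<le> k + b")
    case True
    have "2 * k + N - 1 - n - (k + b - n) = k + N - 1 - b" using True b by simp
    moreover have "k + b - n \<le> 2 * k + N - 1 - n" using b by simp
    ultimately have bin: "of_nat ((2 * k + N - 1 - n) choose (k + b - n)) =
        (fact (2 * k + N - 1 - n) / (fact (k + b - n) * fact (k + N - 1 - b)) :: complex)"
      by (simp add: binomial_fact)
    have sgn: "(-1) ^ (k + b - n) = ((-1) ^ (k + b) * (-1) ^ n :: complex)"
    proof -
      have "(-1) ^ (k + b) = ((-1) ^ (k + b - n) * (-1) ^ n :: complex)"
        using True by (simp add: power_add[symmetric])
      moreover have "(-1) ^ n * (-1) ^ n = (1 :: complex)" by (simp add: power_mult_distrib[symmetric])
      ultimately show ?thesis by (simp add: mult.assoc)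
    qed
    show ?thesis unfolding power_weight_def fps_one_minus_X_power_nth bin sgn 1 point_weight_def
      using True by (simp add: field_simps)
  qed (simp add: power_weight_def 1)
qed

lemma det_power_weight:
  assumes m: "m \<in> strict_columns e (k + N)"
  shows "det (\<chi> i j. power_weight k N (m i) (e j)) =
    (\<Prod>c\<in>UNIV. (-1) ^ (k + e c) / fact (k + N - 1 - e c)) * (\<Prod>c\<in>UNIV. point_weight k (m c)) *
    det (\<chi> i j. of_nat (m i) ^ e j) * det (\<chi> i j. coeff (column_poly k (e i)) (e j))"
proof -
  have mk: "m c < k + N" for c using m by (simp add: strict_columns_def[OF e])
  have "det (\<chi> i j. power_weight k N (m i) (e j)) =
    det (\<chi> i j. ((-1) ^ (k + e j) / fact (k + N - 1 - e j)) * (point_weight k (m i) * poly (column_poly k (e j)) (of_nat (m i))))"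
    by (simp only: power_weight_eq[OF e_less[OF e] mk])
  also have "\<dots> = (\<Prod>c\<in>UNIV. (-1) ^ (k + e c) / fact (k + N - 1 - e c)) *
     det (\<chi> i j. point_weight k (m i) * poly (column_poly k (e j)) (of_nat (m i)))"
    by (rule det_scale_columns)
  also have "(\<chi> i j. point_weight k (m i) * poly (column_poly k (e j)) (of_nat (m i))) =
     (\<chi> i. point_weight k (m i) *s (\<chi> j. poly (column_poly k (e j)) (of_nat (m i))))"
    by (simp add: vec_eq_iff)
  also have "det \<dots> = (\<Prod>c\<in>UNIV. point_weight k (m c)) * det (\<chi> i j. poly (column_poly k (e j)) (of_nat (m i)))"
    by (rule det_rows_mul)
  also have "det (\<chi> i j. poly (column_poly k (e j)) (of_nat (m i))) =
     det (\<chi> i j. of_nat (m i) ^ e j) * det (\<chi> i j. coeff (column_poly k (e i)) (e j))"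
  proof (rule det_poly_rows[OF bij_e])
    fix j
    have "degree (column_poly k (e j)) \<le> degree (falling_poly (N - 1 - e j)) * degree [:of_nat (k + N - 1), -1 :: complex:]"
      unfolding column_poly_def by (rule degree_pcompose_le)
    also have "\<dots> = N - 1 - e j" by simp
    also have "\<dots> < CARD('n)" using e_less[OF e, of j] card_UNIV_eq[OF e] by simp
    finally show "degree (column_poly k (e j)) < CARD('n)" .
  qed
  finally show ?thesis by (simp add: mult_ac)
qed

text \<open>Each of the two minors contributes one Vandermonde determinant in the shifted column
  lengths. Squaring removes the orientation of the pairs, and \<open>hook_product_columns\<close>
  evaluates the result.\<close>

lemma vandermonde_square:
  assumes la: "la \<in> box_partitions k N"
  shows "(det (\<chi> i j. of_nat (shifted_column e N la i) ^ e j))\<^sup>2 * (of_nat (hook_product la))\<^sup>2 =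
    ((\<Prod>c\<in>UNIV. fact (shifted_column e N la c))\<^sup>2 :: complex)"
proof -
  let ?m = "shifted_column e N la"
  define W where "W = (\<Prod>c\<in>UNIV. \<Prod>c' | e c < e c'. (of_nat (?m c) - of_nat (?m c') :: complex))"
  have "det (\<chi> i j. (of_nat (?m i) ^ e j :: complex)) = (\<Prod>i\<in>UNIV. \<Prod>i' | e i' < e i. of_nat (?m i) - of_nat (?m i'))"
    by (rule det_vandermonde[OF bij_e])
  then have "(det (\<chi> i j. of_nat (?m i) ^ e j))\<^sup>2 = (\<Prod>i\<in>UNIV. \<Prod>i' | e i' < e i. (of_nat (?m i) - of_nat (?m i') :: complex)\<^sup>2)"
    by (simp add: prod_power_distrib)
  also have "\<dots> = (\<Prod>i\<in>UNIV. \<Prod>i'\<in>UNIV. if e i' < e i then (of_nat (?m i') - of_nat (?m i) :: complex)\<^sup>2 else 1)"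
    by (rule prod.cong[OF refl]) (simp add: prod.If_cases power2_commute)
  also have "\<dots> = (\<Prod>i'\<in>UNIV. \<Prod>i\<in>UNIV. if e i' < e i then (of_nat (?m i') - of_nat (?m i) :: complex)\<^sup>2 else 1)"
    by (rule prod.swap)
  also have "\<dots> = (\<Prod>i'\<in>UNIV. \<Prod>i | e i' < e i. (of_nat (?m i') - of_nat (?m i) :: complex)\<^sup>2)"
    by (rule prod.cong[OF refl]) (simp add: prod.If_cases)
  also have "\<dots> = W\<^sup>2" by (simp add: W_def prod_power_distrib)
  finally have V: "(det (\<chi> i j. of_nat (?m i) ^ e j))\<^sup>2 = W\<^sup>2" .
  have "W = of_nat (\<Prod>c\<in>UNIV. \<Prod>c' | e c < e c'. ?m c - ?m c')"
  proof -
    have "(\<Prod>c' | e c < e c'. (of_nat (?m c) - of_nat (?m c') :: complex)) = (\<Prod>c' | e c < e c'. of_nat (?m c - ?m c'))" for c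
      using shifted_column_less[OF e, of c _ la] by (intro prod.cong refl) (simp add: of_nat_diff less_imp_le)
    then show ?thesis by (simp add: W_def)
  qed
  then have "of_nat (hook_product la) * W = of_nat (\<Prod>c\<in>UNIV. fact (?m c))"
    unfolding hook_product_columns[OF e la, symmetric] of_nat_mult by simp
  then have "of_nat (hook_product la) * W = (\<Prod>c\<in>UNIV. fact (?m c) :: complex)" by simp
  then have "(W * of_nat (hook_product la))\<^sup>2 = (\<Prod>c\<in>UNIV. fact (?m c) :: complex)\<^sup>2" by (simp add: mult.commute)
  then show ?thesis unfolding V power_mult_distrib .
qed

lemma hook_product_pos: "la \<in> box_partitions k N \<Longrightarrow> 0 < hook_product la"
  by (simp add: hook_product_def hook_length_def prod_pos)

text \<open>Collects all factors that depend neither on the partition nor on s. Like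
  \<open>det_constant\<close>, it is eliminated at t = 0.\<close>

definition binomial_constant :: "nat \<Rightarrow> complex" where
  "binomial_constant k = (\<Prod>c\<in>UNIV. (-1) ^ (k + e c) / fact (k + N - 1 - e c)) *
     det (\<chi> i j. coeff (column_poly k (e i)) (e j)) *
     (\<Prod>c\<in>UNIV. (-1) ^ (N - 1 - e c) * fact (N - 1 - e c) * fact (2 * k + e c) / fact (k + e c))"

text \<open>The two Vandermonde determinants give M^2/H^2, with M the product of the factorials of
  the shifted column lengths and H the hook product. The 1/M of the exponential minor leaves one M,
  which combines with the point weights into the three Pochhammer symbols.\<close>

lemma det_weights_eq:
  assumes la: "la \<in> box_partitions k N"
  defines "m \<equiv> shifted_column e N la"
  shows "det (\<chi> i j. exp_weight s (e i) (m j)) * det (\<chi> i j. power_weight k N (m i) (e j)) =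
    binomial_constant k * (s ^ sum_list la * of_real (gen_pochhammer (real k) la * gen_pochhammer (- real N) la /
        (gen_pochhammer (2 * real k) la * (real (hook_product la))\<^sup>2)))"
proof (cases "N = 0")
  case True
  then show ?thesis using e_less[OF e] by simp
next
  case False
  have mS: "m \<in> strict_columns e (k + N)"
    using shifted_column_bij[OF e, of k] False la by (auto simp: bij_betw_def m_def)
  have exponent: "(\<Sum>c\<in>UNIV. m c) - (\<Sum>c\<in>UNIV. e c) = sum_list la"
    using sum_column_length[OF e la] sum_e_reverse by (simp add: m_def shifted_column_def[OF e] sum.distrib)
  define V where "V = det (\<chi> i j. (of_nat (m i) ^ e j :: complex))"
  define H where "H = (of_nat (hook_product la) :: complex)"
  define M where "M = (\<Prod>c\<in>UNIV. fact (m c) :: complex)"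
  define A where "A = (\<Prod>c\<in>UNIV. (-1) ^ (k + e c) / fact (k + N - 1 - e c) :: complex)"
  define R where "R = det (\<chi> i j. coeff (column_poly k (e i)) (e j))"
  define Om where "Om = (\<Prod>c\<in>UNIV. point_weight k (m c))"
  have H0: "H \<noteq> 0" using hook_product_pos[OF la] by (simp add: H_def)
  have M0: "M \<noteq> 0" by (simp add: M_def)
  have VH: "V\<^sup>2 * H\<^sup>2 = M\<^sup>2" unfolding V_def H_def M_def m_def by (rule vandermonde_square[OF la])
  have "det (\<chi> i j. exp_weight s (e i) (m j)) * det (\<chi> i j. power_weight k N (m i) (e j)) =
     s ^ sum_list la * (1 / M) * V * (A * Om * V * R)"
    unfolding det_exp_weight det_power_weight[OF mS] exponent V_def[symmetric] A_def[symmetric] R_def[symmetric] Om_def[symmetric]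
    by (simp add: M_def prod_dividef)
  also have "\<dots> = s ^ sum_list la * A * R * (Om * M) / H\<^sup>2"
  proof -
    have "V * V = M * M / (H * H)" using VH H0 by (simp add: power2_eq_square field_simps)
    moreover have "s ^ sum_list la * (1 / M) * V * (A * Om * V * R) = s ^ sum_list la * (1 / M) * (A * Om * R) * (V * V)"
      by (simp only: mult_ac)
    ultimately have "s ^ sum_list la * (1 / M) * V * (A * Om * V * R) = s ^ sum_list la * (1 / M) * (A * Om * R) * (M * M / (H * H))"
      by (simp only:)
    then show ?thesis using M0 by (simp add: power2_eq_square mult_ac)
  qed
  also have "Om * M = (\<Prod>c\<in>UNIV. (-1) ^ (N - 1 - e c) * fact (N - 1 - e c) * fact (2 * k + e c) / fact (k + e c)) *
     of_real (gen_pochhammer (real k) la * gen_pochhammer (- real N) la / gen_pochhammer (2 * real k) la)"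
  proof -
    have g2: "gen_pochhammer (2 * real k) la = (\<Prod>c\<in>UNIV. fact (2 * k + e c) / fact (2 * k + N - 1 - m c))"
      using gen_pochhammer_nat_columns[OF e la, of "2 * k"] by (simp add: m_def)
    have g1: "gen_pochhammer (real k) la = (\<Prod>c\<in>UNIV. fact (k + e c) / fact (k + N - 1 - m c))"
      using gen_pochhammer_nat_columns[OF e la, of k] by (simp add: m_def)
    have g3: "gen_pochhammer (- real N) la = (\<Prod>c\<in>UNIV. (-1) ^ column_length e la c * (fact (m c) / fact (N - 1 - e c)))"
      using gen_pochhammer_neg_columns[OF e la] by (simp add: m_def)
    have t: "point_weight k (m c) * fact (m c) =
       ((-1) ^ (N - 1 - e c) * fact (N - 1 - e c) * fact (2 * k + e c) / fact (k + e c)) *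
       of_real ((fact (k + e c) / fact (k + N - 1 - m c)) * ((-1) ^ column_length e la c * (fact (m c) / fact (N - 1 - e c))) /
          (fact (2 * k + e c) / fact (2 * k + N - 1 - m c)))" for c
    proof -
      have "(-1) ^ m c = ((-1) ^ column_length e la c * (-1) ^ (N - 1 - e c) :: complex)"
        by (simp add: m_def shifted_column_def[OF e] power_add)
      then show ?thesis by (simp add: point_weight_def field_simps)
    qed
    show ?thesis unfolding Om_def M_def g1 g2 g3 prod.distrib[symmetric] prod_dividef[symmetric] t of_real_prod ..
  qed
  finally show ?thesis
    unfolding binomial_constant_def A_def[symmetric] R_def[symmetric] H_def by (simp add: field_simps)
qed

text \<open>With s = -2t, the power s^|lambda| supplies the factor (-2)^p of \<open>C_coeff\<close>.
  Partitions in the box are grouped by size, and the wider ones are added with terms equal to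
  0.\<close>

lemma det_laguerre:
  assumes N: "0 < N"
  shows "det (\<chi> i j. fps_nth (fps_of_poly ([:0, 1:] ^ e i * [:1, -1:] ^ (N - 1 - e i)) * laguerre_fps k (- 2 * of_real t)) (k + e j)) =
    binomial_constant k * of_real (\<Sum>p\<le>k * N. C_coeff N p k * t ^ p)"
proof -
  let ?s = "- 2 * complex_of_real t"
  let ?T = "\<lambda>la. gen_pochhammer (real k) la * gen_pochhammer (- real N) la /
        (gen_pochhammer (2 * real k) la * (real (hook_product la))\<^sup>2)"
  have "det (\<chi> i j. fps_nth (fps_of_poly ([:0, 1:] ^ e i * [:1, -1:] ^ (N - 1 - e i)) * laguerre_fps k ?s) (k + e j)) =
     det (\<chi> i j. \<Sum>m<k + N. exp_weight ?s (e i) m * power_weight k N m (e j))"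
    by (simp only: laguerre_coefficient[OF e_less[OF e] e_less[OF e]])
  also have "\<dots> = (\<Sum>m\<in>strict_columns e (k + N). det (\<chi> i j. exp_weight ?s (e i) (m j)) * det (\<chi> i j. power_weight k N (m i) (e j)))"
    by (rule cauchy_binet[OF e])
  also have "\<dots> = (\<Sum>la\<in>box_partitions k N. binomial_constant k * (?s ^ sum_list la * of_real (?T la)))"
    unfolding sum.reindex_bij_betw[OF shifted_column_bij[OF e N, of k], symmetric]
    by (rule sum.cong[OF refl]) (rule det_weights_eq)
  also have "\<dots> = binomial_constant k * of_real (\<Sum>la\<in>box_partitions k N. (-2 * t) ^ sum_list la * ?T la)"
    by (simp add: sum_distrib_left)
  also have "(\<Sum>la\<in>box_partitions k N. (-2 * t) ^ sum_list la * ?T la) = (\<Sum>p\<le>k * N. C_coeff N p k * t ^ p)"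
  proof -
    have fin: "finite (box_partitions k N)"
      using shifted_column_bij[OF e N, of k] finite_strict_columns[OF e] bij_betw_finite by blast
    have le: "sum_list la \<le> k * N" if "la \<in> box_partitions k N" for la
    proof -
      have "sum_list la = (\<Sum>c\<in>UNIV. column_length e la c)" using sum_column_length[OF e that] by simp
      also have "\<dots> \<le> (\<Sum>c\<in>(UNIV::'n set). k)" by (intro sum_mono column_length_le[OF that])
      finally show ?thesis using card_UNIV_eq[OF e] by (simp add: mult.commute)
    qed
    have "(\<Sum>la\<in>box_partitions k N. (-2 * t) ^ sum_list la * ?T la) =
       (\<Sum>p\<le>k * N. \<Sum>la\<in>{la\<in>box_partitions k N. sum_list la = p}. (-2 * t) ^ sum_list la * ?T la)"
      using le by (intro sum.group[symmetric] fin) auto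
    also have "\<dots> = (\<Sum>p\<le>k * N. C_coeff N p k * t ^ p)"
    proof (rule sum.cong[OF refl])
      fix p
      have "(\<Sum>la\<in>{la\<in>box_partitions k N. sum_list la = p}. (-2 * t) ^ sum_list la * ?T la) =
        (\<Sum>la\<in>{la\<in>box_partitions k N. sum_list la = p}. (-2 * t) ^ p * ?T la)"
        by (rule sum.cong) auto
      also have "\<dots> = (\<Sum>la\<in>partitions k p. (-2 * t) ^ p * ?T la)"
      proof (rule sum.mono_neutral_left[OF finite_partitions])
        show "{la \<in> box_partitions k N. sum_list la = p} \<subseteq> partitions k p"
          by (auto simp: box_partitions_def partitions_def)
        show "\<forall>la\<in>partitions k p - {la \<in> box_partitions k N. sum_list la = p}. (-2 * t) ^ p * ?T la = 0"
        proof
          fix la assume la: "la \<in> partitions k p - {la \<in> box_partitions k N. sum_list la = p}"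
          then have "sum_list la = p" by (auto simp: partitions_def)
          then have "gen_pochhammer (- real N) la = 0" using la gen_pochhammer_neg_eq_0[of la k p N] by blast
          then show "(-2 * t) ^ p * ?T la = 0" by simp
        qed
      qed
      also have "\<dots> = (-2 * t) ^ p * (\<Sum>la\<in>partitions k p. ?T la)" by (rule sum_distrib_left[symmetric])
      also have "\<dots> = C_coeff N p k * t ^ p" by (simp only: C_coeff_def power_mult_distrib mult_ac)
      finally show "(\<Sum>la\<in>{la\<in>box_partitions k N. sum_list la = p}. (-2 * t) ^ sum_list la * ?T la) = C_coeff N p k * t ^ p" .
    qed
    finally show ?thesis .
  qed
  finally show ?thesis .
qed

end

section \<open>Absolute moments from a characteristic function\<close>

text \<open>A bound on the derivative near \<open>t\<close> bounds the difference quotients by the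
  mean value inequality, and constants are integrable for a finite measure.\<close>

lemma has_real_derivative_integral:
  fixes g g' :: "real \<Rightarrow> 'a \<Rightarrow> real"
  assumes M: "finite_measure M" and t: "t \<in> {a<..<b}"
    and deriv: "\<And>x s. x \<in> space M \<Longrightarrow> s \<in> {a<..<b} \<Longrightarrow> ((\<lambda>s. g s x) has_real_derivative g' s x) (at s)"
    and bound: "\<And>x s. x \<in> space M \<Longrightarrow> s \<in> {a<..<b} \<Longrightarrow> \<bar>g' s x\<bar> \<le> B"
    and int: "\<And>s. s \<in> {a<..<b} \<Longrightarrow> integrable M (g s)" and meas: "g' t \<in> borel_measurable M"
  shows "((\<lambda>s. \<integral>x. g s x \<partial>M) has_real_derivative (\<integral>x. g' t x \<partial>M)) (at t)"
proof -
  interpret finite_measure M by (rule M)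
  have "((\<lambda>s. ((\<integral>x. g s x \<partial>M) - (\<integral>x. g t x \<partial>M)) / (s - t)) \<longlongrightarrow> (\<integral>x. g' t x \<partial>M)) (at t within {a<..<b})"
    unfolding tendsto_at_iff_sequentially
  proof (intro allI impI)
    fix X assume X: "\<forall>i. X i \<in> {a<..<b} - {t}" and lim: "X \<longlonglongrightarrow> t"
    have "(\<lambda>n. \<integral>x. (g (X n) x - g t x) / (X n - t) \<partial>M) \<longlonglongrightarrow> (\<integral>x. g' t x \<partial>M)"
    proof (rule integral_dominated_convergence[where w = "\<lambda>_. B"])
      show "(\<lambda>x. (g (X n) x - g t x) / (X n - t)) \<in> borel_measurable M" for n
        using int[of "X n"] int[OF t] X by (intro borel_measurable_divide borel_measurable_diff) auto
      show "AE x in M. (\<lambda>n. (g (X n) x - g t x) / (X n - t)) \<longlonglongrightarrow> g' t x"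
      proof (rule AE_I2)
        fix x assume "x \<in> space M"
        then have "((\<lambda>s. (g s x - g t x) / (s - t)) \<longlongrightarrow> g' t x) (at t)"
          using deriv[OF _ t] by (simp add: has_field_derivative_iff DERIV_LIM_iff)
        moreover have "filterlim X (at t) sequentially" using X lim by (auto simp: filterlim_at)
        ultimately show "(\<lambda>n. (g (X n) x - g t x) / (X n - t)) \<longlonglongrightarrow> g' t x"
          by (rule filterlim_compose)
      qed
      show "AE x in M. norm ((g (X n) x - g t x) / (X n - t)) \<le> B" for n
      proof (rule AE_I2)
        fix x assume x: "x \<in> space M"
        have "norm (g (X n) x - g t x) \<le> B * norm (X n - t)"
        proof (rule field_differentiable_bound[where S = "{a<..<b}" and f' = "\<lambda>s. g' s x"])
          show "((\<lambda>s. g s x) has_field_derivative g' s x) (at s within {a<..<b})" if "s \<in> {a<..<b}" for s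
            using deriv[OF x that] by (rule has_field_derivative_at_within)
        qed (use X t bound[OF x] in auto)
        moreover have "X n - t \<noteq> 0" using X by auto
        ultimately show "norm ((g (X n) x - g t x) / (X n - t)) \<le> B"
          by (simp add: field_simps)
      qed
    qed (use meas in auto)
    moreover have "(\<integral>x. (g (X n) x - g t x) / (X n - t) \<partial>M) = ((\<integral>x. g (X n) x \<partial>M) - (\<integral>x. g t x \<partial>M)) / (X n - t)" for n
      using int[of "X n"] int[OF t] X by simp
    ultimately show "((\<lambda>s. ((\<integral>x. g s x \<partial>M) - (\<integral>x. g t x \<partial>M)) / (s - t)) \<circ> X) \<longlonglongrightarrow> (\<integral>x. g' t x \<partial>M)"
      by (simp only: comp_def)
  qed
  then have "((\<lambda>s. \<integral>x. g s x \<partial>M) has_real_derivative (\<integral>x. g' t x \<partial>M)) (at t within {a<..<b})"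
    by (simp add: has_field_derivative_iff)
  then show ?thesis using t by (simp add: at_within_open[of t "{a<..<b}"])
qed

text \<open>The derivative of \<open>e\<^bsup>-ct\<^esup> p(t)\<close> is \<open>e\<^bsup>-ct\<^esup>\<close> times the shifted derivative of \<open>p\<close>.\<close>

definition shifted_pderiv :: "real \<Rightarrow> real poly \<Rightarrow> real poly" where
  "shifted_pderiv c p = pderiv p - smult c p"

lemma shifted_pderiv_add: "shifted_pderiv c (p + q) = shifted_pderiv c p + shifted_pderiv c q"
  by (simp add: shifted_pderiv_def pderiv_add smult_add_right)

lemma shifted_pderiv_smult: "shifted_pderiv c (smult a p) = smult a (shifted_pderiv c p)"
  by (simp add: shifted_pderiv_def pderiv_smult smult_diff_right mult.commute)

lemma shifted_pderiv_0: "shifted_pderiv c 0 = 0"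
  by (simp add: shifted_pderiv_def)

lemma shifted_pderiv_power_add: "(shifted_pderiv c ^^ q) (p + r) = (shifted_pderiv c ^^ q) p + (shifted_pderiv c ^^ q) r"
  by (induction q) (simp_all add: shifted_pderiv_add)

lemma shifted_pderiv_power_smult: "(shifted_pderiv c ^^ q) (smult a p) = smult a ((shifted_pderiv c ^^ q) p)"
  by (induction q) (simp_all add: shifted_pderiv_smult)

lemma shifted_pderiv_power_0: "(shifted_pderiv c ^^ q) 0 = 0"
  by (induction q) (simp_all add: shifted_pderiv_0)

lemma shifted_pderiv_power_sum: "(shifted_pderiv c ^^ q) (\<Sum>i\<in>A. f i) = (\<Sum>i\<in>A. (shifted_pderiv c ^^ q) (f i))"
  by (induction A rule: infinite_finite_induct) (simp_all add: shifted_pderiv_power_0 shifted_pderiv_power_add)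

lemma degree_shifted_pderiv_power: "degree ((shifted_pderiv c ^^ q) p) \<le> degree p"
proof (induction q)
  case (Suc q)
  have "degree (shifted_pderiv c r) \<le> degree r" for r
    unfolding shifted_pderiv_def
    by (rule order_trans[OF degree_diff_le_max]) (auto simp: degree_pderiv degree_smult_le)
  then show ?case using Suc by (metis comp_apply funpow.simps(2) order_trans)
qed simp

lemma exp_poly_has_derivative:
  "((\<lambda>t. exp (- (c * t)) * poly p t) has_real_derivative exp (- (c * t)) * poly (shifted_pderiv c p) t) (at t)"
  by (auto intro!: derivative_eq_intros simp: shifted_pderiv_def algebra_simps)

lemma smult_sum_right: "smult a (\<Sum>i\<in>A. f i) = (\<Sum>i\<in>A. smult a (f i))"
  by (induction A rule: infinite_finite_induct) (simp_all add: smult_add_right)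

lemma pderiv_sum_eq: "pderiv (\<Sum>i\<in>A. f i) = (\<Sum>i\<in>A. pderiv (f i))"
  by (induction A rule: infinite_finite_induct) (simp_all add: pderiv_add)

text \<open>S is the sum of R^(i)/c^(i+1), so exp(-ct) S(t) is, for c > 0, the integral of exp(-cs)
  R(s) from t to infinity, and S(0) is the Laplace transform of R at c.\<close>

lemma exp_poly_antiderivative:
  assumes c: "c \<noteq> 0" and d: "degree R \<le> d"
  obtains S where "shifted_pderiv c S = - R" "poly S 0 = (\<Sum>i\<le>d. coeff R i * fact i / c ^ Suc i)"
proof -
  define S where "S = (\<Sum>i\<le>d. smult (1 / c ^ Suc i) ((pderiv ^^ i) R))"
  have "(pderiv ^^ Suc d) R = 0"
    using d by (intro poly_eqI) (simp only: coeff_higher_pderiv, simp add: coeff_eq_0)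
  moreover have "smult c S - pderiv S = (\<Sum>i\<le>d. smult (1 / c ^ i) ((pderiv ^^ i) R) - smult (1 / c ^ Suc i) ((pderiv ^^ Suc i) R))"
    using c by (simp add: S_def sum_subtractf smult_sum_right pderiv_sum_eq pderiv_smult)
  moreover have "(\<Sum>i\<le>d. smult (1 / c ^ i) ((pderiv ^^ i) R) - smult (1 / c ^ Suc i) ((pderiv ^^ Suc i) R)) =
      smult (1 / c ^ 0) ((pderiv ^^ 0) R) - smult (1 / c ^ Suc d) ((pderiv ^^ Suc d) R)"
    using sum_telescope[of "\<lambda>i. smult (1 / c ^ i) ((pderiv ^^ i) R)" d] by simp
  ultimately have "smult c S - pderiv S = R" by simp
  then have 1: "shifted_pderiv c S = - R" unfolding shifted_pderiv_def by (metis minus_diff_eq)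
  have "poly ((pderiv ^^ i) R) 0 = coeff R i * fact i" for i
    by (simp add: poly_0_coeff_0 coeff_higher_pderiv pochhammer_fact)
  then have "poly S 0 = (\<Sum>i\<le>d. coeff R i * fact i / c ^ Suc i)"
    by (simp add: S_def poly_sum)
  with 1 show ?thesis by (rule that)
qed

lemma exp_poly_tendsto_0:
  fixes c :: real
  assumes "c \<ge> 1"
  shows "((\<lambda>t. exp (- (c * t)) * poly p t) \<longlongrightarrow> 0) at_top"
proof -
  have "((\<lambda>t. exp (- (c * t)) * t ^ i) \<longlongrightarrow> 0) at_top" for i
  proof (rule Lim_null_comparison[OF _ tendsto_power_div_exp_0[of i]])
    show "\<forall>\<^sub>F t in at_top. norm (exp (- (c * t)) * t ^ i) \<le> t ^ i / exp t"
      using eventually_ge_at_top[of 0]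
    proof eventually_elim
      case (elim t)
      have "exp (- (c * t)) \<le> exp (- t)" using elim assms by (simp add: mult_le_cancel_right1)
      then have "exp (- (c * t)) * t ^ i \<le> exp (- t) * t ^ i" using elim by (intro mult_right_mono) auto
      then show ?case using elim by (simp add: exp_minus field_simps abs_mult)
    qed
  qed
  then have "((\<lambda>t. \<Sum>i\<le>degree p. coeff p i * (exp (- (c * t)) * t ^ i)) \<longlongrightarrow> (\<Sum>i\<le>degree p. coeff p i * 0)) at_top"
    by (intro tendsto_intros)
  then show ?thesis by (simp add: poly_altdef sum_distrib_left mult_ac)
qed

lemma Si_0 [simp]: "Si 0 = 0"
  by (simp add: Si_alt_def zero_ereal_def[symmetric])

lemma Si_abs: "Si x = sgn x * Si \<bar>x\<bar>"
  using Si_neg[of "- x"] by (cases "x \<ge> 0") (auto simp: sgn_if)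

text \<open>The integral of w X^q Si(tX), with q = 2m-1 odd, goes from 0 at t = 0 to pi/2 times the
  wanted moment at infinity. Its derivative is the integral of w X^q sin(tX)/t, known from the q-th
  derivative of the characteristic function.\<close>

lemma absolute_odd_moment:
  fixes w X :: "'a \<Rightarrow> real"
  assumes M: "finite_measure M" and [measurable]: "w \<in> borel_measurable M" "X \<in> borel_measurable M"
    and B: "\<And>x j. x \<in> space M \<Longrightarrow> j \<le> 2 * m - 1 \<Longrightarrow> \<bar>w x * X x ^ j\<bar> \<le> B"
    and m: "1 \<le> m" and c: "1 \<le> c" and deg: "degree P \<le> d"
    and char: "\<And>t. 0 \<le> t \<Longrightarrow> (\<integral>x. w x * cos (t * X x) \<partial>M) = a * (exp (- (c * t)) * poly P t)"
  shows "(\<integral>x. w x * \<bar>X x\<bar> ^ (2 * m - 1) \<partial>M) =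
    2 * (-1) ^ m / pi * a * (\<Sum>j=1..d. coeff ((shifted_pderiv c ^^ (2 * m - 1)) P) j * fact (j - 1) / c ^ j)"
proof -
  interpret finite_measure M by (rule M)
  define q where "q = 2 * m - 1"
  \<comment> \<open>The j-th derivative of cos(tX) is X^j cos(tX + j pi/2), which treats all orders
    uniformly.\<close>
  define f where "f j t = (\<integral>x. w x * X x ^ j * cos (t * X x + real j * (pi / 2)) \<partial>M)" for j t
  define Q where "Q = (shifted_pderiv c ^^ q) P"
  have Bq: "\<bar>w x * X x ^ j\<bar> \<le> B" if "x \<in> space M" "j \<le> q" for x j using B that by (simp add: q_def)
  have bd: "\<bar>w x * X x ^ j * y\<bar> \<le> B" if "x \<in> space M" "j \<le> q" "\<bar>y\<bar> \<le> 1" for x j y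
  proof -
    have "\<bar>w x * X x ^ j * y\<bar> = \<bar>w x * X x ^ j\<bar> * \<bar>y\<bar>" by (rule abs_mult)
    also have "\<dots> \<le> \<bar>w x * X x ^ j\<bar> * 1" using that by (intro mult_left_mono) auto
    finally show ?thesis using Bq[OF that(1,2)] by simp
  qed
  have int: "integrable M (\<lambda>x. w x * X x ^ j * y x)" if "j \<le> q" "y \<in> borel_measurable M" "\<And>x. \<bar>y x\<bar> \<le> 1" for j y
    by (rule integrable_const_bound[where B = B])
       (use that bd in \<open>auto intro!: AE_I2\<close>)
  have f_deriv: "(f j has_real_derivative f (Suc j) t) (at t)" if j: "j < q" for j t
    unfolding f_def
  proof (rule has_real_derivative_integral[OF M, of t "t - 1" "t + 1" _ _ B])
    fix x s assume x: "x \<in> space M"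
    show "((\<lambda>s. w x * X x ^ j * cos (s * X x + real j * (pi / 2))) has_real_derivative
       w x * X x ^ Suc j * cos (s * X x + real (Suc j) * (pi / 2))) (at s)"
    proof -
      have "cos (s * X x + real (Suc j) * (pi / 2)) = - sin (s * X x + real j * (pi / 2))"
        by (simp add: algebra_simps cos_add sin_add add_divide_distrib)
      then show ?thesis by (auto intro!: derivative_eq_intros)
    qed
    show "\<bar>w x * X x ^ Suc j * cos (s * X x + real (Suc j) * (pi / 2))\<bar> \<le> B"
      by (rule bd[OF x]) (use j in auto)
  next
    fix s show "integrable M (\<lambda>x. w x * X x ^ j * cos (s * X x + real j * (pi / 2)))"
      by (rule int) (use j in auto)
  qed auto
  \<comment> \<open>Restricted to t > 0, since \<open>char\<close> is known for t >= 0 only and the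
    derivatives are two-sided.\<close>
  have f_eq: "f j t = a * (exp (- (c * t)) * poly ((shifted_pderiv c ^^ j) P) t)" if "j \<le> q" "t > 0" for j t
    using that
  proof (induction j arbitrary: t)
    case 0
    then show ?case using char[of t] by (simp add: f_def)
  next
    case (Suc j)
    have "((\<lambda>t. a * (exp (- (c * t)) * poly ((shifted_pderiv c ^^ j) P) t)) has_real_derivative
       a * (exp (- (c * t)) * poly (shifted_pderiv c ((shifted_pderiv c ^^ j) P)) t)) (at t)"
      by (intro DERIV_cmult exp_poly_has_derivative)
    moreover have "((\<lambda>t. a * (exp (- (c * t)) * poly ((shifted_pderiv c ^^ j) P) t)) has_real_derivative f (Suc j) t) (at t)"
    proof (rule has_field_derivative_transform_within_open)
      show "(f j has_real_derivative f (Suc j) t) (at t)" using Suc by (intro f_deriv) simp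
      show "open {0::real<..}" "t \<in> {0<..}" using Suc by auto
      show "f j s = a * (exp (- (c * s)) * poly ((shifted_pderiv c ^^ j) P) s)" if "s \<in> {0<..}" for s
        using Suc that by simp
    qed
    ultimately show ?case using DERIV_unique by fastforce
  qed
  have sin_q: "(\<integral>x. w x * X x ^ q * sin (t * X x) \<partial>M) = (-1) ^ m * a * (exp (- (c * t)) * poly Q t)" if "t > 0" for t
  proof -
    \<comment> \<open>2m-1 quarter turns are m half turns less one quarter turn.\<close>
    have "cos (y + real q * (pi / 2)) = (-1) ^ m * sin y" for y
    proof -
      have "real q * (pi / 2) = real m * pi - pi / 2" using m by (simp add: q_def of_nat_diff field_simps)
      then have "cos (y + real q * (pi / 2)) = cos (y + real m * pi - pi / 2)" by (simp only: add_diff_eq)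
      also have "\<dots> = sin (y + real m * pi)" by (simp add: cos_diff)
      also have "\<dots> = (-1) ^ m * sin y" by (simp add: sin_add)
      finally show ?thesis .
    qed
    then have "f q t = (\<integral>x. (-1) ^ m * (w x * X x ^ q * sin (t * X x)) \<partial>M)"
      unfolding f_def by (intro Bochner_Integration.integral_cong refl) simp
    then have "f q t = (-1) ^ m * (\<integral>x. w x * X x ^ q * sin (t * X x) \<partial>M)" by simp
    then have "(-1) ^ m * f q t = (\<integral>x. w x * X x ^ q * sin (t * X x) \<partial>M)"
      by (simp add: mult.assoc[symmetric] power_mult_distrib[symmetric])
    then show ?thesis using f_eq[of q t] that by (simp add: Q_def mult.assoc)
  qed
  define u where "u n = inverse (real (Suc n))" for n
  have u0: "u \<longlonglongrightarrow> 0" unfolding u_def by (rule LIMSEQ_inverse_real_of_nat)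
  have u_pos: "0 < u n" for n by (simp add: u_def)
  obtain K where K: "\<And>y. \<bar>Si y\<bar> \<le> K" using bounded_Si by blast
  \<comment> \<open>The sine integral tends to 0 with t, so dividing by t leaves a polynomial. The
    factor \<open>a\<close> is kept, as it may be 0.\<close>
  have Q0: "a * poly Q 0 = 0"
  proof -
    have "(\<lambda>n. \<integral>x. w x * X x ^ q * sin (u n * X x) \<partial>M) \<longlonglongrightarrow> (\<integral>x. w x * X x ^ q * sin (0 * X x) \<partial>M)"
    proof (rule integral_dominated_convergence[where w = "\<lambda>_. B"])
      show "AE x in M. (\<lambda>n. w x * X x ^ q * sin (u n * X x)) \<longlonglongrightarrow> w x * X x ^ q * sin (0 * X x)"
        by (intro AE_I2 tendsto_mult tendsto_const tendsto_sin u0)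
      show "AE x in M. norm (w x * X x ^ q * sin (u n * X x)) \<le> B" for n
        by (rule AE_I2) (use bd in \<open>simp add: abs_sin_le_one\<close>)
    qed auto
    then have "(\<lambda>n. (-1) ^ m * a * (exp (- (c * u n)) * poly Q (u n))) \<longlonglongrightarrow> 0"
      unfolding sin_q[OF u_pos] by simp
    moreover have "(\<lambda>n. (-1) ^ m * a * (exp (- (c * u n)) * poly Q (u n))) \<longlonglongrightarrow> (-1) ^ m * a * (exp (- (c * 0)) * poly Q 0)"
      by (intro tendsto_mult tendsto_const tendsto_exp tendsto_minus tendsto_poly u0)
    ultimately have "(-1) ^ m * a * (exp (- (c * 0)) * poly Q 0) = 0" by (rule LIMSEQ_unique[rotated])
    then show ?thesis by simp
  qed
  define R where "R = smult a Q"
  have "poly R 0 = 0" using Q0 by (simp add: R_def)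
  then obtain R1 where R1: "R = pCons 0 R1" by (metis pCons_cases poly_pCons mult_zero_left add_0_right)
  have dR1: "degree R1 \<le> d"
  proof -
    have "degree R \<le> d" using degree_shifted_pderiv_power[of q c P] deg by (simp add: R_def Q_def)
    then show ?thesis unfolding R1 by (cases "R1 = 0") auto
  qed
  have c0: "c \<noteq> 0" using c by simp
  obtain S where S: "shifted_pderiv c S = - R1" "poly S 0 = (\<Sum>i\<le>d. coeff R1 i * fact i / c ^ Suc i)"
    by (rule exp_poly_antiderivative[OF c0 dR1])
  define G where "G t = (\<integral>x. w x * X x ^ q * Si (t * X x) \<partial>M)" for t
  have Gint: "integrable M (\<lambda>x. w x * X x ^ q * Si (t * X x))" for t
  proof (rule integrable_const_bound[where B = "B * K"])
    show "AE x in M. norm (w x * X x ^ q * Si (t * X x)) \<le> B * K"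
      unfolding norm_mult[of "w _ * _"] by (intro AE_I2 mult_mono) (use K Bq in \<open>auto intro: order_trans[OF abs_ge_zero]\<close>)
  qed simp
  have G_deriv: "(G has_real_derivative (-1) ^ m * (exp (- (c * t)) * poly R1 t)) (at t)" if t: "t > 0" for t
  proof -
    have "(G has_real_derivative (\<integral>x. w x * X x ^ q * (X x * sinc (t * X x)) \<partial>M)) (at t)"
      unfolding G_def
    \<comment> \<open>\<open>B\<close> controls powers of X up to q only. Rewriting X sinc(sX) as
      sin(sX)/s saves the extra factor X, at the price of staying away from s = 0.\<close>
    proof (rule has_real_derivative_integral[OF M, of t "t / 2" "2 * t" _ _ "B / (t / 2)"])
      show "t \<in> {t / 2<..<2 * t}" using t by simp
    next
      fix x s assume x: "x \<in> space M" and s: "s \<in> {t / 2<..<2 * t}"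
      show "((\<lambda>s. w x * X x ^ q * Si (s * X x)) has_real_derivative w x * X x ^ q * (X x * sinc (s * X x))) (at s)"
        by (auto intro!: derivative_eq_intros DERIV_chain2[OF DERIV_Si])
      have "X x * sinc (s * X x) = sin (s * X x) / s" using s t by auto
      then have "\<bar>w x * X x ^ q * (X x * sinc (s * X x))\<bar> = \<bar>w x * X x ^ q * sin (s * X x)\<bar> / s"
        using s t by (simp add: abs_mult)
      also have "\<dots> \<le> B / (t / 2)"
        using bd[OF x le_refl, of "sin (s * X x)"] s t by (intro frac_le) (auto simp: abs_sin_le_one intro: order_trans[OF abs_ge_zero])
      finally show "\<bar>w x * X x ^ q * (X x * sinc (s * X x))\<bar> \<le> B / (t / 2)" .
    qed (use Gint in auto)
    moreover have "(\<integral>x. w x * X x ^ q * (X x * sinc (t * X x)) \<partial>M) = (-1) ^ m * (exp (- (c * t)) * poly R1 t)"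
    proof -
      have "(\<integral>x. w x * X x ^ q * (X x * sinc (t * X x)) \<partial>M) = (\<integral>x. w x * X x ^ q * sin (t * X x) / t \<partial>M)"
        using t by (intro Bochner_Integration.integral_cong refl) auto
      also have "\<dots> = (-1) ^ m * a * (exp (- (c * t)) * poly Q t) / t"
        unfolding integral_divide_zero sin_q[OF t] ..
      also have "a * poly Q t = t * poly R1 t"
      proof -
        have "poly R t = t * poly R1 t" unfolding R1 by simp
        then show ?thesis by (simp add: R_def)
      qed
      then have "(-1) ^ m * a * (exp (- (c * t)) * poly Q t) / t = (-1) ^ m * (exp (- (c * t)) * poly R1 t)"
        using t by (simp add: field_simps)
      finally show ?thesis .
    qed
    ultimately show ?thesis by simp
  qed
  \<comment> \<open>The added term is, up to the sign (-1)^m, the tail integral of exp(-cs) R1(s)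
    from t to infinity, so \<open>H\<close> is constant; comparing t -> 0 with t -> infinity
    evaluates the Dirichlet integral.\<close>
  define H where "H t = G t + (-1) ^ m * (exp (- (c * t)) * poly S t)" for t
  have H_deriv: "(H has_real_derivative 0) (at t)" if "t > 0" for t
  proof -
    have "(H has_real_derivative (-1) ^ m * (exp (- (c * t)) * poly R1 t) + (-1) ^ m * (exp (- (c * t)) * poly (shifted_pderiv c S) t)) (at t)"
      unfolding H_def by (intro DERIV_add G_deriv that DERIV_cmult exp_poly_has_derivative)
    then show ?thesis unfolding S(1) by simp
  qed
  have H_const: "H t = H 1" if "t > 0" for t
  proof -
    have "H constant_on {0<..}"
      by (rule has_field_derivative_0_imp_constant_on) (use H_deriv in auto)
    then show ?thesis using that by (auto simp: constant_on_def)
  qed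
  have "(\<lambda>n. G (u n)) \<longlonglongrightarrow> (\<integral>x. w x * X x ^ q * Si (0 * X x) \<partial>M)"
    unfolding G_def
  proof (rule integral_dominated_convergence[where w = "\<lambda>_. B * K"])
    show "AE x in M. (\<lambda>n. w x * X x ^ q * Si (u n * X x)) \<longlonglongrightarrow> w x * X x ^ q * Si (0 * X x)"
      by (intro AE_I2 tendsto_mult tendsto_const isCont_tendsto_compose[OF isCont_Si] u0)
    show "AE x in M. norm (w x * X x ^ q * Si (u n * X x)) \<le> B * K" for n
      unfolding norm_mult[of "w _ * _"] by (intro AE_I2 mult_mono) (use K Bq in \<open>auto intro: order_trans[OF abs_ge_zero]\<close>)
  qed auto
  then have G0: "(\<lambda>n. G (u n)) \<longlonglongrightarrow> 0" by simp
  have "(\<lambda>n. H (u n)) \<longlonglongrightarrow> 0 + (-1) ^ m * (exp (- (c * 0)) * poly S 0)"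
    unfolding H_def by (intro tendsto_add G0 tendsto_mult tendsto_const tendsto_exp tendsto_minus tendsto_poly u0)
  then have H1: "H 1 = (-1) ^ m * poly S 0"
    unfolding H_const[OF u_pos] by (simp add: LIMSEQ_const_iff)
  have lim_Si: "(\<lambda>n. Si (real (Suc n) * y)) \<longlonglongrightarrow> sgn y * (pi / 2)" for y
  proof (cases "y = 0")
    case False
    have "filterlim (\<lambda>n. real (Suc n) * \<bar>y\<bar>) at_top sequentially"
      using False by (intro filterlim_at_top_mult_tendsto_pos[where c = "\<bar>y\<bar>", rotated -1]
          filterlim_compose[OF filterlim_real_sequentially filterlim_Suc] tendsto_const) auto
    from filterlim_compose[OF Si_at_top this] have "(\<lambda>n. Si (real (Suc n) * \<bar>y\<bar>)) \<longlonglongrightarrow> pi / 2" .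
    then have "(\<lambda>n. sgn y * Si (real (Suc n) * \<bar>y\<bar>)) \<longlonglongrightarrow> sgn y * (pi / 2)" by (intro tendsto_mult tendsto_const)
    moreover have "Si (real (Suc n) * y) = sgn y * Si (real (Suc n) * \<bar>y\<bar>)" for n
      using Si_abs[of "real (Suc n) * y"] by (simp add: sgn_mult abs_mult del: of_nat_Suc)
    ultimately show ?thesis by simp
  qed simp
  have "(\<lambda>n. G (real (Suc n))) \<longlonglongrightarrow> (\<integral>x. w x * X x ^ q * (sgn (X x) * (pi / 2)) \<partial>M)"
    unfolding G_def
  proof (rule integral_dominated_convergence[where w = "\<lambda>_. B * K"])
    show "AE x in M. (\<lambda>n. w x * X x ^ q * Si (real (Suc n) * X x)) \<longlonglongrightarrow> w x * X x ^ q * (sgn (X x) * (pi / 2))"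
      by (intro AE_I2 tendsto_mult[OF tendsto_const lim_Si])
    show "AE x in M. norm (w x * X x ^ q * Si (real (Suc n) * X x)) \<le> B * K" for n
      unfolding norm_mult[of "w _ * _"] by (intro AE_I2 mult_mono) (use K Bq in \<open>auto intro: order_trans[OF abs_ge_zero]\<close>)
  qed auto
  moreover have "(\<lambda>n. G (real (Suc n))) \<longlonglongrightarrow> H 1 - (-1) ^ m * 0"
  proof -
    have "(\<lambda>n. exp (- (c * real (Suc n))) * poly S (real (Suc n))) \<longlonglongrightarrow> 0"
      using filterlim_compose[OF exp_poly_tendsto_0[OF c] filterlim_compose[OF filterlim_real_sequentially filterlim_Suc]] .
    then have "(\<lambda>n. H 1 - (-1) ^ m * (exp (- (c * real (Suc n))) * poly S (real (Suc n)))) \<longlonglongrightarrow> H 1 - (-1) ^ m * 0"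
      by (intro tendsto_diff tendsto_mult tendsto_const)
    moreover have "G (real (Suc n)) = H 1 - (-1) ^ m * (exp (- (c * real (Suc n))) * poly S (real (Suc n)))" for n
      using H_const[of "real (Suc n)"] by (simp add: H_def)
    ultimately show ?thesis by simp
  qed
  ultimately have E1: "(\<integral>x. w x * X x ^ q * (sgn (X x) * (pi / 2)) \<partial>M) = H 1 - (-1) ^ m * 0" by (rule LIMSEQ_unique)
  have E2: "w x * X x ^ q * (sgn (X x) * (pi / 2)) = (w x * \<bar>X x\<bar> ^ q) * (pi / 2)" for x
  proof -
    have "odd q" using m by (simp add: q_def)
    then have "X x ^ q * sgn (X x) = \<bar>X x\<bar> ^ q"
      by (cases "X x \<ge> 0") (auto simp: sgn_if power_minus_odd elim: oddE)
    then show ?thesis by (simp add: mult_ac)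
  qed
  have eq: "(\<integral>x. w x * \<bar>X x\<bar> ^ q \<partial>M) * (pi / 2) = (-1) ^ m * poly S 0"
    using E1 unfolding E2 H1 integral_mult_left_zero by simp
  have "poly S 0 = (\<Sum>j=1..d. coeff R j * fact (j - 1) / c ^ j)"
  proof -
    have "(\<Sum>i\<le>d. coeff R1 i * fact i / c ^ Suc i) = (\<Sum>j=1..Suc d. coeff R j * fact (j - 1) / c ^ j)"
      unfolding R1 by (rule sum.reindex_bij_witness[where i = "\<lambda>j. j - 1" and j = Suc]) (auto simp: coeff_pCons split: nat.splits)
    also have "coeff R (Suc d) = 0"
      using degree_shifted_pderiv_power[of q c P] deg by (intro coeff_eq_0) (simp add: R_def Q_def)
    then have "(\<Sum>j=1..Suc d. coeff R j * fact (j - 1) / c ^ j) = (\<Sum>j=1..d. coeff R j * fact (j - 1) / c ^ j)" by simp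
    finally show ?thesis using S(2) by simp
  qed
  also have "\<dots> = a * (\<Sum>j=1..d. coeff Q j * fact (j - 1) / c ^ j)"
    by (simp add: R_def sum_distrib_left mult_ac)
  finally have S0: "poly S 0 = a * (\<Sum>j=1..d. coeff Q j * fact (j - 1) / c ^ j)" .
  have "(\<integral>x. w x * \<bar>X x\<bar> ^ q \<partial>M) = 2 / pi * ((\<integral>x. w x * \<bar>X x\<bar> ^ q \<partial>M) * (pi / 2))" by simp
  also have "\<dots> = 2 * (-1) ^ m / pi * a * (\<Sum>j=1..d. coeff Q j * fact (j - 1) / c ^ j)"
    unfolding eq S0 by simp
  finally show ?thesis by (simp add: q_def Q_def)
qed

text \<open>On polynomials vanishing at 0 and for c > 0, d bounding the degree, this is the integral
  of exp(-ct) p(t)/t over t > 0. Dropping the constant coefficient extends it linearly to single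
  monomials, whose shifted derivatives need not vanish at 0.\<close>

definition laplace_weight :: "real \<Rightarrow> nat \<Rightarrow> real poly \<Rightarrow> real" where
  "laplace_weight c d p = (\<Sum>j=1..d. coeff p j * fact (j - 1) / c ^ j)"

lemma laplace_weight_diff: "laplace_weight c d (p - q) = laplace_weight c d p - laplace_weight c d q"
  by (simp add: laplace_weight_def diff_divide_distrib algebra_simps sum_subtractf)

lemma laplace_weight_smult: "laplace_weight c d (smult a p) = a * laplace_weight c d p"
  by (simp add: laplace_weight_def sum_distrib_left mult.assoc)

lemma laplace_weight_sum: "laplace_weight c d (\<Sum>i\<in>A. f i) = (\<Sum>i\<in>A. laplace_weight c d (f i))"
proof -
  have "laplace_weight c d (\<Sum>i\<in>A. f i) = (\<Sum>j=1..d. \<Sum>i\<in>A. coeff (f i) j * fact (j - 1) / c ^ j)"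
    by (simp add: laplace_weight_def coeff_sum sum_distrib_right sum_divide_distrib)
  also have "\<dots> = (\<Sum>i\<in>A. laplace_weight c d (f i))"
    unfolding laplace_weight_def by (rule sum.swap)
  finally show ?thesis .
qed

lemma laplace_weight_monom:
  assumes "p \<le> d" shows "laplace_weight c d (monom 1 p) = (if p = 0 then 0 else fact (p - 1) / c ^ p)"
proof -
  have "laplace_weight c d (monom 1 p) = (\<Sum>j=1..d. if j = p then fact (j - 1) / c ^ j else 0)"
    unfolding laplace_weight_def by (rule sum.cong) auto
  then show ?thesis using assms by (simp add: Suc_le_eq)
qed

lemma laplace_weight_recursion:
  "laplace_weight c d ((shifted_pderiv c ^^ Suc q) (monom 1 p)) =
     real p * laplace_weight c d ((shifted_pderiv c ^^ q) (monom 1 (p - 1))) - c * laplace_weight c d ((shifted_pderiv c ^^ q) (monom 1 p))"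
proof -
  have eq: "shifted_pderiv c (monom 1 p) = smult (real p) (monom 1 (p - 1)) + smult (- c) (monom 1 p)"
    by (simp add: shifted_pderiv_def pderiv_monom smult_monom minus_monom)
  have "(shifted_pderiv c ^^ Suc q) (monom 1 p) =
     smult (real p) ((shifted_pderiv c ^^ q) (monom 1 (p - 1))) - smult c ((shifted_pderiv c ^^ q) (monom 1 p))"
    unfolding funpow_Suc_right comp_apply eq shifted_pderiv_power_add shifted_pderiv_power_smult by simp
  then show ?thesis by (simp only: laplace_weight_diff laplace_weight_smult)
qed

text \<open>This is the Leibniz expansion of (D - c)^q t^p, weighted term by term; the induction
  reproduces it through Pascal's rule.\<close>

lemma laplace_weight_eq:
  assumes c: "c > 0" and p: "p \<le> d"
  shows "laplace_weight c d ((shifted_pderiv c ^^ q) (monom 1 p)) =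
    fact p * c ^ q / c ^ p * (\<Sum>i<p. real (q choose i) * (-1) ^ (q + i) / real (p - i))"
  using p
proof (induction q arbitrary: p)
  case 0
  have "(\<Sum>i<p. real (0 choose i) * (-1) ^ (0 + i) / real (p - i)) = (\<Sum>i<p. if i = 0 then 1 / real p else 0)"
    by (intro sum.cong) auto
  also have "\<dots> = (if p = 0 then 0 else 1 / real p)" by simp
  finally have s: "(\<Sum>i<p. real (0 choose i) * (-1) ^ (0 + i) / real (p - i)) = (if p = 0 then 0 else 1 / real p)" .
  show ?case unfolding s using laplace_weight_monom[OF 0, of c]
    by (cases p) (simp_all add: fact_Suc del: of_nat_Suc)
next
  case (Suc q)
  show ?case
  proof (cases p)
    case 0
    have "laplace_weight c d ((shifted_pderiv c ^^ Suc q) (monom 1 0)) = 0"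
      unfolding laplace_weight_recursion using Suc.IH[of 0] by simp
    then show ?thesis using 0 by simp
  next
    case (Suc p')
    define A where "A = (\<Sum>i<p'. real (q choose i) * (-1) ^ (q + i) / real (p' - i))"
    define A' where "A' = (\<Sum>i<p. real (q choose i) * (-1) ^ (q + i) / real (p - i))"
    have "(\<Sum>i<p. real (Suc q choose i) * (-1) ^ (Suc q + i) / real (p - i)) = A - A'"
    proof -
      have "(\<Sum>i<p. real (Suc q choose i) * (-1) ^ (Suc q + i) / real (p - i)) =
        (-1) ^ Suc q / real p + (\<Sum>i<p'. real (Suc q choose Suc i) * (-1) ^ (Suc q + Suc i) / real (p' - i))"
        unfolding Suc by (subst sum.lessThan_Suc_shift) simp
      also have "(\<Sum>i<p'. real (Suc q choose Suc i) * (-1) ^ (Suc q + Suc i) / real (p' - i)) =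
        A + (\<Sum>i<p'. real (q choose Suc i) * (-1) ^ (q + i) / real (p' - i))"
        unfolding A_def sum.distrib[symmetric] by (intro sum.cong) (auto simp: add_divide_distrib algebra_simps)
      also have "(\<Sum>i<p'. real (q choose Suc i) * (-1) ^ (q + i) / real (p' - i)) = (-1) ^ q / real p - A'"
        unfolding A'_def Suc by (subst sum.lessThan_Suc_shift) (simp add: sum_negf)
      finally show ?thesis by simp
    qed
    moreover have "laplace_weight c d ((shifted_pderiv c ^^ Suc q) (monom 1 p)) =
       real p * (fact p' * c ^ q / c ^ p' * A) - c * (fact p * c ^ q / c ^ p * A')"
      unfolding laplace_weight_recursion A_def A'_def using Suc.IH[of p'] Suc.IH[of p] Suc.prems Suc by simp
    moreover have "real p * (fact p' * c ^ q / c ^ p' * A) - c * (fact p * c ^ q / c ^ p * A') = fact p * c ^ Suc q / c ^ p * (A - A')"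
      using c Suc by (simp add: field_simps)
    ultimately show ?thesis by simp
  qed
qed

text \<open>For p > q, q integrations by parts without boundary terms move the derivatives onto 1/t,
  giving q! times the integral of exp(-ct) t^(p-q-1). The recursion yields the same value.\<close>

lemma laplace_weight_large:
  assumes c: "c > 0" and p: "q < p" "p \<le> d"
  shows "laplace_weight c d ((shifted_pderiv c ^^ q) (monom 1 p)) = fact q * fact (p - q - 1) / c ^ (p - q)"
  using p
proof (induction q arbitrary: p)
  case 0
  then show ?case by (simp add: laplace_weight_monom)
next
  case (Suc q)
  obtain r where r: "p = q + 2 + r" using Suc.prems by (metis Suc_eq_plus1 add_2_eq_Suc' add_Suc_right add_Suc less_iff_Suc_add)
  have 1: "laplace_weight c d ((shifted_pderiv c ^^ q) (monom 1 (p - 1))) = fact q * fact r / c ^ Suc r"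
    using Suc.IH[of "p - 1"] Suc.prems r by simp
  have 2: "laplace_weight c d ((shifted_pderiv c ^^ q) (monom 1 p)) = fact q * fact (Suc r) / c ^ Suc (Suc r)"
    using Suc.IH[of p] Suc.prems r by simp
  have "p - Suc q = Suc r" "p - Suc q - 1 = r" "real p = real q + 2 + real r" using r by auto
  then show ?case unfolding laplace_weight_recursion 1 2 using c by (simp add: field_simps)
qed

text \<open>Substitution l = p - i; the signs agree because q + p - l and l + q - p have the same
  parity.\<close>

lemma laplace_weight_small:
  assumes c: "c > 0" and p: "p \<le> q" "p \<le> d"
  shows "laplace_weight c d ((shifted_pderiv c ^^ q) (monom 1 p)) =
    (\<Sum>l=1..p. real (q choose (p - l)) * ((-1) ^ l / real l) * (- c) ^ (q - p) * fact p)"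
proof -
  have "(\<Sum>i<p. real (q choose i) * (-1) ^ (q + i) / real (p - i)) = (\<Sum>l=1..p. real (q choose (p - l)) * (-1) ^ (q + (p - l)) / real l)"
    by (rule sum.reindex_bij_witness[where i = "\<lambda>l. p - l" and j = "\<lambda>i. p - i"]) auto
  also have "\<dots> = (\<Sum>l=1..p. real (q choose (p - l)) * ((-1) ^ l / real l) * (-1) ^ (q - p))"
  proof (rule sum.cong[OF refl])
    fix l assume l: "l \<in> {1..p}"
    have "even (q + (p - l)) \<longleftrightarrow> even (l + (q - p))" using l p by presburger
    then have "(-1) ^ (q + (p - l)) = ((-1) ^ l * (-1) ^ (q - p) :: real)"
      by (simp add: minus_one_power_iff flip: power_add)
    then show "real (q choose (p - l)) * (-1) ^ (q + (p - l)) / real l = real (q choose (p - l)) * ((-1) ^ l / real l) * (-1) ^ (q - p)"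
      by simp
  qed
  finally have 1: "(\<Sum>i<p. real (q choose i) * (-1) ^ (q + i) / real (p - i)) =
    (\<Sum>l=1..p. real (q choose (p - l)) * ((-1) ^ l / real l) * (-1) ^ (q - p))" .
  have 2: "c ^ q / c ^ p = c ^ (q - p)" using c p by (simp add: power_diff)
  have 3: "(- c) ^ (q - p) = (-1) ^ (q - p) * c ^ (q - p)" by (rule power_minus)
  have "laplace_weight c d ((shifted_pderiv c ^^ q) (monom 1 p)) =
      fact p * (c ^ q / c ^ p) * (\<Sum>l=1..p. real (q choose (p - l)) * ((-1) ^ l / real l) * (-1) ^ (q - p))"
    unfolding laplace_weight_eq[OF c p(2)] 1 by simp
  then show ?thesis unfolding 2 3 by (simp add: sum_distrib_left mult_ac)
qed

section \<open>The moments of the characteristic polynomial\<close>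

lemma proots_prod_linear:
  fixes f :: "'a \<Rightarrow> complex"
  assumes "finite A" shows "proots (\<Prod>i\<in>A. [:- f i, 1:]) = image_mset f (mset_set A)"
  using assms
proof (induction A)
  case (insert a A)
  have "(\<Prod>i\<in>A. [:- f i, 1:]) \<noteq> 0" using insert.hyps by (simp add: prod_zero_iff)
  then show ?case using insert by (simp add: proots_mult del: mult_pCons_left)
qed simp

text \<open>On the unit circle the Cayley transform is i cot(theta/2); at x = 1 division by zero
  makes it 0.\<close>

lemma Re_cayley:
  fixes x :: complex assumes "norm x = 1" shows "Re ((1 + x) / (1 - x)) = 0"
proof -
  have "(Re x)\<^sup>2 + (Im x)\<^sup>2 = 1" using assms by (simp add: cmod_def)
  then have "Re (1 + x) * Re (1 - x) + Im (1 + x) * Im (1 - x) = 0"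
    by (simp add: algebra_simps power2_eq_square)
  then show ?thesis by (simp add: Re_divide)
qed

text \<open>A partition of p > kN with at most k parts has a part larger than N.\<close>

lemma C_coeff_eq_0:
  assumes "k * N < p" shows "C_coeff N p k = 0"
proof -
  have "gen_pochhammer (- real N) la = 0" if la: "la \<in> partitions k p" for la
  proof (rule gen_pochhammer_neg_eq_0[OF la])
    show "la \<notin> box_partitions k N"
    proof
      assume box: "la \<in> box_partitions k N"
      have "sum_list la = (\<Sum>i<length la. la ! i)" by (simp add: sum_list_sum_nth atLeast0LessThan)
      also have "\<dots> \<le> (\<Sum>i<length la. N)" using box_partitions_nth(2)[OF box] by (intro sum_mono) simp
      also have "\<dots> \<le> k * N" using box by (simp add: box_partitions_def)
      finally show False using la assms by (simp add: partitions_def)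
    qed
  qed
  then show ?thesis by (simp add: C_coeff_def)
qed

context haar_eigenvalues begin

definition det_at_1 :: "complex ^ 'n ^ 'n \<Rightarrow> complex" where
  "det_at_1 U = (\<Prod>l\<in>UNIV. 1 - z U l)"

text \<open>The numerator of the sum of z/(1-z) over the common denominator \<open>det_at_1\<close>;
  it stays bounded when an eigenvalue approaches 1.\<close>

definition det_slope :: "complex ^ 'n ^ 'n \<Rightarrow> complex" where
  "det_slope U = (\<Sum>l\<in>UNIV. z U l * (\<Prod>l'\<in>UNIV - {l}. 1 - z U l'))"

text \<open>This is \<open>\<Sum>\<^sub>l cot(\<theta>\<^sub>l/2)\<close>; it is \<open>0\<close> by division by zero if \<open>1\<close> is an eigenvalue.\<close>

definition cot_sum :: "complex ^ 'n ^ 'n \<Rightarrow> real" where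
  "cot_sum U = 2 * Im (det_slope U / det_at_1 U)"

lemma N_pos: "0 < CARD('n)" by simp

lemma det_at_1_nonzero_iff: "det_at_1 U \<noteq> 0 \<longleftrightarrow> (\<forall>l. z U l \<noteq> 1)"
  by (auto simp: det_at_1_def)

lemma det_slope_divide:
  assumes "det_at_1 U \<noteq> 0"
  shows "det_slope U / det_at_1 U = (\<Sum>l\<in>UNIV. z U l / (1 - z U l))"
proof -
  have "z U l * (\<Prod>l'\<in>UNIV - {l}. 1 - z U l') / det_at_1 U = z U l / (1 - z U l)" for l
  proof -
    have "det_at_1 U = (1 - z U l) * (\<Prod>l'\<in>UNIV - {l}. 1 - z U l')"
      unfolding det_at_1_def by (rule prod.remove) auto
    then show ?thesis using assms by auto
  qed
  then show ?thesis by (simp add: det_slope_def sum_divide_distrib)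
qed

text \<open>2z/(1-z) is the Cayley transform of z minus 1, and the Cayley transforms are purely
  imaginary.\<close>

lemma cayley_sum:
  assumes U: "U \<in> unitary_group" and nz: "det_at_1 U \<noteq> 0"
  shows "(\<Sum>l\<in>UNIV. 2 * (z U l / (1 - z U l))) = \<i> * of_real (cot_sum U) - of_nat CARD('n)"
proof -
  have ne: "1 - z U l \<noteq> 0" for l using nz by (simp add: det_at_1_nonzero_iff)
  have "(1 + z U l) / (1 - z U l) = 1 + 2 * (z U l / (1 - z U l))" for l
    using ne[of l] by (simp add: field_simps)
  then have eq: "(\<Sum>l\<in>UNIV. (1 + z U l) / (1 - z U l)) = of_nat CARD('n) + (\<Sum>l\<in>UNIV. 2 * (z U l / (1 - z U l)))"
    by (simp add: sum.distrib)
  have "Im (\<Sum>l\<in>UNIV. (1 + z U l) / (1 - z U l)) = cot_sum U"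
    unfolding eq sum_distrib_left[symmetric] by (simp add: cot_sum_def det_slope_divide[OF nz])
  moreover have "Re (\<Sum>l\<in>UNIV. (1 + z U l) / (1 - z U l)) = 0"
    using Re_cayley[OF norm_z[OF U]] by simp
  ultimately have "(\<Sum>l\<in>UNIV. (1 + z U l) / (1 - z U l)) = \<i> * of_real (cot_sum U)"
    by (simp add: complex_eq_iff)
  then show ?thesis
    unfolding eq by (simp add: algebra_simps)
qed

lemma eigenangles_eq: "eigenangles U = image_mset (\<lambda>l. Arg2pi (z U l)) (mset_set UNIV)"
  by (simp add: eigenangles_def z proots_prod_linear image_mset.compositionality comp_def)

lemma Z_poly_eq:
  assumes U: "U \<in> unitary_group"
  shows "Z_poly U \<theta> = (\<Prod>l\<in>UNIV. 1 - z U l * exp (- (\<i> * of_real \<theta>)))"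
proof -
  have "exp (\<i> * of_real (Arg2pi (z U l) - \<theta>)) = z U l * exp (- (\<i> * of_real \<theta>))" for l
    using Arg2pi_eq[of "z U l"] norm_z[OF U, of l]
    by (simp add: right_diff_distrib exp_diff exp_minus divide_inverse)
  then show ?thesis
    by (simp add: Z_poly_def eigenangles_eq image_mset.compositionality comp_def prod_unfold_prod_mset)
qed

lemma norm_V_poly_0:
  assumes U: "U \<in> unitary_group"
  shows "norm (V_poly U 0) = norm (det_at_1 U)"
  by (simp add: V_poly_def Z_poly_eq[OF U] det_at_1_def norm_mult)

text \<open>In the logarithmic derivative of V the phase contributes iN/2 and the product i times
  the sum of z/(1-z); by \<open>cayley_sum\<close> they add up to -X/2. The unimodular prefactor
  disappears in the norm.\<close>

lemma norm_V_poly_derivative: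
  assumes U: "U \<in> unitary_group" and nz: "det_at_1 U \<noteq> 0"
  shows "norm (vector_derivative (V_poly U) (at 0)) = norm (det_at_1 U) * \<bar>cot_sum U\<bar> / 2"
proof -
  define s where "s = (\<Sum>t\<in>#eigenangles U. t / 2)"
  define A where "A w = exp (\<i> * of_nat CARD('n) * ((w + of_real pi) / 2) - \<i> * of_real s)" for w
  define B where "B w = (\<Prod>l\<in>UNIV. 1 - z U l * exp (- (\<i> * w)))" for w
  have V: "V_poly U = (\<lambda>\<theta>. A (of_real \<theta>) * B (of_real \<theta>))"
    by (simp add: fun_eq_iff V_poly_def Z_poly_eq[OF U] A_def B_def s_def)
  have ne: "1 - z U l \<noteq> 0" for l using nz by (simp add: det_at_1_nonzero_iff)
  have B0: "B 0 = det_at_1 U" by (simp add: B_def det_at_1_def)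
  have dA: "(A has_field_derivative A 0 * (\<i> * of_nat CARD('n) / 2)) (at 0)"
    unfolding A_def by (auto intro!: derivative_eq_intros)
  have dB: "(B has_field_derivative B 0 * (\<Sum>l\<in>UNIV. \<i> * (z U l / (1 - z U l)))) (at 0)"
  proof -
    have "((\<lambda>w. \<Prod>l\<in>UNIV. 1 - z U l * exp (- (\<i> * w))) has_field_derivative
      (\<Prod>l\<in>UNIV. 1 - z U l * exp (- (\<i> * 0))) * (\<Sum>l\<in>UNIV. (\<i> * z U l) / (1 - z U l * exp (- (\<i> * 0))))) (at 0)"
      by (rule has_field_derivative_prod') (use ne in \<open>auto intro!: derivative_eq_intros\<close>)
    then show ?thesis by (simp add: B_def[abs_def])
  qed
  have "((\<lambda>w. A w * B w) has_field_derivative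
      A 0 * (\<i> * of_nat CARD('n) / 2) * B 0 + B 0 * (\<Sum>l\<in>UNIV. \<i> * (z U l / (1 - z U l))) * A 0) (at 0)"
    by (rule DERIV_mult[OF dA dB])
  also have "A 0 * (\<i> * of_nat CARD('n) / 2) * B 0 + B 0 * (\<Sum>l\<in>UNIV. \<i> * (z U l / (1 - z U l))) * A 0 =
      A 0 * B 0 * (\<i> / 2) * (of_nat CARD('n) + (\<Sum>l\<in>UNIV. 2 * (z U l / (1 - z U l))))"
    by (simp add: algebra_simps sum_distrib_left)
  also have "of_nat CARD('n) + (\<Sum>l\<in>UNIV. 2 * (z U l / (1 - z U l))) = \<i> * of_real (cot_sum U)"
    unfolding cayley_sum[OF U nz] by simp
  finally have "((\<lambda>w. A w * B w) has_field_derivative A 0 * B 0 * (\<i> / 2) * (\<i> * of_real (cot_sum U))) (at (of_real 0))"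
    by simp
  from has_vector_derivative_real_field[OF this]
  have "(V_poly U has_vector_derivative A 0 * B 0 * (\<i> / 2) * (\<i> * of_real (cot_sum U))) (at 0)"
    unfolding V by simp
  then have "vector_derivative (V_poly U) (at 0) = A 0 * B 0 * (\<i> / 2) * (\<i> * of_real (cot_sum U))"
    by (rule vector_derivative_at)
  moreover have "norm (A 0) = 1" by (simp add: A_def)
  ultimately show ?thesis by (simp only: norm_mult B0) (simp add: norm_divide)
qed

lemma measurable_det_at_1: "det_at_1 \<in> borel_measurable \<mu>"
  using measurable_class_polynomial[of "[:1, -1:]"] by (simp add: det_at_1_def[abs_def])

text \<open>\<open>det_slope\<close> is the derivative at h = 0 of the product of 1 - (1-h) z_l,
  hence a limit of differences of measurable class polynomials.\<close>

lemma measurable_det_slope: "det_slope \<in> borel_measurable \<mu>"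
proof (rule borel_measurable_LIMSEQ_metric)
  define f where "f U h = (\<Prod>l\<in>UNIV. 1 - (1 - complex_of_real h) * z U l)" for U and h :: real
  show "(\<lambda>U. (f U (inverse (real (Suc n))) - f U 0) * of_nat (Suc n)) \<in> borel_measurable \<mu>" for n
  proof -
    have "(\<lambda>U. f U h) \<in> borel_measurable \<mu>" for h
      using measurable_class_polynomial[of "[:1, - (1 - complex_of_real h):]"] by (simp add: f_def algebra_simps)
    then show ?thesis by (intro borel_measurable_times borel_measurable_diff) auto
  qed
  fix U
  have "((\<lambda>w. \<Prod>l\<in>UNIV. 1 - (1 - w) * z U l) has_field_derivative
      (\<Sum>l\<in>UNIV. z U l * (\<Prod>l'\<in>UNIV - {l}. 1 - (1 - of_real 0) * z U l'))) (at (of_real 0))"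
    by (rule has_field_derivative_prod) (auto intro!: derivative_eq_intros)
  from has_vector_derivative_real_field[OF this]
  have "(f U has_vector_derivative det_slope U) (at 0)"
    by (simp add: f_def[abs_def] det_slope_def)
  from tendsto_slope_sequence[OF this]
  show "(\<lambda>n. (f U (inverse (real (Suc n))) - f U 0) * of_nat (Suc n)) \<longlonglongrightarrow> det_slope U" .
qed

lemma measurable_cot_sum: "cot_sum \<in> borel_measurable \<mu>"
  unfolding cot_sum_def[abs_def]
  by (intro borel_measurable_times borel_measurable_const borel_measurable_divide measurable_det_slope measurable_det_at_1
      measurable_compose[OF _ borel_measurable_Im])

lemma norm_one_minus_z_le: "U \<in> unitary_group \<Longrightarrow> norm (1 - z U l) \<le> 2"
  using norm_triangle_ineq4[of 1 "z U l"] norm_z[of U l] by simp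

lemma norm_det_at_1_le:
  assumes "U \<in> unitary_group" shows "norm (det_at_1 U) \<le> 2 ^ CARD('n)"
proof -
  have "norm (det_at_1 U) \<le> (\<Prod>l\<in>(UNIV::'n set). 2)"
    unfolding det_at_1_def prod_norm[symmetric] by (intro prod_mono conjI norm_ge_zero norm_one_minus_z_le assms)
  then show ?thesis by simp
qed

lemma norm_det_slope_le:
  assumes U: "U \<in> unitary_group" shows "norm (det_slope U) \<le> real CARD('n) * 2 ^ CARD('n)"
proof -
  have "norm (z U l * (\<Prod>l'\<in>UNIV - {l}. 1 - z U l')) \<le> 2 ^ CARD('n)" for l
  proof -
    have "norm (\<Prod>l'\<in>UNIV - {l}. 1 - z U l') \<le> (\<Prod>l'\<in>UNIV - {l}. 2)"
      unfolding prod_norm[symmetric] by (intro prod_mono conjI norm_ge_zero norm_one_minus_z_le U)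
    also have "\<dots> = 2 ^ (CARD('n) - 1)" by (simp add: card_Diff_singleton)
    also have "\<dots> \<le> (2 :: real) ^ CARD('n)" by (rule power_increasing) auto
    finally show ?thesis by (simp add: norm_mult norm_z[OF U])
  qed
  then have "norm (det_slope U) \<le> (\<Sum>l\<in>(UNIV::'n set). 2 ^ CARD('n))"
    unfolding det_slope_def by (intro sum_norm_le)
  then show ?thesis by simp
qed

text \<open>Multiplication by det(1 - U) clears the denominators of X, so the weight of power 2k
  compensates up to 2k factors X.\<close>

lemma weighted_cot_sum_bound:
  assumes U: "U \<in> unitary_group" and k: "1 \<le> k" and j: "j \<le> 2 * k"
  shows "\<bar>norm (det_at_1 U) ^ (2 * k) * cot_sum U ^ j\<bar> \<le> (2 * (real CARD('n) * 2 ^ CARD('n))) ^ (2 * k)"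
proof -
  let ?D = "norm (det_at_1 U)" and ?C = "2 * (real CARD('n) * 2 ^ CARD('n))"
  have N1: "1 \<le> real CARD('n)" by (simp add: Suc_leI)
  have DX: "?D * \<bar>cot_sum U\<bar> \<le> ?C"
  proof (cases "det_at_1 U = 0")
    case False
    have "\<bar>cot_sum U\<bar> \<le> 2 * (norm (det_slope U) / ?D)"
      using abs_Im_le_cmod[of "det_slope U / det_at_1 U"] by (simp add: cot_sum_def abs_mult norm_divide)
    then have "?D * \<bar>cot_sum U\<bar> \<le> ?D * (2 * (norm (det_slope U) / ?D))" by (intro mult_left_mono) auto
    also have "\<dots> = 2 * norm (det_slope U)" using False by simp
    also have "\<dots> \<le> ?C" using norm_det_slope_le[OF U] by simp
    finally show ?thesis .
  qed simp
  have DC: "?D \<le> ?C"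
  proof -
    have "?D \<le> 1 * 2 ^ CARD('n)" using norm_det_at_1_le[OF U] by simp
    also have "\<dots> \<le> real CARD('n) * 2 ^ CARD('n)" using N1 by (intro mult_right_mono) auto
    also have "\<dots> \<le> ?C" by simp
    finally show ?thesis .
  qed
  have "\<bar>?D ^ (2 * k) * cot_sum U ^ j\<bar> = ?D ^ (2 * k - j) * (?D * \<bar>cot_sum U\<bar>) ^ j"
    using j by (simp add: abs_mult power_abs power_mult_distrib flip: power_add mult.assoc)
  also have "\<dots> \<le> ?C ^ (2 * k - j) * ?C ^ j"
    by (intro mult_mono power_mono DX DC) auto
  also have "\<dots> = ?C ^ (2 * k)" using j by (simp only: power_add[symmetric]) simp
  finally show ?thesis .
qed

lemma F_moment_0:
  assumes k: "1 \<le> k"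
  shows "F_moment \<mu> 0 (real k) = (\<integral>U. norm (det_at_1 U) ^ (2 * k) \<partial>\<mu>)"
  unfolding F_moment_def
proof (rule Bochner_Integration.integral_cong[OF refl])
  fix U assume "U \<in> space \<mu>"
  then have U: "U \<in> unitary_group" by (simp add: space_haar)
  have "norm (det_at_1 U) powr (2 * real k) = norm (det_at_1 U) ^ (2 * k)"
    using k powr_realpow[of "norm (det_at_1 U)" "2 * k"] by (cases "det_at_1 U = 0") auto
  then show "real_pow (norm (V_poly U 0)) (2 * real k - 2 * 0) * real_pow (norm (vector_derivative (V_poly U) (at 0))) (2 * 0) =
     norm (det_at_1 U) ^ (2 * k)"
    using k by (simp add: real_pow_def norm_V_poly_0[OF U])
qed

lemma F_moment_half_odd:
  assumes k: "1 \<le> k" and m: "1 \<le> m" "m \<le> k" and h: "h = (2 * real m - 1) / 2"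
  shows "F_moment \<mu> h (real k) = (\<integral>U. norm (det_at_1 U) ^ (2 * k) * \<bar>cot_sum U\<bar> ^ (2 * m - 1) \<partial>\<mu>) / 2 ^ (2 * m - 1)"
proof -
  define q where "q = 2 * m - 1"
  have q: "1 \<le> q" "q < 2 * k" "2 * h = real q" using m h by (auto simp: q_def of_nat_diff)
  have "F_moment \<mu> h (real k) = (\<integral>U. norm (det_at_1 U) ^ (2 * k) * \<bar>cot_sum U\<bar> ^ q / 2 ^ q \<partial>\<mu>)"
    unfolding F_moment_def
  proof (rule Bochner_Integration.integral_cong[OF refl])
    fix U assume "U \<in> space \<mu>"
    then have U: "U \<in> unitary_group" by (simp add: space_haar)
    have kq: "2 * real k - 2 * h = real (2 * k - q)" using q by (simp add: of_nat_diff)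
    have rp: "real_pow y (real n) = y ^ n" if "0 \<le> y" "1 \<le> n" for y n
      using that powr_realpow[of y n] by (cases "y = 0") (auto simp: real_pow_def)
    let ?D = "norm (det_at_1 U)"
    show "real_pow (norm (V_poly U 0)) (2 * real k - 2 * h) * real_pow (norm (vector_derivative (V_poly U) (at 0))) (2 * h) =
       ?D ^ (2 * k) * \<bar>cot_sum U\<bar> ^ q / 2 ^ q"
    proof (cases "det_at_1 U = 0")
      \<comment> \<open>V vanishes at 0 and occurs with the positive power 2k - q, so the value of
        the derivative does not matter.\<close>
      case True
      then have "real_pow (norm (V_poly U 0)) (real (2 * k - q)) = 0"
        using q by (subst rp) (auto simp: norm_V_poly_0[OF U])
      then show ?thesis unfolding kq using True k by simp
    next
      case False
      have "real_pow (norm (V_poly U 0)) (2 * real k - 2 * h) * real_pow (norm (vector_derivative (V_poly U) (at 0))) (2 * h) =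
        ?D ^ (2 * k - q) * (?D * \<bar>cot_sum U\<bar> / 2) ^ q"
        unfolding kq unfolding q(3) norm_V_poly_0[OF U] norm_V_poly_derivative[OF U False] using q by (simp add: rp del: of_nat_diff)
      also have "\<dots> = ?D ^ (2 * k) * \<bar>cot_sum U\<bar> ^ q / 2 ^ q"
        using q by (simp add: power_divide power_mult_distrib flip: power_add mult.assoc)
      finally show ?thesis .
    qed
  qed
  then show ?thesis by (simp add: q_def)
qed

text \<open>On the unit circle (1-z)^2 conj(z) = -|1-z|^2, which yields the weight and the sign;
  \<open>cayley_sum\<close> turns the exponentials into exp(Nt - itX). If 1 is an eigenvalue, both
  sides are 0 because k >= 1.\<close>

lemma laguerre_integrand:
  assumes U: "U \<in> unitary_group" and k: "1 \<le> k"
  shows "(\<Prod>l\<in>UNIV. (1 - z U l) ^ (2 * k) * exp (- 2 * of_real t * (z U l / (1 - z U l)))) * cnj (det U) ^ k =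
    (-1) ^ (k * CARD('n)) * of_real (exp (real CARD('n) * t)) * (of_real (norm (det_at_1 U) ^ (2 * k)) * exp (- (\<i> * of_real (t * cot_sum U))))"
proof (cases "det_at_1 U = 0")
  case True
  then obtain l where "z U l = 1" using det_at_1_nonzero_iff by blast
  then have "(\<Prod>l\<in>UNIV. (1 - z U l) ^ (2 * k) * exp (- 2 * of_real t * (z U l / (1 - z U l)))) = 0"
    using k by (intro prod_zero bexI[of _ l]) auto
  moreover have "norm (det_at_1 U) ^ (2 * k) = 0" using True k by simp
  ultimately show ?thesis by (simp only: mult_zero_left mult_zero_right of_real_0)
next
  case False
  have "(1 - z U l) ^ (2 * k) * cnj (z U l) ^ k = (- of_real ((norm (1 - z U l))\<^sup>2)) ^ k" for l
  proof -
    have "z U l * cnj (z U l) = 1" using norm_z[OF U, of l] by (simp add: complex_norm_square[symmetric])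
    then have "(1 - z U l)\<^sup>2 * cnj (z U l) = - ((1 - z U l) * cnj (1 - z U l))"
      by (simp add: power2_eq_square algebra_simps)
    also have "\<dots> = - of_real ((norm (1 - z U l))\<^sup>2)" by (simp only: complex_norm_square)
    finally show ?thesis by (simp only: power_mult power_mult_distrib[symmetric])
  qed
  then have "(\<Prod>l\<in>UNIV. (1 - z U l) ^ (2 * k)) * cnj (det U) ^ k = (\<Prod>l\<in>UNIV. (- of_real ((norm (1 - z U l))\<^sup>2)) ^ k)"
    by (simp add: det_eq_prod_z prod_power_distrib flip: prod.distrib)
  also have "\<dots> = (\<Prod>l\<in>UNIV. (-1) ^ k * of_real (norm (1 - z U l) ^ (2 * k)))"
    by (rule prod.cong[OF refl]) (simp add: power_minus[of "_ ^ 2"] power_mult)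
  also have "\<dots> = (-1) ^ (k * CARD('n)) * of_real (norm (det_at_1 U) ^ (2 * k))"
    by (simp add: prod.distrib power_mult det_at_1_def prod_norm[symmetric] prod_power_distrib[symmetric])
  finally have 1: "(\<Prod>l\<in>UNIV. (1 - z U l) ^ (2 * k)) * cnj (det U) ^ k = (-1) ^ (k * CARD('n)) * of_real (norm (det_at_1 U) ^ (2 * k))" .
  have "(\<Prod>l\<in>UNIV. exp (- 2 * of_real t * (z U l / (1 - z U l)))) = exp (- of_real t * (\<Sum>l\<in>UNIV. 2 * (z U l / (1 - z U l))))"
    by (simp add: exp_sum[symmetric] sum_distrib_left mult_ac sum_negf)
  also have "\<dots> = of_real (exp (real CARD('n) * t)) * exp (- (\<i> * of_real (t * cot_sum U)))"
    unfolding cayley_sum[OF U False] by (simp add: exp_of_real[symmetric] mult_exp_exp algebra_simps)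
  finally have 2: "(\<Prod>l\<in>UNIV. exp (- 2 * of_real t * (z U l / (1 - z U l)))) = of_real (exp (real CARD('n) * t)) * exp (- (\<i> * of_real (t * cot_sum U)))" .
  have "(\<Prod>l\<in>UNIV. (1 - z U l) ^ (2 * k) * exp (- 2 * of_real t * (z U l / (1 - z U l)))) * cnj (det U) ^ k =
    ((\<Prod>l\<in>UNIV. (1 - z U l) ^ (2 * k)) * cnj (det U) ^ k) * (\<Prod>l\<in>UNIV. exp (- 2 * of_real t * (z U l / (1 - z U l))))"
    by (simp only: prod.distrib mult_ac)
  then show ?thesis unfolding 1 2 by (simp only: mult_ac)
qed

text \<open>The product of \<open>det_constant\<close> and \<open>binomial_constant\<close> is read
  off at t = 0, where the integral is F(0,k) and the polynomial is \<open>C_coeff N 0 k\<close> =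
  1.\<close>

lemma characteristic_function:
  assumes k: "1 \<le> k" and t: "0 \<le> t"
  shows "(\<integral>U. norm (det_at_1 U) ^ (2 * k) * cos (t * cot_sum U) \<partial>\<mu>) =
    F_moment \<mu> 0 (real k) * (exp (- (real CARD('n) * t)) * (\<Sum>p\<le>k * CARD('n). C_coeff CARD('n) p k * t ^ p))"
proof -
  \<comment> \<open>The basis for which \<open>laguerre_coefficient\<close> factorises; it is
    unitriangular against the monomials, so its determinant is 1.\<close>
  define q where "q i = [:0, 1:] ^ e i * ([:1, -1:] ^ (CARD('n) - 1 - e i) :: complex poly)" for i
  define P where "P t = (\<Sum>p\<le>k * CARD('n). C_coeff CARD('n) p k * t ^ p)" for t
  define J where "J t = (\<integral>U. of_real (norm (det_at_1 U) ^ (2 * k)) * exp (- (\<i> * of_real (t * cot_sum U))) \<partial>\<mu>)" for t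
  have lt: "e i < CARD('n)" for i using bij_betwE[OF e] by auto
  have inj: "inj e" using e by (simp add: bij_betw_def)
  have X: "[:0, 1:] ^ a = monom (1::complex) a" for a by (simp add: monom_altdef)
  have dq: "degree (q i) < CARD('n)" for i
  proof -
    have "degree (q i) \<le> degree ([:0, 1:] ^ e i :: complex poly) + degree ([:1, -1:] ^ (CARD('n) - 1 - e i) :: complex poly)"
      unfolding q_def by (rule degree_mult_le)
    also have "\<dots> \<le> e i + (CARD('n) - 1 - e i)" by (simp add: degree_power_eq)
    also have "\<dots> < CARD('n)" using lt[of i] by simp
    finally show ?thesis .
  qed
  have coeff_q: "coeff (q i) n = (if n < e i then 0 else coeff ([:1, -1:] ^ (CARD('n) - 1 - e i)) (n - e i))" for i n
    unfolding q_def X coeff_monom_mult by simp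
  have det_q: "det (\<chi> i j. coeff (q i) (e j)) = 1"
  proof -
    have "det (\<chi> i j. coeff (q i) (e j)) = (\<Prod>i\<in>UNIV. (\<chi> i j. coeff (q i) (e j)) $ i $ i)"
      by (rule det_triangular'[OF inj]) (simp add: coeff_q)
    also have "\<dots> = 1" by (intro prod.neutral) (simp add: coeff_q coeff_0_power)
    finally show ?thesis .
  qed
  have J: "J t = (-1) ^ (k * CARD('n)) * of_real (exp (- (real CARD('n) * t))) * (det_constant k * binomial_constant e CARD('n) k) * of_real (P t)"
    if t: "0 \<le> t" for t
  proof -
    have "(-1) ^ (k * CARD('n)) * of_real (exp (real CARD('n) * t)) * J t =
      (\<integral>U. (-1) ^ (k * CARD('n)) * of_real (exp (real CARD('n) * t)) * (of_real (norm (det_at_1 U) ^ (2 * k)) * exp (- (\<i> * of_real (t * cot_sum U)))) \<partial>\<mu>)"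
      unfolding J_def by (simp only: integral_mult_right_zero)
    also have "\<dots> = (\<integral>U. (\<Prod>l\<in>UNIV. (1 - z U l) ^ (2 * k) * exp (- 2 * of_real t * (z U l / (1 - z U l)))) * cnj (det U) ^ k \<partial>\<mu>)"
      by (rule Bochner_Integration.integral_cong[OF refl]) (simp only: laguerre_integrand[OF _ k] space_haar)
    also have "\<dots> = det_constant k * (binomial_constant e CARD('n) k * of_real (P t))"
      unfolding integral_laguerre[OF k t dq det_q] q_def det_laguerre[OF e N_pos] P_def ..
    finally have eq: "(-1) ^ (k * CARD('n)) * of_real (exp (real CARD('n) * t)) * J t = det_constant k * (binomial_constant e CARD('n) k * of_real (P t))" .
    have s: "(-1) ^ (k * CARD('n)) * (-1) ^ (k * CARD('n)) = (1::complex)" by (simp flip: power_mult_distrib)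
    have x: "complex_of_real (exp (- (real CARD('n) * t))) * of_real (exp (real CARD('n) * t)) = 1"
      by (simp add: exp_minus flip: of_real_mult)
    have "J t = ((-1) ^ (k * CARD('n)) * (-1) ^ (k * CARD('n))) * (complex_of_real (exp (- (real CARD('n) * t))) * of_real (exp (real CARD('n) * t))) * J t"
      unfolding s x by simp
    also have "\<dots> = (-1) ^ (k * CARD('n)) * of_real (exp (- (real CARD('n) * t))) * ((-1) ^ (k * CARD('n)) * of_real (exp (real CARD('n) * t)) * J t)"
      by (simp only: mult_ac)
    finally show ?thesis unfolding eq by (simp only: mult_ac)
  qed
  have "J 0 = (\<integral>U. of_real (norm (det_at_1 U) ^ (2 * k)) \<partial>\<mu>)"
    by (simp only: J_def mult_zero_left of_real_0 mult_zero_right minus_zero exp_zero mult_1_right)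
  then have J0: "J 0 = of_real (F_moment \<mu> 0 (real k))"
    unfolding integral_complex_of_real by (subst F_moment_0[OF k])
  have "P 0 = (\<Sum>p\<le>k * CARD('n). if p = 0 then 1 else 0)"
    unfolding P_def by (rule sum.cong[OF refl]) (simp add: power_0_left)
  also have "\<dots> = 1" by (simp only: sum.delta finite_atMost) simp
  finally have P0: "P 0 = 1" .
  have J0': "J 0 = (-1) ^ (k * CARD('n)) * (det_constant k * binomial_constant e CARD('n) k)"
    unfolding J[OF order_refl] P0 mult_zero_right minus_zero exp_zero of_real_1 mult_1_right ..
  have c: "(-1) ^ (k * CARD('n)) * (det_constant k * binomial_constant e CARD('n) k) = of_real (F_moment \<mu> 0 (real k))"
    by (rule trans[OF J0'[symmetric] J0])
  have Jt: "J t = of_real (F_moment \<mu> 0 (real k) * (exp (- (real CARD('n) * t)) * P t))"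
    unfolding J[OF t] of_real_mult c[symmetric] by (simp only: mult_ac)
  have "(\<integral>U. norm (det_at_1 U) ^ (2 * k) * cos (t * cot_sum U) \<partial>\<mu>) = Re (J t)"
  proof -
    have "integrable \<mu> (\<lambda>U. of_real (norm (det_at_1 U) ^ (2 * k)) * exp (- (\<i> * of_real (t * cot_sum U))))"
    proof (rule integrable_const_bound)
      show "AE U in \<mu>. norm (of_real (norm (det_at_1 U) ^ (2 * k)) * exp (- (\<i> * of_real (t * cot_sum U)))) \<le> (2 ^ CARD('n)) ^ (2 * k)"
        by (rule AE_I2) (auto simp: space_haar norm_mult norm_power intro!: power_mono norm_det_at_1_le)
      have "(\<lambda>U. exp (- (\<i> * of_real (t * cot_sum U)))) \<in> borel_measurable \<mu>"
        by (intro measurable_compose[OF measurable_cot_sum borel_measurable_continuous_onI[where f = "\<lambda>x. exp (- (\<i> * of_real (t * x)))"]] continuous_intros)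
      moreover have "(\<lambda>U. complex_of_real (norm (det_at_1 U) ^ (2 * k))) \<in> borel_measurable \<mu>"
        by (intro measurable_compose[OF measurable_det_at_1 borel_measurable_continuous_onI[where f = "\<lambda>x. complex_of_real (norm x ^ (2 * k))"]] continuous_intros)
      ultimately show "(\<lambda>U. of_real (norm (det_at_1 U) ^ (2 * k)) * exp (- (\<i> * of_real (t * cot_sum U)))) \<in> borel_measurable \<mu>"
        by (intro borel_measurable_times)
    qed
    then have "Re (J t) = (\<integral>U. Re (of_real (norm (det_at_1 U) ^ (2 * k)) * exp (- (\<i> * of_real (t * cot_sum U)))) \<partial>\<mu>)"
      unfolding J_def by (rule integral_Re[symmetric])
    then show ?thesis by (simp add: Re_exp)
  qed
  then show ?thesis unfolding Jt P_def by simp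
qed

lemma F_moment_half_odd_eq:
  assumes k: "1 \<le> k" and m: "1 \<le> m" "m \<le> k" and h: "h = (2 * real m - 1) / 2"
  shows "F_moment \<mu> h (real k) =
    2 * (- 1) ^ m / (2 ^ (2 * m - 1) * pi) * F_moment \<mu> 0 (real k) *
    ((\<Sum>p = 1..2 * m - 1. \<Sum>l = 1..p.
        real ((2 * m - 1) choose (p - l)) * ((- 1) ^ l / real l) *
        (- real CARD('n)) ^ (2 * m - 1 - p) * fact p * C_coeff CARD('n) p k)
     + (\<Sum>p = (2 * m - 1) + 1..k * CARD('n).
        fact (2 * m - 1) * fact (p - (2 * m - 1) - 1) / real CARD('n) ^ (p - (2 * m - 1))
        * C_coeff CARD('n) p k))"
proof -
  define q where "q = 2 * m - 1"
  define d where "d = k * CARD('n)"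
  define P where "P = (\<Sum>p\<le>d. smult (C_coeff CARD('n) p k) (monom 1 p))"
  have poly_P: "poly P t = (\<Sum>p\<le>d. C_coeff CARD('n) p k * t ^ p)" for t
    by (simp add: P_def poly_sum poly_monom)
  have deg_P: "degree P \<le> d"
    unfolding P_def by (rule degree_sum_le) (simp_all add: degree_monom_eq)
  have wm: "(\<lambda>U. norm (det_at_1 U) ^ (2 * k)) \<in> borel_measurable \<mu>"
    by (intro borel_measurable_power measurable_compose[OF measurable_det_at_1 borel_measurable_norm])
  have "(\<integral>U. norm (det_at_1 U) ^ (2 * k) * \<bar>cot_sum U\<bar> ^ (2 * m - 1) \<partial>\<mu>) =
    2 * (-1) ^ m / pi * F_moment \<mu> 0 (real k) *
      (\<Sum>j=1..d. coeff ((shifted_pderiv (real CARD('n)) ^^ (2 * m - 1)) P) j * fact (j - 1) / real CARD('n) ^ j)"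
  proof (rule absolute_odd_moment[OF finite_measure_axioms wm measurable_cot_sum])
    show "\<bar>norm (det_at_1 U) ^ (2 * k) * cot_sum U ^ j\<bar> \<le> (2 * (real CARD('n) * 2 ^ CARD('n))) ^ (2 * k)"
      if "U \<in> space \<mu>" "j \<le> 2 * m - 1" for U j
      using that m by (intro weighted_cot_sum_bound k) (auto simp: space_haar)
    show "(\<integral>U. norm (det_at_1 U) ^ (2 * k) * cos (t * cot_sum U) \<partial>\<mu>) = F_moment \<mu> 0 (real k) * (exp (- (real CARD('n) * t)) * poly P t)"
      if "0 \<le> t" for t
      unfolding poly_P d_def by (rule characteristic_function[OF k that])
  qed (use m deg_P in \<open>auto simp: Suc_leI\<close>)
  also have "(\<Sum>j=1..d. coeff ((shifted_pderiv (real CARD('n)) ^^ (2 * m - 1)) P) j * fact (j - 1) / real CARD('n) ^ j) =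
    (\<Sum>p\<le>d. C_coeff CARD('n) p k * laplace_weight (real CARD('n)) d ((shifted_pderiv (real CARD('n)) ^^ q) (monom 1 p)))"
    unfolding laplace_weight_def[symmetric] q_def[symmetric] P_def
      shifted_pderiv_power_sum shifted_pderiv_power_smult laplace_weight_sum laplace_weight_smult ..
  also have "\<dots> = (\<Sum>p=1..q. \<Sum>l=1..p. real (q choose (p - l)) * ((-1) ^ l / real l) * (- real CARD('n)) ^ (q - p) * fact p * C_coeff CARD('n) p k)
     + (\<Sum>p=q + 1..d. fact q * fact (p - q - 1) / real CARD('n) ^ (p - q) * C_coeff CARD('n) p k)"
  proof -
    define g where "g p = (if p \<le> q then \<Sum>l=1..p. real (q choose (p - l)) * ((-1) ^ l / real l) * (- real CARD('n)) ^ (q - p) * fact p * C_coeff CARD('n) p k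
       else fact q * fact (p - q - 1) / real CARD('n) ^ (p - q) * C_coeff CARD('n) p k)" for p
    have "(\<Sum>p\<le>d. C_coeff CARD('n) p k * laplace_weight (real CARD('n)) d ((shifted_pderiv (real CARD('n)) ^^ q) (monom 1 p))) = (\<Sum>p\<le>d. g p)"
    proof (rule sum.cong[OF refl])
      fix p assume p: "p \<in> {..d}"
      show "C_coeff CARD('n) p k * laplace_weight (real CARD('n)) d ((shifted_pderiv (real CARD('n)) ^^ q) (monom 1 p)) = g p"
      proof (cases "p \<le> q")
        case True
        then have "laplace_weight (real CARD('n)) d ((shifted_pderiv (real CARD('n)) ^^ q) (monom 1 p)) =
          (\<Sum>l=1..p. real (q choose (p - l)) * ((-1) ^ l / real l) * (- real CARD('n)) ^ (q - p) * fact p)"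
          using p by (intro laplace_weight_small) auto
        then show ?thesis using True by (simp add: g_def sum_distrib_left sum_distrib_right mult_ac)
      next
        case False
        then have "laplace_weight (real CARD('n)) d ((shifted_pderiv (real CARD('n)) ^^ q) (monom 1 p)) = fact q * fact (p - q - 1) / real CARD('n) ^ (p - q)"
          using p by (intro laplace_weight_large) auto
        then show ?thesis using False by (simp add: g_def mult_ac)
      qed
    qed
    \<comment> \<open>The term p = 0 has an empty inner sum. When kN < q the first range exceeds the
      degree, but there \<open>C_coeff\<close> is 0.\<close>
    also have "\<dots> = (\<Sum>p\<in>{1..q} \<union> {q + 1..d}. g p)"
      by (rule sum.mono_neutral_cong) (auto simp: g_def d_def C_coeff_eq_0 not_less)
    also have "\<dots> = (\<Sum>p=1..q. g p) + (\<Sum>p=q + 1..d. g p)"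
      by (rule sum.union_disjoint) auto
    also have "(\<Sum>p=1..q. g p) = (\<Sum>p=1..q. \<Sum>l=1..p. real (q choose (p - l)) * ((-1) ^ l / real l) * (- real CARD('n)) ^ (q - p) * fact p * C_coeff CARD('n) p k)"
      by (rule sum.cong) (auto simp: g_def)
    also have "(\<Sum>p=q + 1..d. g p) = (\<Sum>p=q + 1..d. fact q * fact (p - q - 1) / real CARD('n) ^ (p - q) * C_coeff CARD('n) p k)"
      by (rule sum.cong) (auto simp: g_def)
    finally show ?thesis .
  qed
  finally show ?thesis unfolding F_moment_half_odd[OF k m h] q_def d_def by (simp only: times_divide_eq_left times_divide_eq_right divide_divide_eq_left mult_ac)
qed

end

theorem theorem2p2:
  fixes \<mu> :: "(complex ^ 'n ^ 'n) measure" and N m k :: nat and h :: real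
  assumes haar: "is_haar_measure \<mu>"
    and N: "N = CARD('n)"
    and m: "1 \<le> m"
    and h: "h = (2 * real m - 1) / 2"
    and k: "1 \<le> k" "real k > h - 1 / 2"
  shows "F_moment \<mu> h (real k) =
    2 * (- 1) ^ m / (2 powr (2 * h) * pi) * F_moment \<mu> 0 (real k) *
    ((\<Sum>p = 1..2 * m - 1. \<Sum>l = 1..p.
        real ((2 * m - 1) choose (p - l)) * ((- 1) ^ l / real l) *
        (- real N) ^ (2 * m - 1 - p) * fact p * C_coeff N p k)
     + (\<Sum>p = (2 * m - 1) + 1..k * N.
        fact (2 * m - 1) * fact (p - (2 * m - 1) - 1) / real N ^ (p - (2 * m - 1))
        * C_coeff N p k))"
proof -
  define z :: "complex ^ 'n ^ 'n \<Rightarrow> 'n \<Rightarrow> complex"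
    where "z U = (SOME f. char_polynomial U = (\<Prod>i\<in>UNIV. [:- f i, 1:]))" for U
  have z: "char_polynomial U = (\<Prod>i\<in>UNIV. [:- z U i, 1:])" for U
  proof -
    have "\<exists>f :: 'n \<Rightarrow> complex. char_polynomial U = (\<Prod>i\<in>UNIV. [:- f i, 1:])"
      by (rule char_polynomial_factor[of U]) (rule exI)
    then show ?thesis unfolding z_def by (rule someI_ex)
  qed
  obtain e :: "'n \<Rightarrow> nat" where e: "bij_betw e UNIV {..<CARD('n)}"
    using ex_bij_betw_finite_nat[of "UNIV :: 'n set"] by (auto simp: atLeast0LessThan)
  interpret haar_eigenvalues \<mu> z e
    by unfold_locales (rule haar z e)+
  \<comment> \<open>h - 1/2 is the integer m - 1, so the bound on k says m <= k; all moments up to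
    order 2m-1 are then covered by the weight.\<close>
  have "real m < real k + 1" using k(2) unfolding h by (simp add: field_simps)
  then have "m \<le> k" by simp
  have pow: "2 powr (2 * h) = (2 :: real) ^ (2 * m - 1)"
  proof -
    have "2 * h = real (2 * m - 1)" using m by (simp add: h of_nat_diff field_simps)
    then show ?thesis by (simp only: powr_realpow zero_less_numeral)
  qed
  show ?thesis
    unfolding N pow by (rule F_moment_half_odd_eq[OF k(1) m \<open>m \<le> k\<close> h])
qed

end
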